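(* Let $(\lambda,\chi)$ be a barrier and let $(\Lambda_{(x,h)}(\cdot))_{(x,h)\in\mathbb{R}^2}$ be a system of forward lines above $(\lambda,\chi)$. For $x\le y$ let $M(x,y)=\{\Lambda_{(z,h)}(y): z<x,\ (z,h)\in\mathbb{R}^2_\lambda\}$ and $M(x)=M(x,x)$. Almost surely, all of the following hold. (1) For all $x\in\mathbb{R}$, $M(x)$ is dense in $[\lambda(x),+\infty)$. (2) For any $x<y$, $M(x,y)$ is locally finite and unbounded. (3) For all $(x,h)\in\mathbb{R}^2_\lambda$ and $\varepsilon>0$, there exists $n\in\mathbb{N}$ such that $\tilde x_n<x$, $\Lambda_{(\tilde x_n,\tilde h_n)}(x)\in(h-\varepsilon,h)$ and, for all $y\ge x+\varepsilon$, $\Lambda_{(x,h)}(y)=\Lambda_{(\tilde x_n,\tilde h_n)}(y)$. (4) For all $x<y$, $M(x,y)=\{\Lambda_{(\tilde x_n,\tilde h_n)}(y): n\in\mathbb{N},\ \tilde x_n<x,\ (\tilde x_n,\tilde h_n)\in\mathbb{R}^2_\lambda\}$. (5) For any $(x,h)\in\mathbb{R}^2_\lambda$, the function $y\mapsto\Lambda_{(x,h)}(y)$ is continuous on $[x,+\infty)$.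
   Context: Fix $v>0$; all Brownian motions have variance $v$, i.e. $\mathrm{Var}(W_y-W_z)=v|y-z|$. Conventions: $\inf\emptyset=+\infty$; $\mathbb{D}$ is the set of dyadic rationals. A barrier is a couple $(\lambda,\chi)$ where $\lambda:\mathbb{R}\to\mathbb{R}$ is a random continuous function and $\chi$ is a real random variable. Let $\mathbb{R}^2_\lambda=\{(x,h)\in\mathbb{R}^2: h>\lambda(x)\}$. $(\lambda,\chi)$-RAB. For $(x,h)\in\mathbb{R}^2$, $x'\le x$ and $(W_y)_{y\ge x'}$ a Brownian motion independent of $(\lambda,\chi)$, the $(\lambda,\chi)$-RAB $(R_y)_{y\ge x}$ starting from $(x,h)$ and driven by $W$ is undefined if $h\le\lambda(x)$. If $h>\lambda(x)$ and $x\ge\chi$: with $Y=\inf\{y\ge x: W_y-W_x+h=\lambda(y)\}$, $R_y=W_y-W_x+h$ for $y\in[x,Y]$ and $R_y=\lambda(y)$ for $y\ge Y$. If $h>\lambda(x)$ and $x<\chi$: with $Y=\inf\{y\in[x,\chi]: W_y-W_x+h=\lambda(y)\}$, for $y\in[x,\chi]$ set $R_y=W_y-W_x+h$ if $y\le Y$ and $R_y=W_y+\sup_{Y\le z\le y}(\lambda(z)-W_z)$ if $y\ge Y$; then with $Y'=\inf\{y\ge\chi: W_y-W_\chi+R_\chi=\lambda(y)\}$, $R_y=W_y-W_\chi+R_\chi$ for $y\in[\chi,Y']$ and $R_y=\lambda(y)$ for $y\ge Y'$. System of forward lines above $(\lambda,\chi)$: let $\{(\tilde x_n,\tilde h_n)\}_{n\in\mathbb{N}}$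 be an enumeration of $\mathbb{D}^2$. Let $R_n$, $n\in\mathbb{N}$, be $(\lambda,\chi)$-RABs starting from $(\tilde x_n,\tilde h_n)$ driven by independent Brownian motions (jointly independent of $(\lambda,\chi)$). $(\Lambda_{(\tilde x_n,\tilde h_n)}(\cdot))_{n\in\mathbb{N}}$ is constructed inductively as a countable family of independent coalescing $(\lambda,\chi)$-RABs: $\Lambda_{(\tilde x_n,\tilde h_n)}$ is undefined if $R_n$ is, and otherwise it equals $R_n$ up to the first point $\omega_n\ge\tilde x_n$ at which $R_n$ meets one of the previously constructed (defined) lines $\Lambda_{(\tilde x_k,\tilde h_k)}$, $k<n$, and on $[\omega_n,+\infty)$ it equals the line of smallest index $k<n$ met at $\omega_n$. Then, for any $(x,h)\in\mathbb{R}^2$, $\Lambda_{(x,h)}$ is undefined if $h\le\lambda(x)$, and if $h>\lambda(x)$ it is defined on $[x,+\infty)$ by $\Lambda_{(x,h)}(y)=\sup\{\Lambda_{(\tilde x_n,\tilde h_n)}(y): \tilde x_n<x,\ \Lambda_{(\tilde x_n,\tilde h_n)}(x)<h\}$ (only defined lines are considered; almost surely this set is never empty, and this definition is compatible with that of the $\Lambda_{(\tilde x_n,\tilde h_n)}$). *)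

theory Defs
  imports "HOL-Probability.Probability"
begin

definition dyadic_rationals :: "real set"
  where "dyadic_rationals = {of_int k / 2 ^ n | (k :: int) (n :: nat). True}"

text \<open>
  The strict epigraph of \<open>l\<close>.  Lines are represented by total functions; a line starting at a
  point \<open>p\<close> counts as defined iff \<open>p \<in> strict_epigraph l\<close>, and only its values at times not earlier than
  its starting time are meaningful.
\<close>

definition strict_epigraph :: "(real \<Rightarrow> real) \<Rightarrow> (real \<times> real) set"
  where "strict_epigraph l = {(x, h). l x < h}"

text \<open>First time in a set \<open>S\<close>; it is \<open>\<infinity>\<close> if \<open>S\<close> is empty.\<close>

definition first_time :: "real set \<Rightarrow> ereal"
  where "first_time S = Inf (ereal ` S)"


subsection \<open>Barriers and Brownian motions\<close>

definition barrier :: "'a measure \<Rightarrow> ('a \<Rightarrow> real \<Rightarrow> real) \<Rightarrow> ('a \<Rightarrow> real) \<Rightarrow> bool"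
  where "barrier M lam chi \<longleftrightarrow>
    (\<forall>\<omega>\<in>space M. continuous_on UNIV (lam \<omega>)) \<and>
    (\<forall>x. (\<lambda>\<omega>. lam \<omega> x) \<in> borel_measurable M) \<and>
    chi \<in> borel_measurable M"

text \<open>
  Brownian motion of variance \<open>v\<close> indexed by \<open>{a..}\<close>.  Its value at time \<open>a\<close> is left arbitrary.
  Note that \<open>normal_density\<close> is parametrised by the standard deviation.
\<close>

definition brownian_motion :: "'a measure \<Rightarrow> real \<Rightarrow> real \<Rightarrow> ('a \<Rightarrow> real \<Rightarrow> real) \<Rightarrow> bool"
  where "brownian_motion M v a W \<longleftrightarrow>
    (\<forall>y\<ge>a. (\<lambda>\<omega>. W \<omega> y) \<in> borel_measurable M) \<and>
    (AE \<omega> in M. continuous_on {a..} (W \<omega>)) \<and>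
    (\<forall>z y. a \<le> z \<longrightarrow> z < y \<longrightarrow>
      distributed M lborel (\<lambda>\<omega>. W \<omega> y - W \<omega> z)
        (\<lambda>u. ennreal (normal_density 0 (sqrt (v * (y - z))) u))) \<and>
    (\<forall>t :: nat \<Rightarrow> real. a \<le> t 0 \<longrightarrow> mono t \<longrightarrow>
      prob_space.indep_vars M (\<lambda>_. borel) (\<lambda>i \<omega>. W \<omega> (t (Suc i)) - W \<omega> (t i)) UNIV)"

text \<open>
  Joint independence of the barrier and the processes \<open>W n\<close>, each indexed by \<open>{a n..}\<close>.  It is
  phrased with the generated \<open>\<sigma>\<close>-algebras because \<open>indep_vars\<close> requires all variables to
  have values in the same type.
\<close>

definition jointly_independent ::
    "'a measure \<Rightarrow> ('a \<Rightarrow> real \<Rightarrow> real) \<Rightarrow> ('a \<Rightarrow> real) \<Rightarrow> (nat \<Rightarrow> real)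
      \<Rightarrow> (nat \<Rightarrow> 'a \<Rightarrow> real \<Rightarrow> real) \<Rightarrow> bool"
  where "jointly_independent M lam chi a W \<longleftrightarrow>
    prob_space.indep_sets M
      (\<lambda>i. case i of
          None \<Rightarrow> sets (vimage_algebra (space M) (\<lambda>\<omega>. (lam \<omega>, chi \<omega>))
                          (PiM UNIV (\<lambda>_. borel) \<Otimes>\<^sub>M borel))
        | Some n \<Rightarrow> sets (vimage_algebra (space M) (\<lambda>\<omega>. restrict (W n \<omega>) {a n..})
                          (PiM {a n..} (\<lambda>_. borel))))
      UNIV"


subsection \<open>Reflected/absorbed paths\<close>

text \<open>
  The path that starts at height \<open>r\<close> at time \<open>s\<close>, follows the increments of \<open>w\<close>, and is absorbed
  by \<open>l\<close> when it hits it.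
\<close>

definition absorbed_path ::
    "(real \<Rightarrow> real) \<Rightarrow> (real \<Rightarrow> real) \<Rightarrow> real \<Rightarrow> real \<Rightarrow> real \<Rightarrow> real"
  where "absorbed_path l w s r y =
    (let Y = first_time {u. s \<le> u \<and> w u - w s + r = l u}
     in if ereal y \<le> Y then w y - w s + r else l y)"

text \<open>The path started from \<open>(x, h)\<close> and reflected above \<open>l\<close>, for times in \<open>{x..c}\<close>.\<close>

definition reflected_path ::
    "(real \<Rightarrow> real) \<Rightarrow> real \<Rightarrow> (real \<Rightarrow> real) \<Rightarrow> real \<Rightarrow> real \<Rightarrow> real \<Rightarrow> real"
  where "reflected_path l c w x h y =
    (let Y = first_time {u. x \<le> u \<and> u \<le> c \<and> w u - w x + h = l u}
     in if ereal y \<le> Y then w y - w x + h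
        else w y + (SUP z\<in>{real_of_ereal Y..y}. l z - w z))"

definition rab ::
    "(real \<Rightarrow> real) \<Rightarrow> real \<Rightarrow> (real \<Rightarrow> real) \<Rightarrow> real \<times> real \<Rightarrow> real \<Rightarrow> real"
  where "rab l c w = (\<lambda>(x, h) y.
    if c \<le> x then absorbed_path l w x h y
    else if y \<le> c then reflected_path l c w x h y
    else absorbed_path l w c (reflected_path l c w x h c) y)"


subsection \<open>Forward lines\<close>

text \<open>
  Here \<open>q\<close> lists the starting points, \<open>r\<close> is the \<open>n\<close>-th path before coalescence, and \<open>L k\<close> for
  \<open>k < n\<close> are the lines already constructed.  \<open>met_lines\<close> are the indices of the lines met by
  \<open>r\<close> at time \<open>y\<close>.
\<close>

definition met_lines ::
    "(real \<Rightarrow> real) \<Rightarrow> (nat \<Rightarrow> real \<times> real) \<Rightarrow> nat \<Rightarrow> (real \<Rightarrow> real) \<Rightarrow> (nat \<Rightarrow> real \<Rightarrow> real)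
      \<Rightarrow> real \<Rightarrow> nat set"
  where "met_lines l q n r L y =
    {k. k < n \<and> q k \<in> strict_epigraph l \<and> fst (q k) \<le> y \<and> r y = L k y}"

definition coalesce ::
    "(real \<Rightarrow> real) \<Rightarrow> (nat \<Rightarrow> real \<times> real) \<Rightarrow> nat \<Rightarrow> (real \<Rightarrow> real) \<Rightarrow> (nat \<Rightarrow> real \<Rightarrow> real)
      \<Rightarrow> real \<Rightarrow> real"
  where "coalesce l q n r L y =
    (let T = first_time {u. fst (q n) \<le> u \<and> met_lines l q n r L u \<noteq> {}}
     in if ereal y \<le> T then r y
        else L (LEAST k. k \<in> met_lines l q n r L (real_of_ereal T)) y)"

text \<open>\<open>first_lines l q R n\<close> contains the lines of index less than \<open>n\<close>.\<close>

primrec first_lines ::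
    "(real \<Rightarrow> real) \<Rightarrow> (nat \<Rightarrow> real \<times> real) \<Rightarrow> (nat \<Rightarrow> real \<Rightarrow> real) \<Rightarrow> nat
      \<Rightarrow> nat \<Rightarrow> real \<Rightarrow> real"
  where
    "first_lines l q R 0 = (\<lambda>_ _. 0)"
  | "first_lines l q R (Suc n) =
       (first_lines l q R n)(n := coalesce l q n (R n) (first_lines l q R n))"

definition coalescing_line ::
    "(real \<Rightarrow> real) \<Rightarrow> (nat \<Rightarrow> real \<times> real) \<Rightarrow> (nat \<Rightarrow> real \<Rightarrow> real) \<Rightarrow> nat \<Rightarrow> real \<Rightarrow> real"
  where "coalescing_line l q R n = first_lines l q R (Suc n) n"

text \<open>
  \<open>\<Lambda>\<close> is a system of forward lines above the barrier \<open>(lam, chi)\<close>, built from the enumeration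
  \<open>q\<close> of the dyadic points.  Nothing is required of \<open>\<Lambda> \<omega> (x, h) y\<close> where the line is
  undefined, that is, for \<open>(x, h) \<notin> strict_epigraph (lam \<omega>)\<close> or \<open>y < x\<close>.
\<close>

definition forward_line_system ::
    "'a measure \<Rightarrow> real \<Rightarrow> ('a \<Rightarrow> real \<Rightarrow> real) \<Rightarrow> ('a \<Rightarrow> real) \<Rightarrow> (nat \<Rightarrow> real \<times> real)
      \<Rightarrow> ('a \<Rightarrow> real \<times> real \<Rightarrow> real \<Rightarrow> real) \<Rightarrow> bool"
  where "forward_line_system M v lam chi q \<Lambda> \<longleftrightarrow>
    bij_betw q UNIV (dyadic_rationals \<times> dyadic_rationals) \<and>
    (\<exists>a W.
      (\<forall>n. a n \<le> fst (q n) \<and> brownian_motion M v (a n) (W n)) \<and>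
      jointly_independent M lam chi a W \<and>
      (\<forall>\<omega>\<in>space M.
        let L = coalescing_line (lam \<omega>) q (\<lambda>n. rab (lam \<omega>) (chi \<omega>) (W n \<omega>) (q n))
        in \<forall>(x, h)\<in>strict_epigraph (lam \<omega>). \<forall>y\<ge>x.
             \<Lambda> \<omega> (x, h) y =
               Sup {L n y | n. q n \<in> strict_epigraph (lam \<omega>) \<and> fst (q n) < x \<and> L n x < h}))"

text \<open>
  For a realisation \<open>l\<close> of the barrier and \<open>F\<close> of the lines: the values at time \<open>y\<close> of the lines
  started before time \<open>x\<close>.
\<close>

definition line_values ::
    "(real \<Rightarrow> real) \<Rightarrow> (real \<times> real \<Rightarrow> real \<Rightarrow> real) \<Rightarrow> real \<Rightarrow> real \<Rightarrow> real set"
  where "line_values l F x y = {F (z, h) y | z h. z < x \<and> (z, h) \<in> strict_epigraph l}"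

definition locally_finite_set :: "real set \<Rightarrow> bool"
  where "locally_finite_set S \<longleftrightarrow> (\<forall>B. bounded B \<longrightarrow> finite (S \<inter> B))"

end

theory Submission
  imports Defs
begin

text \<open>
  By coalescence, everything follows from four almost sure properties of the countably many lines
  started at dyadic points: they are dense at every time, they reach arbitrarily high values, those
  that pass below a given level at a time \<open>s\<close> take finitely many values at a time \<open>t > s\<close>, and each of
  them is joined at once by lines started just below it.

  A line follows one driving motion at a time, and the index of this motion at time \<open>t\<close> is known at
  time \<open>t\<close>.  Sampled on a fine grid, a line away from the barrier is therefore a Gaussian random walk,
  up to an error that only comes from the finitely many cells in which the index changes; the
  difference of two lines that have not met is dominated in the same way by a Gaussian walk of twice
  the variance, because a reflection pushes the lower line towards the upper one.  Levy's maximal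
  inequality and the reflection principle yield two estimates: a line exits a ball of radius \<open>r\<close>
  during \<open>d\<close> units of time with probability at most of order \<open>d\<^sup>2 / r ^ 4\<close>, and two lines at distance
  \<open>h\<close> stay apart during \<open>d\<close> units of time with probability at most of order \<open>h / sqrt d\<close>.  The first
  one is summable enough to control all times at once, and the second one bounds the expected number
  of values left by a grid of mesh \<open>h\<close> uniformly in \<open>h\<close>.
\<close>

subsection \<open>Paths reflected or absorbed by a barrier\<close>

text \<open>The meeting times of lines are random, and the motions are never stopped there: only
  increments over deterministic grid cells are used, together with the least index
  \<open>idx\<close> of a line through the current point. This index never increases, so the line
  \<open>n\<close> changes its motion at most \<open>n\<close> times, and each change costs at most
  twice the oscillation within one cell. For a fixed path this vanishes as the mesh tends to 0; so
  the grids are refined path by path, and probabilities enter through a Fatou argument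
  (\<open>covered_liminf\<close>).

  The power in the exit estimate comes from the union over times. A bounded time interval has about
  \<open>2 ^ m\<close> steps of length \<open>2 ^ (- m)\<close>, so a probability of the order of
  one step would not suffice; the fourth Gaussian moment gives its square.

  The barrier counts as known from the start, at all past and future times. Conditioning on the past
  therefore leaves the later increments Gaussian, whatever the barrier does.\<close>

lemma first_time_ge_iff: "ereal y \<le> first_time S \<longleftrightarrow> (\<forall>u\<in>S. y \<le> u)"
  by (auto simp: first_time_def le_INF_iff)

lemma first_time_attained:
  fixes S :: "real set"
  assumes "closed S" "S \<noteq> {}" "\<And>u. u \<in> S \<Longrightarrow> s \<le> u"
  obtains T where "T \<in> S" "\<And>u. u \<in> S \<Longrightarrow> T \<le> u" "first_time S = ereal T"
proof
  have bdd: "bdd_below S" using assms(3) by (auto simp: bdd_below_def)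
  show T: "Inf S \<in> S" using assms bdd by (intro closed_contains_Inf)
  show lb: "Inf S \<le> u" if "u \<in> S" for u using that bdd by (rule cInf_lower)
  show "first_time S = ereal (Inf S)"
    unfolding first_time_def using T lb by (intro antisym INF_lower INF_greatest) auto
qed

section \<open>Running suprema and one-sided Skorokhod reflection\<close>

definition running_sup :: "(real \<Rightarrow> real) \<Rightarrow> real \<Rightarrow> real \<Rightarrow> real"
  where "running_sup f x y = (SUP z\<in>{x..y}. f z)"

lemma running_sup_attained:
  assumes "continuous_on UNIV f" "x \<le> y"
  obtains z where "x \<le> z" "z \<le> y" "running_sup f x y = f z"
    "\<And>u. x \<le> u \<Longrightarrow> u \<le> y \<Longrightarrow> f u \<le> f z"
proof -
  have "continuous_on {x..y} f" using assms(1) continuous_on_subset by blast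
  then obtain z where z: "z \<in> {x..y}" "\<And>u. u \<in> {x..y} \<Longrightarrow> f u \<le> f z"
    using continuous_attains_sup[of "{x..y}" f] assms(2) by auto
  have "running_sup f x y = f z"
    unfolding running_sup_def using z by (intro cSup_eq_maximum) auto
  with z that show ?thesis by auto
qed

lemma running_sup_upper:
  assumes "continuous_on UNIV f" "x \<le> u" "u \<le> y"
  shows "f u \<le> running_sup f x y"
  using running_sup_attained[OF assms(1), of x y] assms by (metis order_trans)

lemma running_sup_le_iff:
  assumes "continuous_on UNIV f" "x \<le> y"
  shows "running_sup f x y \<le> c \<longleftrightarrow> (\<forall>u\<in>{x..y}. f u \<le> c)"
  using running_sup_attained[OF assms] running_sup_upper[OF assms(1)]
  by (metis atLeastAtMost_iff order_trans)

lemma running_sup_split: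
  assumes "continuous_on UNIV f" "x \<le> y" "y \<le> y'"
  shows "running_sup f x y' = max (running_sup f x y) (running_sup f y y')"
proof (rule antisym)
  have xy': "x \<le> y'" using assms by simp
  show "running_sup f x y' \<le> max (running_sup f x y) (running_sup f y y')"
    unfolding running_sup_le_iff[OF assms(1) xy']
  proof
    fix u assume u: "u \<in> {x..y'}"
    show "f u \<le> max (running_sup f x y) (running_sup f y y')"
      using u running_sup_upper[OF assms(1), of x u y] running_sup_upper[OF assms(1), of y u y']
      by (cases "u \<le> y") (auto simp: le_max_iff_disj)
  qed
  show "max (running_sup f x y) (running_sup f y y') \<le> running_sup f x y'"
    using assms running_sup_upper[OF assms(1), of x _ y']
    by (auto simp: running_sup_le_iff)
qed

lemma running_sup_mono:
  assumes "continuous_on UNIV f" "x \<le> y" "y \<le> y'"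
  shows "running_sup f x y \<le> running_sup f x y'"
  using running_sup_split[OF assms] by simp

lemma running_sup_shift:
  assumes "continuous_on UNIV f" "x \<le> y"
  shows "running_sup (\<lambda>z. f z + c) x y = running_sup f x y + c"
proof -
  have "continuous_on UNIV (\<lambda>z. f z + c)" using assms(1) by (intro continuous_intros)
  note g = this
  have "running_sup (\<lambda>z. f z + c) x y \<le> running_sup f x y + c"
    unfolding running_sup_le_iff[OF g assms(2)] using running_sup_upper[OF assms(1)] by auto
  moreover have "running_sup f x y \<le> running_sup (\<lambda>z. f z + c) x y - c"
    unfolding running_sup_le_iff[OF assms] using running_sup_upper[OF g] by (force simp: le_diff_eq)
  ultimately show ?thesis by simp
qed

lemma running_sup_continuous:
  assumes f: "continuous_on UNIV f"
  shows "continuous_on {x..} (running_sup f x)"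
proof (subst continuous_on_iff, intro ballI allI impI)
  fix y0 e :: real assume y0: "y0 \<in> {x..}" and e: "e > 0"
  obtain d where d: "d > 0" "\<And>z. \<bar>z - y0\<bar> < d \<Longrightarrow> \<bar>f z - f y0\<bar> < e / 4"
    using f e unfolding continuous_on_iff dist_real_def
    by (metis UNIV_I zero_less_divide_iff zero_less_numeral)
  \<comment> \<open>All values of \<open>f\<close> on \<open>{a..b}\<close> lie within
    \<open>e / 4\<close> of \<open>f y0\<close>, hence within \<open>e / 2\<close> of
    \<open>f a\<close>; so the supremum gains at most \<open>e / 2\<close> between \<open>a\<close>
    and \<open>b\<close>.\<close>
  have key: "running_sup f x b \<le> running_sup f x a + e / 2"
    if "x \<le> a" "a \<le> b" "\<bar>a - y0\<bar> < d" "\<bar>b - y0\<bar> < d" for a b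
  proof -
    have "f u \<le> running_sup f x a + e / 2" if u: "u \<in> {a..b}" for u
    proof -
      have "\<bar>f u - f y0\<bar> < e / 4" "\<bar>f a - f y0\<bar> < e / 4"
        using d(2)[of u] d(2)[of a] u \<open>\<bar>a - y0\<bar> < d\<close> \<open>\<bar>b - y0\<bar> < d\<close> by auto
      moreover have "f a \<le> running_sup f x a" using that \<open>x \<le> a\<close> by (intro running_sup_upper f) auto
      ultimately show ?thesis by linarith
    qed
    then have "running_sup f a b \<le> running_sup f x a + e / 2"
      using \<open>a \<le> b\<close> by (simp add: running_sup_le_iff[OF f])
    then show ?thesis using running_sup_split[OF f \<open>x \<le> a\<close> \<open>a \<le> b\<close>] e by simp
  qed
  show "\<exists>d>0. \<forall>y\<in>{x..}. dist y y0 < d \<longrightarrow> dist (running_sup f x y) (running_sup f x y0) < e"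
  proof (intro exI conjI ballI impI)
    fix y assume y: "y \<in> {x..}" "dist y y0 < d"
    show "dist (running_sup f x y) (running_sup f x y0) < e"
    proof (cases "y \<le> y0")
      case True
      then show ?thesis
        using key[of y y0] y y0 d e running_sup_mono[OF f, of x y y0] by (auto simp: dist_real_def)
    next
      case False
      then show ?thesis
        using key[of y0 y] y y0 d e running_sup_mono[OF f, of x y0 y] by (auto simp: dist_real_def)
    qed
  qed (use d in auto)
qed

text \<open>The Skorokhod reflection above \<open>l\<close> of the path started at \<open>h\<close>
  with the increments of \<open>w\<close>: the added term is the least nondecreasing one that keeps
  the path above \<open>l\<close>. Unlike \<open>reflected_path\<close>, it does not refer to a
  hitting time.\<close>

definition push :: "(real \<Rightarrow> real) \<Rightarrow> (real \<Rightarrow> real) \<Rightarrow> real \<Rightarrow> real \<Rightarrow> real \<Rightarrow> real"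
  where "push l w x h y = w y + max (h - w x) (running_sup (\<lambda>z. l z - w z) x y)"

lemma hitting_closed:
  fixes l w :: "real \<Rightarrow> real"
  assumes "continuous_on UNIV l" "continuous_on UNIV w" "closed I"
  shows "closed {u. u \<in> I \<and> w u + c = l u}"
proof -
  have "closed ({u. w u + c = l u} \<inter> I)"
    using assms by (intro closed_Int closed_Collect_eq continuous_intros)
  moreover have "{u. w u + c = l u} \<inter> I = {u. u \<in> I \<and> w u + c = l u}" by auto
  ultimately show ?thesis by simp
qed

lemma no_hit_below:
  fixes f g :: "real \<Rightarrow> real"
  assumes "continuous_on {a..b} f" "continuous_on {a..b} g" "g a < f a"
    "\<And>u. a \<le> u \<Longrightarrow> u \<le> b \<Longrightarrow> f u \<noteq> g u" "a \<le> b"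
  shows "g b < f b"
proof (rule ccontr)
  assume "\<not> g b < f b"
  then have "\<exists>u\<ge>a. u \<le> b \<and> f u - g u = 0"
    using assms(3,5) by (intro IVT2' continuous_intros assms) auto
  then show False using assms(4) by auto
qed

text \<open>Up to the first hit \<open>Y\<close> the supremum of \<open>l - w\<close> does not
  exceed \<open>h - w x\<close>, which therefore is the maximum in \<open>push\<close>. At
  \<open>Y\<close> the two agree, and from then on the maximum is the supremum over
  \<open>{Y..y}\<close>.\<close>

lemma reflected_path_eq:
  assumes l: "continuous_on UNIV l" and w: "continuous_on UNIV w"
    and h: "l x < h" and y: "x \<le> y" "y \<le> c"
  shows "reflected_path l c w x h y = push l w x h y"
proof -
  define S where "S = {u. x \<le> u \<and> u \<le> c \<and> w u - w x + h = l u}"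
  define f where "f = (\<lambda>z. l z - w z)"
  have f: "continuous_on UNIV f" unfolding f_def by (intro continuous_intros l w)
  have S_eq: "S = {u. u \<in> {x..c} \<and> w u + (h - w x) = l u}" unfolding S_def by auto
  have clS: "closed S" unfolding S_eq by (intro hitting_closed l w) auto
  have below: "f u \<le> h - w x" if "x \<le> u" "u \<le> c" "\<And>z. z \<in> S \<Longrightarrow> u \<le> z" for u
  proof (cases "u \<in> S")
    case True then show ?thesis by (simp add: S_def f_def)
  next
    case False
    have cs: "continuous_on {x..u} (\<lambda>u. w u - w x + h)" "continuous_on {x..u} l"
      using l w by (auto intro!: continuous_intros intro: continuous_on_subset)
    have "l u < w u - w x + h"
    proof (rule no_hit_below[OF cs])
      fix z assume z: "x \<le> z" "z \<le> u"
      show "w z - w x + h \<noteq> l z"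
      proof
        assume "w z - w x + h = l z"
        with z that have "z \<in> S" by (auto simp: S_def)
        with that(3)[of z] z False show False by auto
      qed
    qed (use h that in auto)
    then show ?thesis by (simp add: f_def)
  qed
  show ?thesis
  proof (cases "\<forall>u\<in>S. y \<le> u")
    case True
    have "running_sup f x y \<le> h - w x"
      using below y True by (subst running_sup_le_iff[OF f y(1)]) force
    with True show ?thesis
      unfolding reflected_path_def push_def f_def S_def[symmetric]
      by (simp add: first_time_ge_iff)
  next
    case False
    then obtain u0 where u0: "u0 \<in> S" "u0 < y" by auto
    then have "S \<noteq> {}" by auto
    moreover have "x \<le> u" if "u \<in> S" for u using that by (simp add: S_def)
    ultimately obtain Y where Y: "Y \<in> S" "\<And>u. u \<in> S \<Longrightarrow> Y \<le> u" "first_time S = ereal Y"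
      using first_time_attained[OF clS] by metis
    have Yy: "x \<le> Y" "Y \<le> y" "Y \<le> c"
      using Y(1) Y(2)[OF u0(1)] u0(2) by (simp_all add: S_def)
    have "running_sup f x Y \<le> h - w x"
      using below Yy Y by (subst running_sup_le_iff[OF f Yy(1)]) force
    moreover have "h - w x = f Y" using Y by (auto simp: S_def f_def)
    moreover have "f Y \<le> running_sup f Y y" using Yy by (intro running_sup_upper f) auto
    ultimately have "max (h - w x) (running_sup f x y) = running_sup f Y y"
      using running_sup_split[OF f Yy(1,2)] by auto
    moreover have "reflected_path l c w x h y = w y + running_sup f Y y"
      unfolding reflected_path_def S_def[symmetric] running_sup_def f_def
    proof -
      \<comment> \<open>At \<open>y = Y\<close> the definition takes its free branch; both branches
        have the same value there.\<close>
      have yY: "y = Y" if "ereal y \<le> ereal Y" using that Yy by simp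
      have "w Y + running_sup f Y Y = w Y - w x + h"
        using running_sup_attained[OF f order_refl[of Y]] \<open>h - w x = f Y\<close>
        by (metis add_diff_eq add.commute diff_add_eq order_antisym)
      then show "(let Y = first_time S in if ereal y \<le> Y then w y - w x + h
          else w y + (SUP z\<in>{real_of_ereal Y..y}. l z - w z)) = w y + (SUP z\<in>{Y..y}. l z - w z)"
        using yY unfolding Y(3) by (auto simp: running_sup_def f_def)
    qed
    ultimately show ?thesis by (simp add: push_def f_def)
  qed
qed

text \<open>At the first hit itself the free branch of \<open>absorbed_path\<close> applies, but its
  value is \<open>l y\<close>. So only the existence of a hit up to \<open>y\<close>
  matters.\<close>

lemma absorbed_path_eq:
  assumes l: "continuous_on UNIV l" and w: "continuous_on UNIV w" and y: "s \<le> y"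
  shows "absorbed_path l w s r y =
    (if \<exists>u\<in>{s..y}. w u - w s + r = l u then l y else w y - w s + r)"
  unfolding absorbed_path_def Let_def first_time_ge_iff
  using y by (auto dest!: order_antisym)

text \<open>A motion is continuous only from the time \<open>a n\<close> on. This lets it be
  replaced by a path that is continuous on the whole line and agrees with it from the starting point
  on.\<close>

lemma rab_cong:
  assumes "\<And>u. x \<le> u \<Longrightarrow> w u = w' u" "x \<le> y"
  shows "rab l c w (x, h) y = rab l c w' (x, h) y"
proof -
  have a: "absorbed_path l w s r z = absorbed_path l w' s r z" if "x \<le> s" "x \<le> z" for s r z
  proof -
    have "{u. s \<le> u \<and> w u - w s + r = l u} = {u. s \<le> u \<and> w' u - w' s + r = l u}"
      using assms(1) that by (metis order_trans)
    then show ?thesis unfolding absorbed_path_def using assms(1) that by simp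
  qed
  have b: "reflected_path l c w x h z = reflected_path l c w' x h z" if "x \<le> z" for z
  proof -
    let ?S = "\<lambda>w. {u. x \<le> u \<and> u \<le> c \<and> w u - w x + h = l u}"
    have S: "?S w = ?S w'" using assms(1) by auto
    have "(SUP z\<in>{real_of_ereal (first_time (?S w'))..z}. l z - w z) =
        (SUP z\<in>{real_of_ereal (first_time (?S w'))..z}. l z - w' z)"
      if "\<not> ereal z \<le> first_time (?S w')"
    proof (rule SUP_cong)
      fix u assume u: "u \<in> {real_of_ereal (first_time (?S w'))..z}"
      have "first_time (?S w') < ereal z" using that by simp
      moreover have "ereal x \<le> first_time (?S w')" by (simp add: first_time_ge_iff)
      ultimately have "x \<le> real_of_ereal (first_time (?S w'))"
        by (cases "first_time (?S w')") auto
      then show "l u - w u = l u - w' u" using assms(1) u by auto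
    qed simp
    then show ?thesis
      unfolding reflected_path_def Let_def S using assms(1) \<open>x \<le> z\<close> by auto
  qed
  show ?thesis
    using a[of _ y] b assms(2) by (auto simp: rab_def)
qed

context
  fixes l w :: "real \<Rightarrow> real" and c x h :: real
  assumes l: "continuous_on UNIV l" and w: "continuous_on UNIV w" and h: "l x < h"
begin

lemma push_start: "push l w x h x = h"
proof -
  have f: "continuous_on UNIV (\<lambda>z. l z - w z)" by (intro continuous_intros l w)
  have "running_sup (\<lambda>z. l z - w z) x x \<le> h - w x"
    using h by (subst running_sup_le_iff[OF f order_refl]) auto
  then show ?thesis by (simp add: push_def)
qed

lemma push_continuous: "continuous_on {x..} (push l w x h)"
proof -
  have f: "continuous_on UNIV (\<lambda>z. l z - w z)" by (intro continuous_intros l w)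
  show ?thesis
    unfolding push_def[abs_def] using running_sup_continuous[OF f, of x] w
    by (intro continuous_intros) (auto intro: continuous_on_subset)
qed

lemma push_ge:
  assumes "x \<le> y"
  shows "l y \<le> push l w x h y"
proof -
  have f: "continuous_on UNIV (\<lambda>z. l z - w z)" by (intro continuous_intros l w)
  have "l y - w y \<le> running_sup (\<lambda>z. l z - w z) x y"
    by (rule running_sup_upper[OF f assms order_refl])
  then show ?thesis by (simp add: push_def)
qed

lemma push_increment_ge:
  assumes "x \<le> u" "u \<le> v"
  shows "w v - w u \<le> push l w x h v - push l w x h u"
proof -
  have f: "continuous_on UNIV (\<lambda>z. l z - w z)" by (intro continuous_intros l w)
  show ?thesis using running_sup_mono[OF f assms] by (simp add: push_def)
qed

text \<open>If the reflection term grew between \<open>u\<close> and \<open>v\<close>, the path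
  would touch \<open>l\<close> at the point \<open>z\<close> of \<open>{u..v}\<close> where
  \<open>l - w\<close> is maximal.\<close>

lemma push_free:
  assumes uv: "x \<le> u" "u \<le> v" and above: "\<And>z. u \<le> z \<Longrightarrow> z \<le> v \<Longrightarrow> l z < push l w x h z"
  shows "push l w x h v - push l w x h u = w v - w u"
proof -
  define f where "f = (\<lambda>z. l z - w z)"
  have f: "continuous_on UNIV f" unfolding f_def by (intro continuous_intros l w)
  have "max (h - w x) (running_sup f x v) = max (h - w x) (running_sup f x u)"
  proof (rule ccontr)
    assume ne: "\<not> ?thesis"
    obtain z where z: "u \<le> z" "z \<le> v" "running_sup f u v = f z"
      using running_sup_attained[OF f uv(2)] by metis
    have "max (h - w x) (running_sup f x u) < f z"
      using ne z(3) running_sup_split[OF f uv] by auto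
    moreover have "running_sup f x z \<le> running_sup f x v"
      using z uv by (intro running_sup_mono f) auto
    ultimately have "max (h - w x) (running_sup f x z) \<le> f z"
      using z(3) running_sup_split[OF f uv] by auto
    moreover have "push l w x h z = w z + max (h - w x) (running_sup f x z)" "f z = l z - w z"
      by (simp_all add: push_def f_def)
    ultimately have "push l w x h z \<le> l z" by (smt (verit))
    with above[OF z(1,2)] show False by simp
  qed
  then show ?thesis by (simp add: push_def f_def)
qed

text \<open>\<open>max x c\<close> is the time at which reflection turns into absorption. For
  \<open>c \<le> x\<close> the reflected phase shrinks to the single time \<open>x\<close>, where
  \<open>push\<close> has the value \<open>h\<close>, so one formula covers all cases.\<close>

lemma rab_eq:
  assumes y: "x \<le> y"
  shows "rab l c w (x, h) y =
    (if y \<le> max x c then push l w x h y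
     else if \<exists>u\<in>{max x c..y}. w u - w (max x c) + push l w x h (max x c) = l u then l y
     else w y - w (max x c) + push l w x h (max x c))"
proof -
  consider "c \<le> x" "y = x" | "c \<le> x" "x < y" | "x < c" "y \<le> c" | "x < c" "c < y"
    using y by linarith
  then show ?thesis
  proof cases
    case 1
    then show ?thesis using h
      by (auto simp: rab_def absorbed_path_eq[OF l w] push_start)
  next
    case 2
    then show ?thesis
      by (auto simp: rab_def absorbed_path_eq[OF l w] push_start max_def)
  next
    case 3
    then show ?thesis using reflected_path_eq[of l w x h y c, OF l w h] y
      by (auto simp: rab_def)
  next
    case 4
    then show ?thesis using reflected_path_eq[of l w x h c c, OF l w h]
      by (auto simp: rab_def absorbed_path_eq[OF l w])
  qed
qed

lemma rab_cases:
  defines "s \<equiv> max x c"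
  defines "f \<equiv> \<lambda>u. w u - w s + push l w x h s"
  obtains
    (free) "\<And>u. s \<le> u \<Longrightarrow> l u < f u"
      "\<And>y. x \<le> y \<Longrightarrow> rab l c w (x, h) y = (if y \<le> s then push l w x h y else f y)"
  | (hit) T where "s \<le> T" "f T = l T" "\<And>u. s \<le> u \<Longrightarrow> u < T \<Longrightarrow> l u < f u"
      "\<And>y. x \<le> y \<Longrightarrow> rab l c w (x, h) y =
        (if y \<le> s then push l w x h y else if y \<le> T then f y else l y)"
proof -
  have xs: "x \<le> s" by (simp add: s_def)
  have fc: "continuous_on UNIV f" unfolding f_def by (intro continuous_intros w)
  have fs: "f s = push l w x h s" by (simp add: f_def)
  have R: "rab l c w (x, h) y = (if y \<le> s then push l w x h y
     else if \<exists>u\<in>{s..y}. f u = l u then l y else f y)" if "x \<le> y" for y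
    using rab_eq[OF that] by (simp add: s_def f_def)
  define S where "S = {u. u \<in> {s..} \<and> f u = l u}"
  have S_eq: "S = {u. u \<in> {s..} \<and> w u + (push l w x h s - w s) = l u}"
    by (auto simp: S_def f_def)
  have clS: "closed S" unfolding S_eq by (intro hitting_closed l w) auto
  have above: "l u < f u" if u: "s \<le> u" and no: "\<And>z. z \<in> S \<Longrightarrow> u < z" for u
  proof (rule no_hit_below[of s u f l])
    have "s \<notin> S" using no[of s] u by auto
    then have "f s \<noteq> l s" by (simp add: S_def)
    then show "l s < f s" using push_ge[OF xs] fs by simp
    fix z assume "s \<le> z" "z \<le> u"
    then show "f z \<noteq> l z" using no[of z] by (auto simp: S_def)
  qed (use u l fc in \<open>auto intro: continuous_on_subset\<close>)
  show thesis
  proof (cases "S = {}")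
    case True
    then have no: "\<not> (\<exists>u\<in>{s..y}. f u = l u)" for y by (auto simp: S_def)
    show thesis
    proof (rule free)
      show "l u < f u" if "s \<le> u" for u using above[OF that] True by simp
      show "rab l c w (x, h) y = (if y \<le> s then push l w x h y else f y)" if "x \<le> y" for y
        unfolding R[OF that] using no[of y] by simp
    qed
  next
    case False
    have "s \<le> u" if "u \<in> S" for u using that by (simp add: S_def)
    with False obtain T where T: "T \<in> S" "\<And>u. u \<in> S \<Longrightarrow> T \<le> u"
      using first_time_attained[OF clS] by metis
    have ex: "(\<exists>u\<in>{s..y}. f u = l u) \<longleftrightarrow> T \<le> y" for y
    proof
      assume "\<exists>u\<in>{s..y}. f u = l u"
      then obtain u where "u \<in> S" "u \<le> y" by (auto simp: S_def)
      then show "T \<le> y" using T(2)[of u] by simp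
    qed (use T(1) in \<open>auto simp: S_def intro!: bexI[of _ T]\<close>)
    show thesis
    proof (rule hit[of T])
      show "s \<le> T" "f T = l T" using T by (auto simp: S_def)
      show "l u < f u" if "s \<le> u" "u < T" for u
        using above[OF that(1)] T(2) that(2) by (meson less_le_trans)
      show "rab l c w (x, h) y =
          (if y \<le> s then push l w x h y else if y \<le> T then f y else l y)" if "x \<le> y" for y
        using R[OF that] \<open>f T = l T\<close> unfolding ex by (cases "y = T") auto
    qed
  qed
qed

lemma rab_start: "rab l c w (x, h) x = h"
  using rab_eq[OF order_refl] push_start by simp

lemma rab_ge:
  assumes "x \<le> y"
  shows "l y \<le> rab l c w (x, h) y"
proof (cases rule: rab_cases)
  case free
  then show ?thesis using assms push_ge[OF assms] by (auto intro: less_imp_le)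
next
  case (hit T)
  then show ?thesis using assms push_ge[OF assms]
    by (smt (verit) order_less_le)
qed

lemma rab_continuous: "continuous_on {x..} (rab l c w (x, h))"
proof -
  define s where "s = max x c"
  define f where "f = (\<lambda>u. w u - w s + push l w x h s)"
  have xs: "x \<le> s" by (simp add: s_def)
  have fs: "f s = push l w x h s" by (simp add: f_def)
  have fc: "continuous_on A f" for A
    unfolding f_def using w by (intro continuous_intros) (auto intro: continuous_on_subset)
  have 1: "continuous_on {x..s} (push l w x h)"
    using push_continuous by (rule continuous_on_subset) auto
  have glue: "continuous_on ({a..b} \<union> {b..}) (\<lambda>y. if y \<le> b then g y else k y)"
    if "continuous_on {a..b} g" "continuous_on {b..} k" "g b = k b" for a b and g k :: "real \<Rightarrow> real"
    using that by (intro continuous_on_cases) auto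
  have un: "{a..b} \<union> {b..} = {a..}" if "a \<le> b" for a b :: real using that by auto
  from rab_cases[of thesis] show ?thesis
  proof (cases rule: rab_cases)
    case free
    have "continuous_on {x..} (\<lambda>y. if y \<le> s then push l w x h y else f y)"
      using glue[OF 1 fc fs[symmetric]] un[OF xs] by simp
    then show ?thesis
      by (rule continuous_on_eq) (use free(2) in \<open>auto simp: s_def f_def\<close>)
  next
    case (hit T)
    have l': "continuous_on {T..} l" using l by (rule continuous_on_subset) auto
    have "s \<le> T" "f T = l T" using hit(1,2) by (auto simp: s_def f_def)
    then have "continuous_on {s..} (\<lambda>y. if y \<le> T then f y else l y)"
      using glue[OF fc l', of s] un[OF \<open>s \<le> T\<close>] by simp
    then have "continuous_on {x..} (\<lambda>y. if y \<le> s then push l w x h y else if y \<le> T then f y else l y)"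
      using glue[OF 1, of "\<lambda>y. if y \<le> T then f y else l y"] fs un[OF xs] \<open>s \<le> T\<close> by simp
    then show ?thesis
      by (rule continuous_on_eq) (use hit(4) in \<open>auto simp: s_def f_def\<close>)
  qed
qed

lemma rab_absorbed:
  assumes "x \<le> u" "c \<le> u" "rab l c w (x, h) u = l u" "u \<le> v"
  shows "rab l c w (x, h) v = l v"
proof (cases rule: rab_cases)
  case free
  have "rab l c w (x, h) u = w u - w (max x c) + push l w x h (max x c)"
    using free(2)[OF assms(1)] assms(1,2) by (cases "u = max x c") auto
  then show ?thesis using free(1)[of u] assms by auto
next
  case (hit T)
  have ux: "max x c \<le> u" using assms by simp
  have "T \<le> u"
  proof (rule ccontr)
    assume "\<not> T \<le> u"
    then have "rab l c w (x, h) u = w u - w (max x c) + push l w x h (max x c)"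
      using hit(4)[OF assms(1)] ux by (cases "u = max x c") auto
    then show False using hit(3)[of u] ux \<open>\<not> T \<le> u\<close> assms(3) by auto
  qed
  show ?thesis
  proof (cases "v = u")
    case False
    then show ?thesis using hit(4)[of v] ux \<open>T \<le> u\<close> assms by auto
  qed (use assms in simp)
qed

text \<open>Reflection only adds to the increments of \<open>w\<close>. Absorption could violate the
  inequality, but an absorbed path stays on the barrier, so the hypothesis at the final time
  \<open>v\<close> excludes it on all of \<open>{u..v}\<close>.\<close>

lemma rab_increment_ge:
  assumes uv: "x \<le> u" "u \<le> v" and "v \<le> c \<or> l v < rab l c w (x, h) v"
  shows "w v - w u \<le> rab l c w (x, h) v - rab l c w (x, h) u"
proof -
  define s where "s = max x c"
  have xs: "x \<le> s" "c \<le> s" by (simp_all add: s_def)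
  have *: "rab l c w (x, h) y =
      (if y \<le> s then push l w x h y else w y - w s + push l w x h s)" if "x \<le> y" "y \<le> v" for y
  proof (cases "v \<le> s")
    case True
    then show ?thesis using that rab_eq[of y] by (auto simp: s_def)
  next
    case False
    then have "l v < rab l c w (x, h) v" using assms(3) xs by auto
    then have no: "\<not> (\<exists>u\<in>{s..v}. w u - w s + push l w x h s = l u)"
      using rab_eq[of v] False uv by (auto simp: s_def split: if_splits)
    show ?thesis
      using rab_eq[OF that(1)] no that(2) unfolding s_def[symmetric] by auto
  qed
  show ?thesis
    using *[of u] *[of v] uv push_increment_ge[of u s] push_increment_ge[of u v] xs
    by (auto split: if_splits)
qed

lemma rab_free:
  assumes uv: "x \<le> u" "u \<le> v" and above: "\<And>z. u \<le> z \<Longrightarrow> z \<le> v \<Longrightarrow> l z < rab l c w (x, h) z"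
  shows "rab l c w (x, h) v - rab l c w (x, h) u = w v - w u"
proof -
  define s where "s = max x c"
  have xs: "x \<le> s" "c \<le> s" by (simp_all add: s_def)
  have *: "rab l c w (x, h) y =
      (if y \<le> s then push l w x h y else w y - w s + push l w x h s)" if "x \<le> y" "y \<le> v" for y
  proof (cases "v \<le> s")
    case True
    then show ?thesis using that rab_eq[of y] by (auto simp: s_def)
  next
    case False
    then have "l v < rab l c w (x, h) v" using above[of v] uv by auto
    then have no: "\<not> (\<exists>u\<in>{s..v}. w u - w s + push l w x h s = l u)"
      using rab_eq[of v] False uv by (auto simp: s_def split: if_splits)
    show ?thesis
      using rab_eq[OF that(1)] no that(2) unfolding s_def[symmetric] by auto
  qed
  have push_above: "l z < push l w x h z" if "u \<le> z" "z \<le> v" "z \<le> s" for z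
    using above[of z] *[of z] that uv by auto
  consider "v \<le> s" | "s < v" "u \<le> s" | "s < u" using uv by linarith
  then show ?thesis
  proof cases
    case 1
    then show ?thesis using push_free[OF uv] push_above *[of u] *[of v] uv by auto
  next
    case 2
    then show ?thesis using push_free[of u s] push_above *[of u] *[of v] uv by auto
  next
    case 3
    then show ?thesis using *[of u] *[of v] uv by auto
  qed
qed

lemma push_shift:
  assumes "x \<le> y"
  shows "push l (\<lambda>u. w u + k) x h y = push l w x h y"
proof -
  have f: "continuous_on UNIV (\<lambda>z. l z - w z)" by (intro continuous_intros l w)
  have "running_sup (\<lambda>z. l z - (w z + k)) x y = running_sup (\<lambda>z. l z - w z) x y - k"
    using running_sup_shift[OF f assms, of "- k"] by (simp add: algebra_simps)
  then show ?thesis by (simp add: push_def max_def)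
qed

end

text \<open>Only increments matter, so a motion may be normalised to vanish at the birth time of its
  line.\<close>

lemma rab_shift:
  assumes "continuous_on UNIV l" "continuous_on UNIV w" "l x < h" "x \<le> y"
  shows "rab l c (\<lambda>u. w u + k) (x, h) y = rab l c w (x, h) y"
proof -
  have "continuous_on UNIV (\<lambda>u. w u + k)" using assms(2) by (intro continuous_intros)
  from rab_eq[OF assms(1) this assms(3,4)] rab_eq[OF assms] show ?thesis
    using push_shift[OF assms(1,2,3), of y k] push_shift[OF assms(1,2,3), of "max x c" k] assms(4)
    by simp
qed

subsection \<open>Coalescing families of paths\<close>

lemma closed_eq_on:
  fixes f g :: "real \<Rightarrow> real"
  assumes "continuous_on {a..} f" "continuous_on {a..} g"
  shows "closed {u. a \<le> u \<and> f u = g u}"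
proof -
  have "closedin (top_of_set {a..}) ({a..} \<inter> (\<lambda>u. f u - g u) -` {0})"
    using assms by (intro continuous_closedin_preimage continuous_intros) auto
  then have "closed ({a..} \<inter> (\<lambda>u. f u - g u) -` {0})"
    using closedin_closed_trans by blast
  moreover have "{a..} \<inter> (\<lambda>u. f u - g u) -` {0} = {u. a \<le> u \<and> f u = g u}" by auto
  ultimately show ?thesis by simp
qed

text \<open>A fixed realisation of the barrier and of the motions, so that coalescence becomes a
  matter of continuous functions.\<close>

locale rab_family =
  fixes l :: "real \<Rightarrow> real" and c :: real and q :: "nat \<Rightarrow> real \<times> real" and X :: "nat \<Rightarrow> real \<Rightarrow> real"
  assumes l_cont: "continuous_on UNIV l" and X_cont: "\<And>n. continuous_on UNIV (X n)"
begin

abbreviation alive :: "nat \<Rightarrow> bool"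
  where "alive n \<equiv> q n \<in> strict_epigraph l"

abbreviation birth :: "nat \<Rightarrow> real"
  where "birth n \<equiv> fst (q n)"

definition R :: "nat \<Rightarrow> real \<Rightarrow> real"
  where "R n = rab l c (X n) (q n)"

definition L :: "nat \<Rightarrow> real \<Rightarrow> real"
  where "L = coalescing_line l q R"

definition meets :: "nat \<Rightarrow> real \<Rightarrow> nat set"
  where "meets n u = {k. k < n \<and> alive k \<and> birth k \<le> u \<and> R n u = L k u}"

lemma alive_less: "alive n \<Longrightarrow> l (birth n) < snd (q n)"
  by (auto simp: strict_epigraph_def split: prod.splits)

lemma R_rab: "R n = rab l c (X n) (birth n, snd (q n))"
  by (simp add: R_def)

lemma R_continuous: "alive n \<Longrightarrow> continuous_on {birth n..} (R n)"
  unfolding R_rab by (intro rab_continuous l_cont X_cont alive_less)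

lemma R_start: "alive n \<Longrightarrow> R n (birth n) = snd (q n)"
  unfolding R_rab by (intro rab_start l_cont X_cont alive_less)

lemma R_ge: "alive n \<Longrightarrow> birth n \<le> y \<Longrightarrow> l y \<le> R n y"
  unfolding R_rab by (intro rab_ge l_cont X_cont alive_less)

lemma first_lines_eq: "k < n \<Longrightarrow> first_lines l q R n k = L k"
proof (induction n)
  case (Suc n)
  then show ?case
    by (cases "k = n") (auto simp: L_def coalescing_line_def)
qed simp

lemma met_lines_eq: "met_lines l q n (R n) (first_lines l q R n) u = meets n u"
  by (auto simp: met_lines_def meets_def first_lines_eq)

lemma L_unfold:
  "L n y = (let T = first_time {u. birth n \<le> u \<and> meets n u \<noteq> {}}
     in if ereal y \<le> T then R n y
        else first_lines l q R n (LEAST k. k \<in> meets n (real_of_ereal T)) y)"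
  by (simp add: L_def coalescing_line_def coalesce_def met_lines_eq Let_def del: ereal_less_eq)

text \<open>The times of contact with finitely many earlier lines form a closed set, so a first
  meeting is attained. Continuity of the earlier lines is a hypothesis because
  \<open>L_continuous\<close> is itself proved by induction from this case distinction.\<close>

lemma L_cases_aux:
  assumes n: "alive n" and cont: "\<forall>k<n. alive k \<longrightarrow> continuous_on {birth k..} (L k)"
  obtains
    (free) "\<And>u. birth n \<le> u \<Longrightarrow> meets n u = {}" "\<And>y. L n y = R n y"
  | (hit) T k where "birth n \<le> T" "k \<in> meets n T" "\<And>j. j \<in> meets n T \<Longrightarrow> k \<le> j"
      "\<And>u. birth n \<le> u \<Longrightarrow> u < T \<Longrightarrow> meets n u = {}"
      "\<And>y. y \<le> T \<Longrightarrow> L n y = R n y" "\<And>y. T \<le> y \<Longrightarrow> L n y = L k y"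
proof -
  define S where "S = {u. birth n \<le> u \<and> meets n u \<noteq> {}}"
  show thesis
  proof (cases "S = {}")
    case True
    then have "first_time S = \<infinity>" by (simp add: first_time_def top_ereal_def)
    then have "L n y = R n y" for y by (simp add: L_unfold S_def[symmetric])
    then show thesis using True by (intro free) (auto simp: S_def)
  next
    case False
    have "S = (\<Union>k\<in>{k. k < n \<and> alive k}. {u. max (birth n) (birth k) \<le> u \<and> R n u = L k u})"
      by (auto simp: S_def meets_def)
    moreover have "closed \<dots>"
    proof (intro closed_UN ballI)
      fix k assume "k \<in> {k. k < n \<and> alive k}"
      then show "closed {u. max (birth n) (birth k) \<le> u \<and> R n u = L k u}"
        using R_continuous[OF n] cont
        by (intro closed_eq_on)
          (auto intro: continuous_on_subset[of "{birth n..}"] continuous_on_subset[of "{birth k..}"])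
    qed auto
    ultimately have clS: "closed S" by simp
    have lb: "birth n \<le> u" if "u \<in> S" for u using that by (simp add: S_def)
    obtain T where T: "T \<in> S" "\<And>u. u \<in> S \<Longrightarrow> T \<le> u" "first_time S = ereal T"
      by (rule first_time_attained[OF clS False, of "birth n"]) (use lb that in simp_all)
    define k where "k = (LEAST k. k \<in> meets n T)"
    have k: "k \<in> meets n T"
      unfolding k_def using T(1) by (metis (mono_tags, lifting) LeastI S_def all_not_in_conv mem_Collect_eq)
    have kn: "k < n" using k by (simp add: meets_def)
    have L: "L n y = (if y \<le> T then R n y else L k y)" for y
      unfolding L_unfold[of n] S_def[symmetric] T(3) using first_lines_eq[OF kn]
      by (simp add: k_def[symmetric])
    show thesis
    proof (rule hit)
      show "birth n \<le> T" "k \<in> meets n T" using lb[OF T(1)] k by auto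
      show "k \<le> j" if "j \<in> meets n T" for j unfolding k_def using that by (rule Least_le)
      show "meets n u = {}" if "birth n \<le> u" "u < T" for u
        using T(2)[of u] that by (auto simp: S_def)
      show "L n y = R n y" if "y \<le> T" for y using that by (simp add: L)
      show "L n y = L k y" if "T \<le> y" for y
        using that k by (cases "y = T") (auto simp: L meets_def)
    qed
  qed
qed

lemma L_continuous: "alive n \<Longrightarrow> continuous_on {birth n..} (L n)"
proof (induction n rule: less_induct)
  case (less n)
  have "\<forall>k<n. alive k \<longrightarrow> continuous_on {birth k..} (L k)" using less.IH by blast
  with less.prems show ?case
  proof (cases rule: L_cases_aux)
    case free
    then show ?thesis using R_continuous[OF less.prems] by (auto intro: continuous_on_eq)
  next
    case (hit T k)
    have k: "k < n" "alive k" "birth k \<le> T" using hit(2) by (auto simp: meets_def)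
    have "continuous_on ({birth n..T} \<union> {T..}) (\<lambda>y. if y \<le> T then R n y else L k y)"
      using R_continuous[OF less.prems] less.IH[OF k(1,2)] k(3) hit(2)
      by (intro continuous_on_cases) (auto simp: meets_def intro: continuous_on_subset)
    moreover have "{birth n..T} \<union> {T..} = {birth n..}" using hit(1) by auto
    ultimately have "continuous_on {birth n..} (\<lambda>y. if y \<le> T then R n y else L k y)" by simp
    then show ?thesis by (rule continuous_on_eq) (use hit(5,6) in auto)
  qed
qed

lemma L_cases:
  assumes "alive n"
  obtains
    (free) "\<And>u. birth n \<le> u \<Longrightarrow> meets n u = {}" "\<And>y. L n y = R n y"
  | (hit) T k where "birth n \<le> T" "k \<in> meets n T" "\<And>j. j \<in> meets n T \<Longrightarrow> k \<le> j"
      "\<And>u. birth n \<le> u \<Longrightarrow> u < T \<Longrightarrow> meets n u = {}"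
      "\<And>y. y \<le> T \<Longrightarrow> L n y = R n y" "\<And>y. T \<le> y \<Longrightarrow> L n y = L k y"
proof -
  have "\<forall>k<n. alive k \<longrightarrow> continuous_on {birth k..} (L k)" using L_continuous by blast
  with assms show thesis
  proof (cases rule: L_cases_aux)
    case free': free
    then show thesis by (rule free)
  next
    case hit': (hit T k)
    then show thesis by (rule hit)
  qed
qed

lemma L_start:
  assumes "alive n"
  shows "L n (birth n) = snd (q n)"
  using assms by (cases rule: L_cases) (auto simp: R_start[OF assms])

lemma L_ge: "alive n \<Longrightarrow> birth n \<le> y \<Longrightarrow> l y \<le> L n y"
proof (induction n rule: less_induct)
  case (less n)
  from less.prems(1) show ?case
  proof (cases rule: L_cases)
    case free
    then show ?thesis using R_ge[OF less.prems] by simp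
  next
    case (hit T k)
    then show ?thesis using R_ge[OF less.prems] less.IH[of k]
      by (cases "y \<le> T") (auto simp: meets_def)
  qed
qed

text \<open>If the line turns to another line at \<open>T\<close> after \<open>u\<close>, it is
  still on the barrier at \<open>T\<close> and hands this contact over; if it has turned before, the
  contact already belongs to the followed line. Either way a smaller index takes over.\<close>

lemma L_absorbed:
  "alive n \<Longrightarrow> birth n \<le> u \<Longrightarrow> c \<le> u \<Longrightarrow> L n u = l u \<Longrightarrow> u \<le> v \<Longrightarrow> L n v = l v"
proof (induction n arbitrary: u rule: less_induct)
  case (less n)
  have R: "R n z = l z" if "R n u = l u" "u \<le> z" for z
    using rab_absorbed[OF l_cont X_cont alive_less[OF less.prems(1)] less.prems(2,3)] that
    by (simp add: R_rab)
  from less.prems(1) show ?case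
  proof (cases rule: L_cases)
    case free
    then show ?thesis using less.prems R by simp
  next
    case (hit T k)
    have k: "k < n" "alive k" "birth k \<le> T" "R n T = L k T" using hit(2) by (auto simp: meets_def)
    show ?thesis
    proof (cases "v \<le> T")
      case True
      then show ?thesis using R[of v] hit(5)[of v] hit(5)[of u] less.prems by simp
    next
      case False
      show ?thesis
      proof (cases "u \<le> T")
        case True
        then have "L k T = l T" using R[of T] hit(5)[of u] less.prems k by simp
        then have "L k v = l v" using less.IH[of k T] k less.prems True False by simp
        then show ?thesis using hit(6) False by simp
      next
        case u: False
        then have "L k v = l v" using less.IH[of k u] k less.prems hit(6)[of u] by simp
        then show ?thesis using hit(6) False by simp
      qed
    qed
  qed
qed

text \<open>Induction on the larger index. If \<open>j < i\<close>, the line \<open>i\<close> has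
  met some line of smaller index by time \<open>u\<close>, because it meets \<open>j\<close> at
  \<open>u\<close> at the latest; then \<open>i\<close> may be replaced by the line that it
  follows.\<close>

lemma L_coalesce:
  assumes "alive i" "alive j" "birth i \<le> u" "birth j \<le> u" "L i u = L j u" "u \<le> y"
  shows "L i y = L j y"
  using assms
proof (induction "max i j" arbitrary: i j rule: less_induct)
  case less
  have main: "L i y = L j y"
    if ij: "j < i" "alive i" "alive j" "birth i \<le> u" "birth j \<le> u" "L i u = L j u"
      and IH: "\<And>k. k < i \<Longrightarrow> alive k \<Longrightarrow> birth k \<le> u \<Longrightarrow> L k u = L j u \<Longrightarrow> L k y = L j y"
    for i j
    using ij(2)
  proof (cases rule: L_cases)
    case free
    then have "j \<in> meets i u" using ij by (auto simp: meets_def)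
    then show ?thesis using free ij by auto
  next
    case (hit T k)
    have "T \<le> u"
    proof (rule ccontr)
      assume "\<not> T \<le> u"
      then have "j \<in> meets i u" using ij hit(5)[of u] by (auto simp: meets_def)
      then show False using hit(4)[of u] ij \<open>\<not> T \<le> u\<close> by auto
    qed
    have k: "k < i" "alive k" "birth k \<le> u" using hit(2) \<open>T \<le> u\<close> by (auto simp: meets_def)
    have "L k y = L j y" using hit(6)[OF \<open>T \<le> u\<close>] ij by (intro IH k) auto
    then show ?thesis using hit(6)[of y] \<open>T \<le> u\<close> less.prems(6) by auto
  qed
  consider "j < i" | "i < j" | "i = j" by linarith
  then show ?case
  proof cases
    case 1
    show ?thesis
    proof (rule main[of j i])
      fix k assume "k < i" "alive k" "birth k \<le> u" "L k u = L j u"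
      then show "L k y = L j y" using less.prems 1 by (intro less.hyps) simp_all
    qed (use 1 less.prems in simp_all)
  next
    case 2
    have "L j y = L i y"
    proof (rule main[of i j])
      fix k assume "k < j" "alive k" "birth k \<le> u" "L k u = L i u"
      then show "L k y = L i y" using less.prems 2 by (intro less.hyps) simp_all
    qed (use 2 less.prems in simp_all)
    then show ?thesis by simp
  next
    case 3
    then show ?thesis by simp
  qed
qed

text \<open>Continuous lines that change their order meet in between, and from there on they
  coincide.\<close>

lemma L_mono:
  assumes "alive i" "alive j" "birth i \<le> u" "birth j \<le> u" "L i u \<le> L j u" "u \<le> y"
  shows "L i y \<le> L j y"
proof (rule ccontr)
  assume neg: "\<not> ?thesis"
  have "continuous_on {u..y} (L i)" "continuous_on {u..y} (L j)"
    using L_continuous[of i] L_continuous[of j] assms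
    by (auto intro: continuous_on_subset[of "{birth i..}"] continuous_on_subset[of "{birth j..}"])
  then have "\<exists>z\<ge>u. z \<le> y \<and> L i z - L j z = 0"
    using neg assms by (intro IVT' continuous_intros) auto
  then obtain z where "u \<le> z" "z \<le> y" "L i z = L j z" by auto
  then have "L i y = L j y" using assms by (intro L_coalesce[of i j z y]) auto
  then show False using neg by simp
qed

text \<open>The index of the driving motion that the line \<open>n\<close> follows immediately before and at time \<open>t\<close>.\<close>

definition idx :: "nat \<Rightarrow> real \<Rightarrow> nat"
  where "idx n t = (LEAST k. alive k \<and> birth k \<le> t \<and> L k t = L n t)"

context
  fixes n :: nat and t :: real
  assumes n: "alive n" and t: "birth n \<le> t"
begin

lemma idx_props: "alive (idx n t)" "birth (idx n t) \<le> t" "L (idx n t) t = L n t"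
  using LeastI[of "\<lambda>k. alive k \<and> birth k \<le> t \<and> L k t = L n t" n] n t by (auto simp: idx_def)

lemma idx_le: "idx n t \<le> n"
  unfolding idx_def using n t by (intro Least_le) auto

text \<open>Lines through a common point stay together, so a candidate at time \<open>t\<close> is
  still a candidate at \<open>t'\<close>, while new ones may appear.\<close>

lemma idx_antimono:
  assumes "t \<le> t'"
  shows "idx n t' \<le> idx n t"
proof -
  have "L (idx n t) t' = L n t'"
    using idx_props n t assms by (intro L_coalesce[of _ _ t t']) auto
  then show ?thesis
    unfolding idx_def[of n t'] using idx_props assms by (intro Least_le) auto
qed

text \<open>If the line \<open>idx n t\<close> turned to an earlier line before \<open>w\<close>,
  that line would be a candidate of smaller index at time \<open>w\<close>, against the equality of
  the two indices.\<close>

lemma cell_eq: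
  assumes "t \<le> w" "idx n w = idx n t" "t \<le> z" "z \<le> w"
  shows "L n z = R (idx n t) z"
proof -
  let ?k = "idx n t"
  have nz: "L n z = L ?k z"
    using idx_props n t assms by (intro L_coalesce[of _ _ t z]) auto
  from idx_props(1) show ?thesis
  proof (cases rule: L_cases)
    case free
    then show ?thesis using nz by simp
  next
    case (hit T k')
    have "w \<le> T"
    proof (rule ccontr)
      assume "\<not> w \<le> T"
      have "L ?k w = L n w"
        using idx_props n t assms by (intro L_coalesce[of _ _ t w]) auto
      then have "alive k' \<and> birth k' \<le> w \<and> L k' w = L n w" "k' < ?k"
        using hit(2) hit(6)[of w] \<open>\<not> w \<le> T\<close> by (auto simp: meets_def)
      then have "idx n w \<le> k'" unfolding idx_def by (intro Least_le)
      then show False using assms \<open>k' < ?k\<close> by simp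
    qed
    then show ?thesis using hit(5)[of z] assms nz by simp
  qed
qed

lemma cell_free:
  assumes "t \<le> w" "idx n w = idx n t" "\<And>z. t \<le> z \<Longrightarrow> z \<le> w \<Longrightarrow> l z < L n z"
  shows "L n w - L n t = X (idx n t) w - X (idx n t) t"
proof -
  have eq: "L n z = R (idx n t) z" if "t \<le> z" "z \<le> w" for z
    using cell_eq[OF assms(1,2)] that by simp
  show ?thesis
    using rab_free[OF l_cont X_cont alive_less[OF idx_props(1)] idx_props(2) assms(1), of c "idx n t"]
      assms(3) eq assms(1) by (simp add: R_rab)
qed

lemma cell_ge:
  assumes "t \<le> w" "idx n w = idx n t" "w \<le> c \<or> l w < L n w"
  shows "X (idx n t) w - X (idx n t) t \<le> L n w - L n t"
proof -
  have eq: "L n z = R (idx n t) z" if "t \<le> z" "z \<le> w" for z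
    using cell_eq[OF assms(1,2)] that by simp
  show ?thesis
    using rab_increment_ge[OF l_cont X_cont alive_less[OF idx_props(1)] idx_props(2) assms(1), of c "idx n t"]
      assms(3) eq assms(1) by (simp add: R_rab)
qed

end

end

subsection \<open>Measurability of the lines\<close>

context rab_family
begin

text \<open>The first meeting time of the line \<open>n\<close>, capped at \<open>u\<close>. The cap
  keeps the set nonempty and lets the value depend on the paths up to \<open>u\<close> only.\<close>

definition merge_time :: "nat \<Rightarrow> real \<Rightarrow> real"
  where "merge_time n u = Inf {z. birth n \<le> z \<and> (meets n z \<noteq> {} \<or> u \<le> z)}"

text \<open>The characterisation of \<open>merge_time n u \<le> a\<close> by the existence of a
  meeting up to \<open>a\<close> is what reduces the measurability of this random time to hitting
  events.\<close>

lemma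
  assumes n: "alive n" and u: "birth n \<le> u"
  shows merge_time_bounds: "birth n \<le> merge_time n u" "merge_time n u \<le> u"
    and merge_time_le_iff:
      "\<And>a. a < u \<Longrightarrow> merge_time n u \<le> a \<longleftrightarrow> (\<exists>z. birth n \<le> z \<and> z \<le> a \<and> meets n z \<noteq> {})"
    and L_merge_time: "L n u = (if meets n (merge_time n u) = {} then R n u
      else L (LEAST k. k \<in> meets n (merge_time n u)) u)"
proof -
  let ?S = "{z. birth n \<le> z \<and> (meets n z \<noteq> {} \<or> u \<le> z)}"
  have "(birth n \<le> merge_time n u \<and> merge_time n u \<le> u) \<and>
    (\<forall>a<u. merge_time n u \<le> a \<longleftrightarrow> (\<exists>z. birth n \<le> z \<and> z \<le> a \<and> meets n z \<noteq> {})) \<and>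
    L n u = (if meets n (merge_time n u) = {} then R n u
      else L (LEAST k. k \<in> meets n (merge_time n u)) u)"
    using n
  proof (cases rule: L_cases)
    case free
    have "merge_time n u = u"
      unfolding merge_time_def using free(1) u by (intro cInf_eq_minimum) auto
    then show ?thesis using free u by auto
  next
    case (hit T k)
    have m: "merge_time n u = min T u"
      unfolding merge_time_def
    proof (rule cInf_eq_minimum)
      show "min T u \<in> ?S" using hit(1,2) u by (auto simp: min_def)
      show "min T u \<le> z" if "z \<in> ?S" for z
        using hit(4)[of z] that by (cases "z < T") (auto simp: min_def)
    qed
    show ?thesis
    proof (intro conjI allI impI)
      show "birth n \<le> merge_time n u" "merge_time n u \<le> u" using m hit(1) u by auto
      show "merge_time n u \<le> a \<longleftrightarrow> (\<exists>z. birth n \<le> z \<and> z \<le> a \<and> meets n z \<noteq> {})" if "a < u" for a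
      proof
        assume "merge_time n u \<le> a"
        then have "T \<le> a" using m that by auto
        then show "\<exists>z. birth n \<le> z \<and> z \<le> a \<and> meets n z \<noteq> {}" using hit(1,2) by blast
      next
        assume "\<exists>z. birth n \<le> z \<and> z \<le> a \<and> meets n z \<noteq> {}"
        then obtain z where "birth n \<le> z" "z \<le> a" "meets n z \<noteq> {}" by blast
        then have "T \<le> a" using hit(4)[of z] by force
        then show "merge_time n u \<le> a" using m by auto
      qed
      have "(LEAST k. k \<in> meets n T) = k" using hit(2,3) by (intro Least_equality)
      moreover have "meets n u = {}" if "u < T" using hit(4)[OF u that] .
      ultimately show "L n u = (if meets n (merge_time n u) = {} then R n u
          else L (LEAST k. k \<in> meets n (merge_time n u)) u)"
        unfolding m using hit(2) hit(5)[of u] hit(6)[of u] by (cases "T \<le> u") (auto simp: min_def)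
    qed
  qed
  then show "birth n \<le> merge_time n u" "merge_time n u \<le> u"
    "\<And>a. a < u \<Longrightarrow> merge_time n u \<le> a \<longleftrightarrow> (\<exists>z. birth n \<le> z \<and> z \<le> a \<and> meets n z \<noteq> {})"
    "L n u = (if meets n (merge_time n u) = {} then R n u
      else L (LEAST k. k \<in> meets n (merge_time n u)) u)"
    by blast+
qed

end

text \<open>The random time is rounded down to a multiple of \<open>1 / (n + 1)\<close>, which
  leaves countably many values, and continuity recovers the limit.\<close>

lemma measurable_eval_continuous:
  fixes f :: "'a \<Rightarrow> real \<Rightarrow> real"
  assumes c: "\<And>\<omega>. \<omega> \<in> space G \<Longrightarrow> continuous_on UNIV (f \<omega>)"
    and f: "\<And>u. (\<lambda>\<omega>. f \<omega> u) \<in> borel_measurable G" and t: "t \<in> borel_measurable G"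
  shows "(\<lambda>\<omega>. f \<omega> (t \<omega>)) \<in> borel_measurable G"
proof (rule borel_measurable_LIMSEQ_real)
  let ?a = "\<lambda>n \<omega>. real_of_int \<lfloor>real (Suc n) * t \<omega>\<rfloor> / real (Suc n)"
  show "(\<lambda>\<omega>. f \<omega> (?a n \<omega>)) \<in> borel_measurable G" for n
  proof (rule measurable_compose_countable[where f="\<lambda>i \<omega>. f \<omega> (real_of_int i / real (Suc n))"])
    show "(\<lambda>\<omega>. \<lfloor>real (Suc n) * t \<omega>\<rfloor>) \<in> measurable G (count_space UNIV)"
      using t by measurable
  qed (rule f)
  fix \<omega> assume w: "\<omega> \<in> space G"
  have "(\<lambda>n. ?a n \<omega>) \<longlonglongrightarrow> t \<omega>"
  proof (rule tendsto_sandwich[OF _ _ _ tendsto_const])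
    show "(\<lambda>n. t \<omega> - inverse (real (Suc n))) \<longlonglongrightarrow> t \<omega>"
      using tendsto_diff[OF tendsto_const LIMSEQ_inverse_real_of_nat] by simp
    show "\<forall>\<^sub>F n in sequentially. t \<omega> - inverse (real (Suc n)) \<le> ?a n \<omega>"
    proof (rule always_eventually, rule allI)
      fix n
      have "real (Suc n) * t \<omega> - 1 \<le> real_of_int \<lfloor>real (Suc n) * t \<omega>\<rfloor>" by linarith
      then have "(real (Suc n) * t \<omega> - 1) / real (Suc n) \<le> ?a n \<omega>"
        by (intro divide_right_mono) simp_all
      moreover have "(real (Suc n) * t \<omega> - 1) / real (Suc n) = t \<omega> - inverse (real (Suc n))"
        by (simp add: diff_divide_distrib inverse_eq_divide del: of_nat_Suc)
      ultimately show "t \<omega> - inverse (real (Suc n)) \<le> ?a n \<omega>" by simp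
    qed
    show "\<forall>\<^sub>F n in sequentially. ?a n \<omega> \<le> t \<omega>"
    proof (rule always_eventually, rule allI)
      fix n
      have "real_of_int \<lfloor>real (Suc n) * t \<omega>\<rfloor> \<le> real (Suc n) * t \<omega>" by linarith
      then show "?a n \<omega> \<le> t \<omega>" by (simp add: divide_le_eq mult.commute del: of_nat_Suc)
    qed
  qed
  moreover have "isCont (f \<omega>) (t \<omega>)" using c[OF w] by (simp add: continuous_on_eq_continuous_at)
  ultimately show "(\<lambda>n. f \<omega> (?a n \<omega>)) \<longlonglongrightarrow> f \<omega> (t \<omega>)"
    by (rule isCont_tendsto_compose[rotated])
qed

lemma le_on_unit_interval:
  fixes g :: "real \<Rightarrow> real"
  assumes g: "continuous_on UNIV g" and le: "\<And>r. r \<in> \<rat> \<Longrightarrow> 0 \<le> r \<Longrightarrow> r \<le> 1 \<Longrightarrow> g r \<le> a"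
    and r: "0 \<le> r" "r \<le> 1"
  shows "g r \<le> a"
proof (rule ccontr)
  assume "\<not> g r \<le> a"
  then obtain d where d: "d > 0" "\<And>z. \<bar>z - r\<bar> < d \<Longrightarrow> \<bar>g z - g r\<bar> < g r - a"
    using g unfolding continuous_on_iff dist_real_def
    by (metis UNIV_I diff_gt_0_iff_gt not_le)
  have "max 0 (r - d) < min 1 (r + d)" using d(1) r by auto
  then obtain z where z: "z \<in> \<rat>" "max 0 (r - d) < z" "z < min 1 (r + d)"
    using Rats_dense_in_real by blast
  then have "\<bar>z - r\<bar> < d" by auto
  then show False using d(2)[of z] le[of z] z by auto
qed

text \<open>The random interval is parametrised by \<open>{0..1}\<close>, and by continuity it
  suffices to test the rational parameters.\<close>

lemma measurable_running_sup:
  fixes f :: "'a \<Rightarrow> real \<Rightarrow> real"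
  assumes c: "\<And>\<omega>. \<omega> \<in> space G \<Longrightarrow> continuous_on UNIV (f \<omega>)"
    and f: "\<And>u. (\<lambda>\<omega>. f \<omega> u) \<in> borel_measurable G"
    and s: "s \<in> borel_measurable G" and t: "t \<in> borel_measurable G"
    and le: "\<And>\<omega>. \<omega> \<in> space G \<Longrightarrow> s \<omega> \<le> t \<omega>"
  shows "(\<lambda>\<omega>. running_sup (f \<omega>) (s \<omega>) (t \<omega>)) \<in> borel_measurable G"
  unfolding borel_measurable_iff_le
proof
  fix a
  let ?p = "\<lambda>r \<omega>. s \<omega> + r * (t \<omega> - s \<omega>)"
  have "(running_sup (f \<omega>) (s \<omega>) (t \<omega>) \<le> a) =
      (\<forall>r\<in>\<rat> \<inter> {0..1}. f \<omega> (?p r \<omega>) \<le> a)" if w: "\<omega> \<in> space G" for \<omega>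
    unfolding running_sup_le_iff[OF c[OF w] le[OF w]]
  proof
    assume A: "\<forall>u\<in>{s \<omega>..t \<omega>}. f \<omega> u \<le> a"
    show "\<forall>r\<in>\<rat> \<inter> {0..1}. f \<omega> (?p r \<omega>) \<le> a"
    proof
      fix r :: real assume "r \<in> \<rat> \<inter> {0..1}"
      then have "?p r \<omega> \<in> {s \<omega>..t \<omega>}"
        using le[OF w] mult_right_mono[of r 1 "t \<omega> - s \<omega>"] by auto
      then show "f \<omega> (?p r \<omega>) \<le> a" using A by blast
    qed
  next
    assume A: "\<forall>r\<in>\<rat> \<inter> {0..1}. f \<omega> (?p r \<omega>) \<le> a"
    show "\<forall>u\<in>{s \<omega>..t \<omega>}. f \<omega> u \<le> a"
    proof
      fix u assume u: "u \<in> {s \<omega>..t \<omega>}"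
      define r where "r = (if s \<omega> = t \<omega> then 0 else (u - s \<omega>) / (t \<omega> - s \<omega>))"
      have r: "0 \<le> r" "r \<le> 1" "?p r \<omega> = u" using u by (auto simp: r_def divide_simps)
      have "continuous_on UNIV (\<lambda>r. f \<omega> (?p r \<omega>))"
        by (rule continuous_on_compose2[OF c[OF w]]) (auto intro!: continuous_intros)
      from le_on_unit_interval[OF this, of a r] A r show "f \<omega> u \<le> a" by auto
    qed
  qed
  then have "{\<omega> \<in> space G. running_sup (f \<omega>) (s \<omega>) (t \<omega>) \<le> a} =
      {\<omega> \<in> space G. \<forall>r\<in>\<rat> \<inter> {0..1}. f \<omega> (?p r \<omega>) \<le> a}" by auto
  moreover have zero: "(0::real) \<in> \<rat> \<inter> {0..1}" by simp
  then have "{\<omega> \<in> space G. \<forall>r\<in>\<rat> \<inter> {0..1}. f \<omega> (?p r \<omega>) \<le> a} =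
      (\<Inter>r\<in>\<rat> \<inter> {0..1}. {\<omega> \<in> space G. f \<omega> (?p r \<omega>) \<le> a})"
    by blast
  moreover have "\<dots> \<in> sets G"
  proof (rule sets.countable_INT')
    show "countable (\<rat> \<inter> {0..1::real})" using countable_rat by blast
    show "\<rat> \<inter> {0..1::real} \<noteq> {}" using zero by blast
    show "(\<lambda>r. {\<omega> \<in> space G. f \<omega> (?p r \<omega>) \<le> a}) ` (\<rat> \<inter> {0..1}) \<subseteq> sets G"
    proof (intro image_subsetI)
      fix r :: real
      have "(\<lambda>\<omega>. f \<omega> (?p r \<omega>)) \<in> borel_measurable G"
      proof (rule measurable_eval_continuous[where f=f, OF c f])
        show "?p r \<in> borel_measurable G" using s t by measurable
      qed
      then show "{\<omega> \<in> space G. f \<omega> (?p r \<omega>) \<le> a} \<in> sets G" by simp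
    qed
  qed
  ultimately show "{\<omega> \<in> space G. running_sup (f \<omega>) (s \<omega>) (t \<omega>) \<le> a} \<in> sets G" by simp
qed

text \<open>A continuous function has a zero on a compact interval iff the supremum of minus its
  absolute value is not negative there.\<close>

lemma measurable_hits_zero:
  fixes f :: "'a \<Rightarrow> real \<Rightarrow> real"
  assumes c: "\<And>\<omega>. \<omega> \<in> space G \<Longrightarrow> continuous_on UNIV (f \<omega>)"
    and f: "\<And>u. (\<lambda>\<omega>. f \<omega> u) \<in> borel_measurable G"
    and s: "s \<in> borel_measurable G" and t: "t \<in> borel_measurable G"
    and le: "\<And>\<omega>. \<omega> \<in> space G \<Longrightarrow> s \<omega> \<le> t \<omega>"
  shows "{\<omega> \<in> space G. \<exists>u\<in>{s \<omega>..t \<omega>}. f \<omega> u = 0} \<in> sets G"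
proof -
  let ?g = "\<lambda>\<omega> u. - \<bar>f \<omega> u\<bar>"
  have cg: "continuous_on UNIV (?g \<omega>)" if "\<omega> \<in> space G" for \<omega>
    by (intro continuous_intros c that)
  have "(\<lambda>\<omega>. running_sup (?g \<omega>) (s \<omega>) (t \<omega>)) \<in> borel_measurable G"
  proof (rule measurable_running_sup[OF cg _ s t le])
    show "(\<lambda>\<omega>. ?g \<omega> u) \<in> borel_measurable G" for u using f by measurable
  qed
  then have "{\<omega> \<in> space G. 0 \<le> running_sup (?g \<omega>) (s \<omega>) (t \<omega>)} \<in> sets G" by simp
  moreover have "0 \<le> running_sup (?g \<omega>) (s \<omega>) (t \<omega>) \<longleftrightarrow> (\<exists>u\<in>{s \<omega>..t \<omega>}. f \<omega> u = 0)"
    if w: "\<omega> \<in> space G" for \<omega>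
  proof
    assume "0 \<le> running_sup (?g \<omega>) (s \<omega>) (t \<omega>)"
    then show "\<exists>u\<in>{s \<omega>..t \<omega>}. f \<omega> u = 0"
      by (rule_tac running_sup_attained[OF cg[OF w] le[OF w]]) force
  next
    assume "\<exists>u\<in>{s \<omega>..t \<omega>}. f \<omega> u = 0"
    then obtain u where "s \<omega> \<le> u" "u \<le> t \<omega>" "f \<omega> u = 0" by auto
    then show "0 \<le> running_sup (?g \<omega>) (s \<omega>) (t \<omega>)"
      using running_sup_upper[OF cg[OF w], of "s \<omega>" u "t \<omega>"] by simp
  qed
  then have "{\<omega> \<in> space G. 0 \<le> running_sup (?g \<omega>) (s \<omega>) (t \<omega>)} =
    {\<omega> \<in> space G. \<exists>u\<in>{s \<omega>..t \<omega>}. f \<omega> u = 0}" by auto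
  ultimately show ?thesis by simp
qed

text \<open>\<open>G\<close> stands for the information available at time \<open>t\<close>: the
  barrier is known as a whole, but the motions only up to \<open>t\<close>. The results of this
  locale say that the lines are adapted.\<close>

locale adapted_input =
  fixes G :: "'a measure" and lam :: "'a \<Rightarrow> real \<Rightarrow> real" and chi :: "'a \<Rightarrow> real"
    and q :: "nat \<Rightarrow> real \<times> real" and X :: "nat \<Rightarrow> 'a \<Rightarrow> real \<Rightarrow> real" and t :: real
  assumes lam_cont: "\<And>\<omega>. \<omega> \<in> space G \<Longrightarrow> continuous_on UNIV (lam \<omega>)"
    and lam_meas: "\<And>u. (\<lambda>\<omega>. lam \<omega> u) \<in> borel_measurable G"
    and chi_meas: "chi \<in> borel_measurable G"
    and X_cont: "\<And>\<omega> n. \<omega> \<in> space G \<Longrightarrow> continuous_on UNIV (X n \<omega>)"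
    and X_meas: "\<And>n u. u \<le> t \<Longrightarrow> (\<lambda>\<omega>. X n \<omega> u) \<in> borel_measurable G"
begin

abbreviation "Rw n \<omega> \<equiv> rab_family.R (lam \<omega>) (chi \<omega>) q (\<lambda>n. X n \<omega>) n"
abbreviation "Lw n \<omega> \<equiv> rab_family.L (lam \<omega>) (chi \<omega>) q (\<lambda>n. X n \<omega>) n"
abbreviation "live n \<omega> \<equiv> q n \<in> strict_epigraph (lam \<omega>)"
abbreviation "start n \<equiv> fst (q n)"

lemma fam: "\<omega> \<in> space G \<Longrightarrow> rab_family (lam \<omega>) (\<lambda>n. X n \<omega>)"
  using lam_cont X_cont by (simp add: rab_family_def)

lemma alive_sets: "{\<omega> \<in> space G. live n \<omega>} \<in> sets G"
proof -
  have "{\<omega> \<in> space G. live n \<omega>} = {\<omega> \<in> space G. lam \<omega> (start n) < snd (q n)}"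
    by (cases "q n") (auto simp: strict_epigraph_def)
  also have "\<dots> \<in> sets G" using lam_meas by measurable
  finally show ?thesis .
qed

lemma R_measurable:
  assumes u: "start n \<le> u" "u \<le> t"
  shows "(\<lambda>\<omega>. if live n \<omega> then Rw n \<omega> u else 0) \<in> borel_measurable G"
proof -
  define x where "x = start n"
  define h where "h = snd (q n)"
  \<comment> \<open>The switching time, capped at \<open>u\<close>. It enters the result only when
    \<open>u\<close> exceeds \<open>max x (chi \<omega>)\<close>, where the cap has no
    effect.\<close>
  define s where "s = (\<lambda>\<omega>. max x (min (chi \<omega>) u))"
  \<comment> \<open>Freezing the path after \<open>t\<close> keeps it continuous on the whole line
    and makes all of its values measurable at time \<open>t\<close>.\<close>
  define Y where "Y = (\<lambda>\<omega> z. X n \<omega> (min z t))"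
  define f where "f = (\<lambda>\<omega> z. lam \<omega> z - Y \<omega> z)"
  define P where "P = (\<lambda>b \<omega>. Y \<omega> (b \<omega>) + max (h - X n \<omega> x) (running_sup (f \<omega>) x (b \<omega>)))"
  have xu: "x \<le> u" "x \<le> t" using u by (auto simp: x_def)
  have s: "s \<in> borel_measurable G" unfolding s_def using chi_meas by measurable
  have s_bd: "x \<le> s \<omega>" "s \<omega> \<le> u" for \<omega> using xu by (auto simp: s_def)
  have Yc: "continuous_on UNIV (Y \<omega>)" if "\<omega> \<in> space G" for \<omega>
    unfolding Y_def by (rule continuous_on_compose2[OF X_cont[OF that]]) (auto intro!: continuous_intros)
  have Ym: "(\<lambda>\<omega>. Y \<omega> z) \<in> borel_measurable G" for z
    unfolding Y_def by (intro X_meas) simp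
  have fc: "continuous_on UNIV (f \<omega>)" if "\<omega> \<in> space G" for \<omega>
    unfolding f_def by (intro continuous_intros lam_cont Yc that)
  have fm: "(\<lambda>\<omega>. f \<omega> z) \<in> borel_measurable G" for z
    unfolding f_def using lam_meas Ym by measurable
  have Ys: "(\<lambda>\<omega>. Y \<omega> (b \<omega>)) \<in> borel_measurable G" if "b \<in> borel_measurable G" for b
    by (rule measurable_eval_continuous[where f=Y, OF Yc Ym that])
  have Pm: "P b \<in> borel_measurable G" if b: "b \<in> borel_measurable G" "\<And>\<omega>. x \<le> b \<omega>" for b
  proof -
    have "(\<lambda>\<omega>. running_sup (f \<omega>) x (b \<omega>)) \<in> borel_measurable G"
      using b by (intro measurable_running_sup[where f=f, OF fc fm]) auto
    then show ?thesis unfolding P_def using Ys[OF b(1)] X_meas[OF xu(2), of n] by measurable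
  qed
  have push: "push (lam \<omega>) (X n \<omega>) x h z = P (\<lambda>_. z) \<omega>" if "z \<le> u" for \<omega> z
  proof -
    have "running_sup (\<lambda>z. lam \<omega> z - X n \<omega> z) x z = running_sup (f \<omega>) x z"
      unfolding running_sup_def f_def Y_def using that u by (intro SUP_cong) auto
    then show ?thesis using that u by (simp add: push_def P_def Y_def)
  qed
  define k where "k = (\<lambda>\<omega> z. Y \<omega> z - Y \<omega> (s \<omega>) + P s \<omega> - lam \<omega> z)"
  have kc: "continuous_on UNIV (k \<omega>)" if "\<omega> \<in> space G" for \<omega>
    unfolding k_def by (intro continuous_intros lam_cont Yc that)
  have km: "(\<lambda>\<omega>. k \<omega> z) \<in> borel_measurable G" for z
    unfolding k_def using lam_meas Ym Ys[OF s] Pm[OF s s_bd(1)] by measurable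
  define H where "H = {\<omega> \<in> space G. \<exists>z\<in>{s \<omega>..u}. k \<omega> z = 0}"
  have H: "H \<in> sets G" unfolding H_def
    using s s_bd by (intro measurable_hits_zero[where f=k, OF kc km]) auto
  define F where "F = (\<lambda>\<omega>. if live n \<omega> then
      (if u \<le> max x (chi \<omega>) then P (\<lambda>_. u) \<omega>
       else if \<omega> \<in> H then lam \<omega> u else Y \<omega> u - Y \<omega> (s \<omega>) + P s \<omega>) else 0)"
  have "F \<in> borel_measurable G"
    unfolding F_def
  proof (intro measurable_If)
    show "{\<omega> \<in> space G. live n \<omega>} \<in> sets G" by (rule alive_sets)
    show "P (\<lambda>_. u) \<in> borel_measurable G" using xu by (intro Pm) auto
    show "{\<omega> \<in> space G. u \<le> max x (chi \<omega>)} \<in> sets G" using chi_meas by measurable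
    show "{\<omega> \<in> space G. \<omega> \<in> H} \<in> sets G" using H by simp
    show "(\<lambda>\<omega>. Y \<omega> u - Y \<omega> (s \<omega>) + P s \<omega>) \<in> borel_measurable G"
      using Ym Ys[OF s] Pm[OF s s_bd(1)] by measurable
  qed (use lam_meas in auto)
  moreover have "(if live n \<omega> then Rw n \<omega> u else 0) = F \<omega>" if w: "\<omega> \<in> space G" for \<omega>
  proof (cases "live n \<omega>")
    case True
    interpret rab_family "lam \<omega>" "chi \<omega>" q "\<lambda>n. X n \<omega>" by (rule fam[OF w])
    have R: "Rw n \<omega> u = (if u \<le> max x (chi \<omega>) then push (lam \<omega>) (X n \<omega>) x h u
      else if \<exists>z\<in>{max x (chi \<omega>)..u}. X n \<omega> z - X n \<omega> (max x (chi \<omega>))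
          + push (lam \<omega>) (X n \<omega>) x h (max x (chi \<omega>)) = lam \<omega> z then lam \<omega> u
      else X n \<omega> u - X n \<omega> (max x (chi \<omega>)) + push (lam \<omega>) (X n \<omega>) x h (max x (chi \<omega>)))"
      unfolding R_rab x_def h_def
      using rab_eq[OF l_cont X_cont alive_less[OF True] u(1)] by simp
    show ?thesis
    proof (cases "u \<le> max x (chi \<omega>)")
      case True
      then show ?thesis using \<open>live n \<omega>\<close> by (simp add: R F_def push)
    next
      case False
      then have s_eq: "max x (chi \<omega>) = s \<omega>" by (auto simp: s_def)
      have Y: "X n \<omega> z = Y \<omega> z" if "z \<le> u" for z using that u by (simp add: Y_def)
      have "P (\<lambda>_. s \<omega>) \<omega> = P s \<omega>" by (simp add: P_def)
      then have p: "push (lam \<omega>) (X n \<omega>) x h (s \<omega>) = P s \<omega>"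
        using push[of "s \<omega>" \<omega>] s_bd(2) by simp
      have "(\<exists>z\<in>{s \<omega>..u}. X n \<omega> z - X n \<omega> (s \<omega>) + P s \<omega> = lam \<omega> z) \<longleftrightarrow> \<omega> \<in> H"
        unfolding H_def k_def using w Y s_bd(2)[of \<omega>] by (auto intro!: bex_cong)
      then show ?thesis
        using False \<open>live n \<omega>\<close> Y[OF s_bd(2)] Y[of u] unfolding R F_def s_eq p by simp
    qed
  qed (simp add: F_def)
  ultimately show ?thesis by (subst measurable_cong[of G _ F]) auto
qed

text \<open>By induction the earlier lines are measurable. Hence so is the capped meeting time, then
  the event that the line \<open>k\<close> is met at that time, then the least such
  \<open>k\<close>; the value is that of this line or of the own path.\<close>

lemma L_measurable:
  assumes "start n \<le> u" "u \<le> t"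
  shows "(\<lambda>\<omega>. if live n \<omega> then Lw n \<omega> u else 0) \<in> borel_measurable G"
  using assms
proof (induction n arbitrary: u rule: less_induct)
  case (less n)
  define m where "m = (\<lambda>\<omega>. if live n \<omega> then rab_family.merge_time (lam \<omega>) (chi \<omega>) q (\<lambda>n. X n \<omega>) n u else u)"
  define D where "D = (\<lambda>k. max (start n) (start k))"
  \<comment> \<open>Between the later of the two births and \<open>u\<close>, the zeros of
    \<open>g k\<close> are the meetings with the line \<open>k\<close>. The value 1 excludes
    undefined lines, and clamping the argument gives a continuous function on the whole
    line.\<close>
  define g where "g = (\<lambda>k \<omega> z. if live n \<omega> \<and> live k \<omega>
    then Rw n \<omega> (max (start n) (min z u)) - Lw k \<omega> (max (start k) (min z u)) else 1)"
  have gc: "continuous_on UNIV (g k \<omega>)" if w: "\<omega> \<in> space G" and "start k \<le> u" for k \<omega>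
  proof (cases "live n \<omega> \<and> live k \<omega>")
    case True
    interpret rab_family "lam \<omega>" "chi \<omega>" q "\<lambda>n. X n \<omega>" by (rule fam[OF w])
    have "continuous_on UNIV (\<lambda>z. Rw n \<omega> (max (start n) (min z u)))"
      by (rule continuous_on_compose2[OF R_continuous[of n]]) (use True in \<open>auto intro!: continuous_intros\<close>)
    moreover have "continuous_on UNIV (\<lambda>z. Lw k \<omega> (max (start k) (min z u)))"
      by (rule continuous_on_compose2[OF L_continuous[of k]]) (use True in \<open>auto intro!: continuous_intros\<close>)
    ultimately show ?thesis using True by (auto simp: g_def intro!: continuous_intros)
  qed (auto simp: g_def)
  have gm: "(\<lambda>\<omega>. g k \<omega> z) \<in> borel_measurable G" if k: "k < n" "start k \<le> u" for k z
  proof -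
    have 1: "(\<lambda>\<omega>. if live n \<omega> then Rw n \<omega> (max (start n) (min z u)) else 0) \<in> borel_measurable G"
      using less.prems by (intro R_measurable) auto
    have 2: "(\<lambda>\<omega>. if live k \<omega> then Lw k \<omega> (max (start k) (min z u)) else 0) \<in> borel_measurable G"
      using less.prems k by (intro less.IH) auto
    have "{\<omega> \<in> space G. live n \<omega> \<and> live k \<omega>} \<in> sets G"
      using alive_sets by (rule sets.sets_Collect_conj[OF _ alive_sets])
    then have "(\<lambda>\<omega>. if live n \<omega> \<and> live k \<omega> then
        (if live n \<omega> then Rw n \<omega> (max (start n) (min z u)) else 0) -
        (if live k \<omega> then Lw k \<omega> (max (start k) (min z u)) else 0) else 1) \<in> borel_measurable G"
      using 1 2 by (intro measurable_If) auto
    then show ?thesis unfolding g_def by (rule measurable_cong[THEN iffD1, rotated]) auto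
  qed
  have meets: "k \<in> rab_family.meets (lam \<omega>) (chi \<omega>) q (\<lambda>n. X n \<omega>) n z \<longleftrightarrow>
      k < n \<and> start k \<le> z \<and> g k \<omega> z = 0"
    if "\<omega> \<in> space G" "live n \<omega>" "start n \<le> z" "z \<le> u" for \<omega> k z
    using that by (auto simp: rab_family.meets_def[OF fam] g_def max_def)
  have m_le: "start n \<le> m \<omega>" "m \<omega> \<le> u" if "\<omega> \<in> space G" for \<omega>
    using rab_family.merge_time_bounds[OF fam[OF that], of q n u "chi \<omega>"] less.prems by (auto simp: m_def)
  have mm: "m \<in> borel_measurable G"
    unfolding borel_measurable_iff_le
  proof
    fix a
    show "{\<omega> \<in> space G. m \<omega> \<le> a} \<in> sets G"
    proof (cases "u \<le> a")
      case True
      then have "{\<omega> \<in> space G. m \<omega> \<le> a} = space G" using m_le by force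
      then show ?thesis by simp
    next
      case False
      define K where "K = {k. k < n \<and> start k \<le> a \<and> start n \<le> a}"
      have "m \<omega> \<le> a \<longleftrightarrow> live n \<omega> \<and> (\<exists>k\<in>K. \<exists>z\<in>{D k..a}. g k \<omega> z = 0)"
        if w: "\<omega> \<in> space G" for \<omega>
      proof (cases "live n \<omega>")
        case True
        have "m \<omega> \<le> a \<longleftrightarrow> (\<exists>z. start n \<le> z \<and> z \<le> a \<and>
            rab_family.meets (lam \<omega>) (chi \<omega>) q (\<lambda>n. X n \<omega>) n z \<noteq> {})"
          using rab_family.merge_time_le_iff[OF fam[OF w], where q=q and n=n and u=u and a=a and c="chi \<omega>"]
            False True less.prems(1)
          by (simp add: m_def)
        also have "\<dots> \<longleftrightarrow> (\<exists>z. start n \<le> z \<and> z \<le> a \<and> (\<exists>k<n. start k \<le> z \<and> g k \<omega> z = 0))"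
        proof -
          have "rab_family.meets (lam \<omega>) (chi \<omega>) q (\<lambda>n. X n \<omega>) n z \<noteq> {} \<longleftrightarrow>
              (\<exists>k<n. start k \<le> z \<and> g k \<omega> z = 0)" if "start n \<le> z" "z \<le> a" for z
            using meets[OF w True that(1)] that False by auto
          then show ?thesis by blast
        qed
        also have "\<dots> \<longleftrightarrow> (\<exists>k\<in>K. \<exists>z\<in>{D k..a}. g k \<omega> z = 0)"
          unfolding K_def D_def by fastforce
        finally show ?thesis using True by simp
      next
        case False': False
        then show ?thesis using False by (simp add: m_def)
      qed
      then have "{\<omega> \<in> space G. m \<omega> \<le> a} =
        {\<omega> \<in> space G. live n \<omega>} \<inter> (\<Union>k\<in>K. {\<omega> \<in> space G. \<exists>z\<in>{D k..a}. g k \<omega> z = 0})" by auto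
      also have "\<dots> \<in> sets G"
      proof (intro sets.Int alive_sets sets.finite_UN)
        show "finite K" by (simp add: K_def)
        fix k assume k: "k \<in> K"
        show "{\<omega> \<in> space G. \<exists>z\<in>{D k..a}. g k \<omega> z = 0} \<in> sets G"
          using k False less.prems
          by (intro measurable_hits_zero[where f="g k"] gc gm) (auto simp: K_def D_def)
      qed
      finally show ?thesis .
    qed
  qed
  \<comment> \<open>The event that the line \<open>k\<close> is met at the time \<open>m\<close>.
    Indices not below \<open>n\<close>, or of lines not yet born at \<open>u\<close>, get the empty
    set, so they are never the least index of an event that occurs.\<close>
  define S where "S = (\<lambda>k. if k < n \<and> start k \<le> u
    then {\<omega> \<in> space G. live n \<omega> \<and> start k \<le> m \<omega> \<and> g k \<omega> (m \<omega>) = 0} else {})"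
  have S: "S k \<in> sets G" for k
  proof (cases "k < n \<and> start k \<le> u")
    case True
    have "(\<lambda>\<omega>. g k \<omega> (m \<omega>)) \<in> borel_measurable G"
      using True by (intro measurable_eval_continuous[where f="g k", OF gc gm mm]) auto
    then have "{\<omega> \<in> space G. start k \<le> m \<omega> \<and> g k \<omega> (m \<omega>) = 0} \<in> sets G"
      using mm by measurable
    then have "{\<omega> \<in> space G. live n \<omega>} \<inter> {\<omega> \<in> space G. start k \<le> m \<omega> \<and> g k \<omega> (m \<omega>) = 0} \<in> sets G"
      by (intro sets.Int alive_sets)
    also have "{\<omega> \<in> space G. live n \<omega>} \<inter> {\<omega> \<in> space G. start k \<le> m \<omega> \<and> g k \<omega> (m \<omega>) = 0} = S k"
      using True by (auto simp: S_def)
    finally show ?thesis .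
  qed (auto simp: S_def)
  define F where "F = (\<lambda>k \<omega>. if k < n \<and> start k \<le> u then (if live k \<omega> then Lw k \<omega> u else 0) else 0)"
  have F: "F k \<in> borel_measurable G" for k
    unfolding F_def using less.IH[of k u] less.prems by (cases "k < n \<and> start k \<le> u") auto
  have least: "(\<lambda>\<omega>. LEAST k. \<omega> \<in> S k) \<in> measurable G (count_space UNIV)"
    using S by measurable
  define N where "N = (\<lambda>\<omega>. if live n \<omega> then (if \<exists>k. \<omega> \<in> S k then F (LEAST k. \<omega> \<in> S k) \<omega> else Rw n \<omega> u) else 0)"
  have Fl: "(\<lambda>\<omega>. F (LEAST k. \<omega> \<in> S k) \<omega>) \<in> borel_measurable G"
    by (rule measurable_compose_countable[OF F least])
  have Sex: "{\<omega> \<in> space G. \<exists>k. \<omega> \<in> S k} \<in> sets G" using S by measurable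
  have "(\<lambda>\<omega>. if live n \<omega> then (if \<exists>k. \<omega> \<in> S k then F (LEAST k. \<omega> \<in> S k) \<omega>
      else if live n \<omega> then Rw n \<omega> u else 0) else 0) \<in> borel_measurable G"
    by (rule measurable_If[OF measurable_If[OF Fl R_measurable[OF less.prems] Sex] _ alive_sets]) simp
  then have N: "N \<in> borel_measurable G"
    by (rule measurable_cong[THEN iffD1, rotated]) (simp add: N_def)
  have "(if live n \<omega> then Lw n \<omega> u else 0) = N \<omega>" if w: "\<omega> \<in> space G" for \<omega>
  proof (cases "live n \<omega>")
    case True
    interpret rab_family "lam \<omega>" "chi \<omega>" q "\<lambda>n. X n \<omega>" by (rule fam[OF w])
    have m: "m \<omega> = merge_time n u" using True by (simp add: m_def)
    have mem: "k \<in> meets n (m \<omega>) \<longleftrightarrow> \<omega> \<in> S k" for k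
      using meets[OF w True m_le[OF w], of k] w True m_le[OF w] by (auto simp: S_def)
    have Fk: "F k \<omega> = L k u" if "\<omega> \<in> S k" for k
    proof -
      have "k \<in> meets n (m \<omega>)" using that mem by simp
      then have "k < n" "live k \<omega>" "start k \<le> u" using m_le[OF w] by (auto simp: meets_def)
      then show ?thesis by (simp add: F_def)
    qed
    have "meets n (m \<omega>) = {} \<longleftrightarrow> \<not> (\<exists>k. \<omega> \<in> S k)" using mem by blast
    moreover have "F (LEAST k. \<omega> \<in> S k) \<omega> = L (LEAST k. \<omega> \<in> S k) u" if "\<exists>k. \<omega> \<in> S k"
      by (rule Fk) (use that in \<open>rule LeastI_ex\<close>)
    ultimately show ?thesis
      using L_merge_time[OF True less.prems(1)] True unfolding m[symmetric] mem N_def by simp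
  qed (simp add: N_def)
  then show ?case using N by (subst measurable_cong[of G _ N]) auto
qed

end

subsection \<open>Gaussian random walks\<close>

definition gauss :: "real \<Rightarrow> real measure"
  where "gauss s = density lborel (\<lambda>x. ennreal (normal_density 0 s x))"

lemma prob_space_gauss: "s > 0 \<Longrightarrow> prob_space (gauss s)"
  unfolding gauss_def by (rule prob_space_normal_density)

lemma sets_gauss [simp, measurable_cong]: "sets (gauss s) = sets borel"
  by (simp add: gauss_def)

lemma space_gauss [simp]: "space (gauss s) = UNIV"
  by (simp add: gauss_def)

lemma distr_uminus_gauss:
  assumes "s > 0"
  shows "distr (gauss s) borel uminus = gauss s"
proof -
  interpret prob_space "gauss s" by (rule prob_space_gauss[OF assms])
  have "distr (gauss s) lborel (\<lambda>x. x) = gauss s"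
    by (rule measure_eqI) (simp_all add: emeasure_distr)
  then have "distributed (gauss s) lborel (\<lambda>x. x) (\<lambda>x. ennreal (normal_density 0 s x))"
    unfolding distributed_def by (auto simp: gauss_def)
  from normal_density_affine[OF this assms, of "-1" 0]
  have "distributed (gauss s) lborel uminus (\<lambda>x. ennreal (normal_density 0 s x))" by simp
  then have "distr (gauss s) lborel uminus = gauss s"
    by (simp add: distributed_distr_eq_density gauss_def)
  moreover have "distr (gauss s) lborel uminus = distr (gauss s) borel uminus"
    by (rule distr_cong) auto
  ultimately show ?thesis by simp
qed

lemma measure_gauss_uminus:
  assumes "s > 0" "B \<in> sets borel"
  shows "measure (gauss s) (uminus -` B) = measure (gauss s) B"
proof -
  have "measure (gauss s) B = measure (distr (gauss s) borel uminus) B"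
    using distr_uminus_gauss[OF assms(1)] by simp
  also have "\<dots> = measure (gauss s) (uminus -` B)"
    using assms(2) by (subst measure_distr) auto
  finally show ?thesis by simp
qed

lemma gauss_singleton: "measure (gauss s) {a} = 0"
proof -
  have "emeasure (gauss s) {a} = 0"
    unfolding gauss_def by (rule absolutely_continuousD[OF absolutely_continuousI_density]) auto
  then show ?thesis by (simp add: measure_def)
qed

lemma gauss_half:
  assumes "s > 0"
  shows "measure (gauss s) {..0} = 1 / 2" "measure (gauss s) {0..} = 1 / 2"
proof -
  interpret prob_space "gauss s" by (rule prob_space_gauss[OF assms])
  have "uminus -` {..0::real} = {0..}" by auto
  then have eq: "prob {0..} = prob {..0}" using measure_gauss_uminus[OF assms, of "{..0}"] by simp
  have "prob ({..0} \<union> {0<..}) = prob {..0} + prob {0<..}"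
    by (rule finite_measure_Union) auto
  moreover have "prob ({0} \<union> {0<..}) = prob {0} + prob {0<..}"
    by (rule finite_measure_Union) auto
  moreover have "{..0} \<union> {0<..} = (UNIV :: real set)" "{0} \<union> {0<..} = {0::real..}" by auto
  ultimately show "prob {..0} = 1 / 2" "prob {0..} = 1 / 2"
    using eq gauss_singleton[of s 0] prob_space by simp_all
qed

text \<open>The density is at most \<open>1 / (2 * s)\<close>, because \<open>2 * pi\<close> exceeds
  4, and the interval has length \<open>2 * c\<close>.\<close>

lemma gauss_small_ball:
  assumes "s > 0" "0 \<le> c"
  shows "measure (gauss s) {-c..c} \<le> c / s"
proof -
  interpret prob_space "gauss s" by (rule prob_space_gauss[OF assms(1)])
  have dens: "normal_density 0 s x \<le> 1 / (2 * s)" for x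
  proof -
    have "2\<^sup>2 \<le> 2 * pi" using pi_gt3 by simp
    then have "(2 * s)\<^sup>2 \<le> 2 * pi * s\<^sup>2" using assms(1) by (simp add: power2_eq_square)
    then have "2 * s \<le> sqrt (2 * pi * s\<^sup>2)" by (rule real_le_rsqrt)
    then have "1 / sqrt (2 * pi * s\<^sup>2) \<le> 1 / (2 * s)" using assms(1) by (intro divide_left_mono) auto
    moreover have "exp (- x\<^sup>2 / (2 * s\<^sup>2)) \<le> 1" by simp
    ultimately have "1 / sqrt (2 * pi * s\<^sup>2) * exp (- x\<^sup>2 / (2 * s\<^sup>2)) \<le> 1 / (2 * s) * 1"
      using assms(1) by (intro mult_mono) auto
    then show ?thesis by (simp add: normal_density_def)
  qed
  have "emeasure (gauss s) {-c..c} = (\<integral>\<^sup>+x. ennreal (normal_density 0 s x) * indicator {-c..c} x \<partial>lborel)"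
    unfolding gauss_def by (subst emeasure_density) auto
  also have "\<dots> \<le> (\<integral>\<^sup>+x. ennreal (1 / (2 * s)) * indicator {-c..c} x \<partial>lborel)"
    by (intro nn_integral_mono mult_right_mono ennreal_leI dens) auto
  also have "\<dots> = ennreal (1 / (2 * s)) * ennreal (2 * c)"
    using assms by (subst nn_integral_cmult_indicator) auto
  also have "\<dots> = ennreal (c / s)"
    using assms by (subst ennreal_mult'[symmetric]) auto
  finally show ?thesis
    using assms by (simp add: emeasure_eq_measure)
qed

text \<open>Markov's inequality for the fourth moment, which is \<open>3 * s ^ 4\<close>.\<close>

lemma gauss_tail:
  assumes "s > 0" "a > 0"
  shows "measure (gauss s) {x. a \<le> \<bar>x\<bar>} \<le> 3 * s ^ 4 / a ^ 4"
proof -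
  interpret prob_space "gauss s" by (rule prob_space_gauss[OF assms(1)])
  have [measurable]: "{x. a \<le> \<bar>x\<bar>} \<in> sets borel" for a :: real by measurable
  have mom: "has_bochner_integral lborel (\<lambda>x. normal_density 0 s x * x ^ 4) (3 * s ^ 4)"
  proof -
    have "fact (2 * 2) / ((2 / s\<^sup>2) ^ 2 * fact 2) = 3 * s ^ 4"
      using assms(1) by (simp add: fact_numeral power2_eq_square power4_eq_xxxx field_simps)
    then show ?thesis using normal_moment_even[OF assms(1), of 0 2] by simp
  qed
  have "emeasure (gauss s) {x. a \<le> \<bar>x\<bar>} =
      (\<integral>\<^sup>+x. ennreal (normal_density 0 s x) * indicator {x. a \<le> \<bar>x\<bar>} x \<partial>lborel)"
    unfolding gauss_def by (subst emeasure_density) auto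
  also have "\<dots> \<le> (\<integral>\<^sup>+x. ennreal (normal_density 0 s x * x ^ 4 / a ^ 4) \<partial>lborel)"
  proof (intro nn_integral_mono)
    fix x :: real
    show "ennreal (normal_density 0 s x) * indicator {x. a \<le> \<bar>x\<bar>} x \<le> ennreal (normal_density 0 s x * x ^ 4 / a ^ 4)"
    proof (cases "a \<le> \<bar>x\<bar>")
      case True
      have "a ^ 4 \<le> \<bar>x\<bar> ^ 4" using True assms(2) by (intro power_mono) auto
      then have "1 \<le> x ^ 4 / a ^ 4" using assms(2) by (simp add: power_even_abs)
      then have "normal_density 0 s x * 1 \<le> normal_density 0 s x * (x ^ 4 / a ^ 4)"
        by (intro mult_left_mono) auto
      then show ?thesis using True by (auto intro: ennreal_leI)
    qed simp
  qed
  also have "\<dots> = ennreal (3 * s ^ 4 / a ^ 4)"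
  proof -
    have "has_bochner_integral lborel (\<lambda>x. normal_density 0 s x * x ^ 4 / a ^ 4) (3 * s ^ 4 / a ^ 4)"
      using mom by (rule has_bochner_integral_divide_zero)
    then show ?thesis
      using assms by (subst nn_integral_eq_integral)
        (auto simp: has_bochner_integral_iff power_even_eq)
  qed
  finally show ?thesis using assms by (simp add: emeasure_eq_measure)
qed

context prob_space
begin

text \<open>Under the conditional measure given \<open>A\<close> the two variables are independent Gaussians.\<close>

lemma gauss_combine:
  assumes A: "A \<in> events" and X[measurable]: "X \<in> borel_measurable M" and Y[measurable]: "Y \<in> borel_measurable M"
    and s: "s1 > 0" "s2 > 0"
    and eq: "\<And>B C. B \<in> sets borel \<Longrightarrow> C \<in> sets borel \<Longrightarrow>
      prob (A \<inter> (X -` B \<inter> space M) \<inter> (Y -` C \<inter> space M)) = prob A * measure (gauss s1) B * measure (gauss s2) C"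
    and B: "B \<in> sets borel"
  shows "prob (A \<inter> ((\<lambda>\<omega>. X \<omega> + Y \<omega>) -` B \<inter> space M)) = prob A * measure (gauss (sqrt (s1\<^sup>2 + s2\<^sup>2))) B"
    and "prob (A \<inter> ((\<lambda>\<omega>. X \<omega> - Y \<omega>) -` B \<inter> space M)) = prob A * measure (gauss (sqrt (s1\<^sup>2 + s2\<^sup>2))) B"
proof -
  have "prob (A \<inter> ((\<lambda>\<omega>. X \<omega> + Y \<omega>) -` B \<inter> space M)) = prob A * measure (gauss (sqrt (s1\<^sup>2 + s2\<^sup>2))) B \<and>
    prob (A \<inter> ((\<lambda>\<omega>. X \<omega> - Y \<omega>) -` B \<inter> space M)) = prob A * measure (gauss (sqrt (s1\<^sup>2 + s2\<^sup>2))) B"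
  proof (cases "prob A = 0")
    case True
    then have "prob (A \<inter> E) = 0" for E
      using finite_measure_mono[of "A \<inter> E" A] A by (simp add: measure_le_0_iff)
    then show ?thesis using True by simp
  next
    case False
    have eA: "emeasure M A \<noteq> 0" "emeasure M A \<noteq> \<infinity>" using False by (auto simp: emeasure_eq_measure)
    define Q where "Q = uniform_measure M A"
    interpret Q: prob_space Q unfolding Q_def by (rule prob_space_uniform_measure[OF eA])
    have sQ [measurable_cong, simp]: "sets Q = sets M" and spQ [simp]: "space Q = space M"
      by (simp_all add: Q_def uniform_measure_def)
    have Q: "Q.prob E = prob (A \<inter> E) / prob A" if "E \<in> events" for E
      unfolding Q_def using eA that by (rule measure_uniform_measure)
    interpret g1: prob_space "gauss s1" by (rule prob_space_gauss[OF s(1)])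
    interpret g2: prob_space "gauss s2" by (rule prob_space_gauss[OF s(2)])
    have QXY: "Q.prob ((X -` B \<inter> space M) \<inter> (Y -` C \<inter> space M)) = measure (gauss s1) B * measure (gauss s2) C"
      if "B \<in> sets borel" "C \<in> sets borel" for B C
    proof -
      have "(X -` B \<inter> space M) \<inter> (Y -` C \<inter> space M) \<in> events"
        using that by (intro sets.Int measurable_sets[OF X] measurable_sets[OF Y])
      from Q[OF this] show ?thesis using eq[OF that] False by (simp add: Int_assoc)
    qed
    have QX: "Q.prob (X -` B \<inter> space M) = measure (gauss s1) B" if "B \<in> sets borel" for B
      using QXY[OF that, of UNIV] g2.prob_space by (simp add: Int_absorb2)
    have QY: "Q.prob (Y -` C \<inter> space M) = measure (gauss s2) C" if "C \<in> sets borel" for C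
      using QXY[of UNIV, OF _ that] g1.prob_space by (simp add: Int_absorb1 Int_commute)
    have dist: "distributed Q lborel Z (\<lambda>x. ennreal (normal_density 0 r x))"
      if Z[measurable]: "Z \<in> borel_measurable M" and "r > 0"
        and "\<And>C. C \<in> sets borel \<Longrightarrow> Q.prob (Z -` C \<inter> space M) = measure (gauss r) C" for Z r
    proof -
      interpret gr: prob_space "gauss r" by (rule prob_space_gauss) fact
      have "distr Q lborel Z = gauss r"
        by (rule measure_eqI) (auto simp: emeasure_distr Q.emeasure_eq_measure gr.emeasure_eq_measure that)
      then show ?thesis unfolding distributed_def by (auto simp: gauss_def)
    qed
    have dX: "distributed Q lborel X (\<lambda>x. ennreal (normal_density 0 s1 x))"
      by (rule dist[OF X s(1)]) (rule QX)
    have dY: "distributed Q lborel Y (\<lambda>x. ennreal (normal_density 0 s2 x))"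
      by (rule dist[OF Y s(2)]) (rule QY)
    have ind: "Q.indep_var borel X borel Y"
      unfolding Q.indep_var_eq
    proof (intro conjI Q.indep_set_sigma_sets Q.indep_setI)
      have *: "Int_stable {Z -` A \<inter> space Q |A. A \<in> sets borel}" for Z :: "'a \<Rightarrow> real"
      proof (unfold Int_stable_def, safe)
        fix A B :: "real set" assume "A \<in> sets borel" "B \<in> sets borel"
        then show "\<exists>C. Z -` A \<inter> space Q \<inter> (Z -` B \<inter> space Q) = Z -` C \<inter> space Q \<and> C \<in> sets borel"
          by (intro exI[of _ "A \<inter> B"]) auto
      qed
      show "Int_stable {X -` A \<inter> space Q |A. A \<in> sets borel}" by (rule *)
      show "Int_stable {Y -` A \<inter> space Q |A. A \<in> sets borel}" by (rule *)
    qed (auto simp: QXY QX QY)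
    have res: "prob (A \<inter> (Z -` B \<inter> space M)) = prob A * measure (gauss r) B"
      if d: "distributed Q lborel Z (\<lambda>x. ennreal (normal_density 0 r x))" for Z r
    proof -
      have [measurable]: "Z \<in> borel_measurable Q" using distributed_measurable[OF d] by simp
      have "Q.prob (Z -` B \<inter> space M) = measure (distr Q lborel Z) B"
        using B by (subst measure_distr) auto
      also have "\<dots> = measure (gauss r) B"
        by (simp add: distributed_distr_eq_density[OF d] gauss_def)
      finally have "prob (A \<inter> (Z -` B \<inter> space M)) / prob A = measure (gauss r) B"
        using Q[of "Z -` B \<inter> space M"] B by simp
      then show ?thesis using False by (simp add: field_simps)
    qed
    have "distributed Q lborel (\<lambda>\<omega>. X \<omega> + Y \<omega>) (\<lambda>x. ennreal (normal_density 0 (sqrt (s1\<^sup>2 + s2\<^sup>2)) x))"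
      "distributed Q lborel (\<lambda>\<omega>. X \<omega> - Y \<omega>) (\<lambda>x. ennreal (normal_density 0 (sqrt (s1\<^sup>2 + s2\<^sup>2)) x))"
      using Q.add_indep_normal[OF ind s dX dY] Q.diff_indep_normal[OF ind s dX dY] by simp_all
    from this[THEN res] show ?thesis by (rule conjI)
  qed
  then show "prob (A \<inter> ((\<lambda>\<omega>. X \<omega> + Y \<omega>) -` B \<inter> space M)) = prob A * measure (gauss (sqrt (s1\<^sup>2 + s2\<^sup>2))) B"
    and "prob (A \<inter> ((\<lambda>\<omega>. X \<omega> - Y \<omega>) -` B \<inter> space M)) = prob A * measure (gauss (sqrt (s1\<^sup>2 + s2\<^sup>2))) B"
    by auto
qed

text \<open>One product formula expresses both the independence of \<open>X\<close> from
  \<open>F\<close> and, by taking \<open>A\<close> to be the whole space, the law of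
  \<open>X\<close>.\<close>

definition fresh_gauss :: "'a measure \<Rightarrow> ('a \<Rightarrow> real) \<Rightarrow> real \<Rightarrow> bool"
  where "fresh_gauss F X s \<longleftrightarrow> X \<in> borel_measurable M \<and>
    (\<forall>A\<in>sets F. \<forall>B\<in>sets borel. prob (A \<inter> (X -` B \<inter> space M)) = prob A * measure (gauss s) B)"

lemma fresh_gaussD:
  assumes "fresh_gauss F X s" "A \<in> sets F" "B \<in> sets borel"
  shows "prob (A \<inter> (X -` B \<inter> space M)) = prob A * measure (gauss s) B"
  using assms by (simp add: fresh_gauss_def)

lemma fresh_gauss_prob:
  assumes "fresh_gauss F X s" "space F = space M" "B \<in> sets borel"
  shows "prob (X -` B \<inter> space M) = measure (gauss s) B"
proof -
  have "space M \<in> sets F" using sets.top[of F] assms(2) by simp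
  from fresh_gaussD[OF assms(1) this assms(3)] show ?thesis
    using prob_space by (simp add: Int_absorb1)
qed

lemma fresh_gauss_uminus:
  assumes "fresh_gauss F X s" "s > 0"
  shows "fresh_gauss F (\<lambda>\<omega>. - X \<omega>) s"
  unfolding fresh_gauss_def
proof (intro conjI ballI)
  show "(\<lambda>\<omega>. - X \<omega>) \<in> borel_measurable M" using assms(1) by (simp add: fresh_gauss_def)
  fix A and B :: "real set" assume AB: "A \<in> sets F" "B \<in> sets borel"
  have "uminus -` B \<in> sets borel"
    using measurable_sets[of uminus borel borel B] AB by simp
  then have "prob (A \<inter> (X -` (uminus -` B) \<inter> space M)) = prob A * measure (gauss s) (uminus -` B)"
    using assms(1) AB by (simp add: fresh_gauss_def)
  moreover have "X -` (uminus -` B) = (\<lambda>\<omega>. - X \<omega>) -` B" by auto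
  ultimately show "prob (A \<inter> ((\<lambda>\<omega>. - X \<omega>) -` B \<inter> space M)) = prob A * measure (gauss s) B"
    using measure_gauss_uminus[OF assms(2) AB(2)] by simp
qed

end

section \<open>Maximal inequality and reflection principle for Gaussian walks\<close>

locale gauss_walk = prob_space M for M :: "'a measure" +
  fixes F :: "nat \<Rightarrow> 'a measure" and S :: "nat \<Rightarrow> 'a \<Rightarrow> real" and s :: real and N :: nat
  assumes s_pos: "s > 0" and N_pos: "N > 0"
    and F_space: "\<And>i. i \<le> N \<Longrightarrow> space (F i) = space M"
    and F_events: "\<And>i. i \<le> N \<Longrightarrow> sets (F i) \<subseteq> events"
    and F_mono: "\<And>i j. i \<le> j \<Longrightarrow> j \<le> N \<Longrightarrow> sets (F i) \<subseteq> sets (F j)"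
    and S_meas: "\<And>i. i \<le> N \<Longrightarrow> S i \<in> borel_measurable (F i)"
    and S_0: "\<And>\<omega>. S 0 \<omega> = 0"
    and S_step: "\<And>i. i < N \<Longrightarrow> fresh_gauss (F i) (\<lambda>\<omega>. S (Suc i) \<omega> - S i \<omega>) s"
begin

lemma S_meas_mono: "i \<le> j \<Longrightarrow> j \<le> N \<Longrightarrow> S i \<in> borel_measurable (F j)"
  using S_meas[of i] F_mono[of i j] F_space[of i] F_space[of j]
  by (auto simp: measurable_def)

lemma S_events [measurable]: "i \<le> N \<Longrightarrow> S i \<in> borel_measurable M"
  using S_meas[of i] F_events[of i] F_space[of i] by (auto simp: measurable_def)

text \<open>The next step is independent of the past at time \<open>j\<close>, which contains both
  the event \<open>A\<close> and the sum so far; so \<open>gauss_combine\<close> applies and adds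
  \<open>s ^ 2\<close> to the variance.\<close>

lemma increment:
  assumes "i < j" "j \<le> N"
  shows "fresh_gauss (F i) (\<lambda>\<omega>. S j \<omega> - S i \<omega>) (s * sqrt (real (j - i)))"
  using assms
proof (induction j)
  case (Suc j)
  show ?case
  proof (cases "i = j")
    case True
    then show ?thesis using S_step[of j] Suc.prems by simp
  next
    case False
    with Suc have j: "i < j" "j < N" by auto
    let ?X = "\<lambda>\<omega>. S j \<omega> - S i \<omega>" and ?Y = "\<lambda>\<omega>. S (Suc j) \<omega> - S j \<omega>"
    let ?a = "s * sqrt (real (j - i))"
    have IH: "fresh_gauss (F i) ?X ?a" using Suc j by simp
    have Y: "fresh_gauss (F j) ?Y s" using S_step j by simp
    have X: "?X \<in> borel_measurable (F j)"
      using S_meas_mono[of i j] S_meas_mono[of j j] j by simp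
    have a: "?a > 0" using s_pos j by simp
    have sq: "sqrt (?a\<^sup>2 + s\<^sup>2) = s * sqrt (real (Suc j - i))"
    proof -
      have "?a\<^sup>2 + s\<^sup>2 = s\<^sup>2 * real (Suc j - i)"
        using j by (simp add: power_mult_distrib algebra_simps of_nat_diff)
      then show ?thesis using s_pos by (simp add: real_sqrt_mult)
    qed
    have Z: "S (Suc j) \<omega> - S i \<omega> = ?X \<omega> + ?Y \<omega>" for \<omega> by simp
    show ?thesis
      unfolding fresh_gauss_def
    proof (intro conjI ballI)
      show "(\<lambda>\<omega>. S (Suc j) \<omega> - S i \<omega>) \<in> borel_measurable M"
        using j S_events[of "Suc j"] S_events[of i] by (intro borel_measurable_diff) auto
      fix A and B :: "real set" assume A: "A \<in> sets (F i)" and B: "B \<in> sets borel"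
      have AM: "A \<in> events" "A \<in> sets (F j)" using A F_events[of i] F_mono[of i j] j by auto
      show "prob (A \<inter> ((\<lambda>\<omega>. S (Suc j) \<omega> - S i \<omega>) -` B \<inter> space M)) =
          prob A * measure (gauss (s * sqrt (real (Suc j - i)))) B"
        unfolding Z sq[symmetric]
      proof (rule gauss_combine(1)[OF AM(1) _ _ a s_pos _ B])
        show "?X \<in> borel_measurable M" "?Y \<in> borel_measurable M"
          using IH Y by (simp_all add: fresh_gauss_def)
        fix B C :: "real set" assume BC: "B \<in> sets borel" "C \<in> sets borel"
        have "?X -` B \<inter> space M \<in> sets (F j)"
          using measurable_sets[OF X BC(1)] F_space[of j] j by simp
        then have "A \<inter> (?X -` B \<inter> space M) \<in> sets (F j)" using AM by auto
        then have "prob (A \<inter> (?X -` B \<inter> space M) \<inter> (?Y -` C \<inter> space M)) =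
            prob (A \<inter> (?X -` B \<inter> space M)) * measure (gauss s) C"
          using Y BC by (simp add: fresh_gauss_def)
        also have "prob (A \<inter> (?X -` B \<inter> space M)) = prob A * measure (gauss ?a) B"
          using IH A BC by (simp add: fresh_gauss_def)
        finally show "prob (A \<inter> (?X -` B \<inter> space M) \<inter> (?Y -` C \<inter> space M)) =
          prob A * measure (gauss ?a) B * measure (gauss s) C" .
      qed
    qed
  qed
qed simp

definition total :: real
  where "total = s * sqrt (real N)"

lemma total_pos: "total > 0"
  using s_pos N_pos by (simp add: total_def)

lemma prob_S_N:
  assumes "B \<in> sets borel"
  shows "prob (S N -` B \<inter> space M) = measure (gauss total) B"
proof -
  have "(\<lambda>\<omega>. S N \<omega> - S 0 \<omega>) -` B = S N -` B" by (auto simp: S_0)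
  then show ?thesis
    using fresh_gauss_prob[OF increment[of 0 N] F_space[of 0] assms] N_pos by (simp add: total_def)
qed

lemma gauss_walk_uminus: "gauss_walk M F (\<lambda>i \<omega>. - S i \<omega>) s N"
proof unfold_locales
  show "fresh_gauss (F i) (\<lambda>\<omega>. - S (Suc i) \<omega> - - S i \<omega>) s" if "i < N" for i
    using fresh_gauss_uminus[OF S_step[OF that] s_pos] by (simp add: algebra_simps)
qed (use s_pos N_pos F_space F_events F_mono S_meas S_0 in auto)

text \<open>First entrance at a given step: these events are disjoint and known at time
  \<open>i\<close>, and so replace stopping at a random time.\<close>

definition first_in :: "real set \<Rightarrow> nat \<Rightarrow> 'a set"
  where "first_in B i = {\<omega> \<in> space M. S i \<omega> \<in> B \<and> (\<forall>j<i. S j \<omega> \<notin> B)}"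

lemma first_in_sets:
  assumes "i \<le> N" "B \<in> sets borel"
  shows "first_in B i \<in> sets (F i)"
proof -
  have S: "{\<omega> \<in> space (F i). S j \<omega> \<in> B} \<in> sets (F i)" if "j \<le> i" for j
    using measurable_sets[OF S_meas_mono[OF that assms(1)] assms(2)]
    by (simp add: vimage_def Int_def conj_commute)
  have "first_in B i = {\<omega> \<in> space (F i). S i \<omega> \<in> B} \<inter>
      (space (F i) - (\<Union>j\<in>{..<i}. {\<omega> \<in> space (F i). S j \<omega> \<in> B}))"
    using F_space[OF assms(1)] by (auto simp: first_in_def)
  also have "\<dots> \<in> sets (F i)" using S by (intro sets.Int sets.Diff sets.finite_UN) auto
  finally show ?thesis .
qed

lemma first_in_events: "i \<le> N \<Longrightarrow> B \<in> sets borel \<Longrightarrow> first_in B i \<in> events"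
  using first_in_sets F_events by blast

lemma first_in_disjoint: "disjoint_family_on (first_in B) I"
  by (auto simp: disjoint_family_on_def first_in_def) (metis linorder_neqE_nat)

lemma first_in_Union: "(\<Union>i\<in>{..n}. first_in B i) = {\<omega> \<in> space M. \<exists>i\<le>n. S i \<omega> \<in> B}"
proof (intro set_eqI iffI)
  fix \<omega> assume "\<omega> \<in> {\<omega> \<in> space M. \<exists>i\<le>n. S i \<omega> \<in> B}"
  then obtain i where i: "\<omega> \<in> space M" "i \<le> n" "S i \<omega> \<in> B" by auto
  define k where "k = (LEAST k. S k \<omega> \<in> B)"
  have "S k \<omega> \<in> B" "k \<le> i" "\<And>j. j < k \<Longrightarrow> S j \<omega> \<notin> B"
    unfolding k_def using i(3) by (auto intro: LeastI Least_le dest: not_less_Least)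
  then show "\<omega> \<in> (\<Union>i\<in>{..n}. first_in B i)" using i by (auto simp: first_in_def intro!: bexI[of _ k])
qed (auto simp: first_in_def)

text \<open>The increment from step \<open>i\<close> to step \<open>N\<close> is symmetric and
  independent of the first entrance at step \<open>i\<close>.\<close>

lemma first_in_half:
  assumes "i < N" "B \<in> sets borel"
  shows "prob (first_in B i \<inter> {\<omega> \<in> space M. S i \<omega> \<le> S N \<omega>}) = prob (first_in B i) / 2"
    and "prob (first_in B i \<inter> {\<omega> \<in> space M. S N \<omega> \<le> S i \<omega>}) = prob (first_in B i) / 2"
proof -
  let ?r = "s * sqrt (real (N - i))"
  have r: "?r > 0" using s_pos assms by simp
  have *: "prob (first_in B i \<inter> ((\<lambda>\<omega>. S N \<omega> - S i \<omega>) -` C \<inter> space M)) =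
      prob (first_in B i) * measure (gauss ?r) C" if "C \<in> sets borel" for C
    using increment[of i N] assms first_in_sets[of i B] that by (simp add: fresh_gauss_def)
  have "(\<lambda>\<omega>. S N \<omega> - S i \<omega>) -` {0..} \<inter> space M = {\<omega> \<in> space M. S i \<omega> \<le> S N \<omega>}"
    "(\<lambda>\<omega>. S N \<omega> - S i \<omega>) -` {..0} \<inter> space M = {\<omega> \<in> space M. S N \<omega> \<le> S i \<omega>}" by auto
  then show "prob (first_in B i \<inter> {\<omega> \<in> space M. S i \<omega> \<le> S N \<omega>}) = prob (first_in B i) / 2"
    "prob (first_in B i \<inter> {\<omega> \<in> space M. S N \<omega> \<le> S i \<omega>}) = prob (first_in B i) / 2"
    using *[of "{0..}"] *[of "{..0}"] gauss_half[OF r] by simp_all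
qed

text \<open>After a first passage at step \<open>i < N\<close> the walk ends at or above
  \<open>S i\<close>, and hence at or above \<open>a\<close>, with conditional probability one
  half.\<close>

lemma max_ge_bound:
  "prob {\<omega> \<in> space M. \<exists>i\<le>N. a \<le> S i \<omega>} \<le> 2 * prob {\<omega> \<in> space M. a \<le> S N \<omega>}"
proof -
  let ?A = "first_in {a..}" and ?E = "{\<omega> \<in> space M. a \<le> S N \<omega>}"
  have A: "?A i \<in> events" if "i \<le> N" for i using that by (intro first_in_events) auto
  have E: "?E \<in> events" by measurable
  have "prob (?A i) \<le> 2 * prob (?A i \<inter> ?E)" if i: "i \<le> N" for i
  proof (cases "i = N")
    case True
    then have "?A i \<inter> ?E = ?A i" by (auto simp: first_in_def)
    then show ?thesis by simp
  next
    case False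
    then have iN: "i < N" using i by simp
    have "?A i \<inter> {\<omega> \<in> space M. S i \<omega> \<le> S N \<omega>} \<subseteq> ?A i \<inter> ?E" by (auto simp: first_in_def)
    then have "prob (?A i \<inter> {\<omega> \<in> space M. S i \<omega> \<le> S N \<omega>}) \<le> prob (?A i \<inter> ?E)"
      using A[OF i] E by (intro finite_measure_mono) auto
    then show ?thesis using first_in_half(1)[OF iN, of "{a..}"] by simp
  qed
  then have "(\<Sum>i\<le>N. prob (?A i)) \<le> (\<Sum>i\<le>N. 2 * prob (?A i \<inter> ?E))"
    by (intro sum_mono) auto
  also have "\<dots> = 2 * prob (\<Union>i\<in>{..N}. ?A i \<inter> ?E)"
    using A E first_in_disjoint[of "{a..}" "{..N}"]
    by (subst finite_measure_finite_Union)
      (auto simp: sum_distrib_left disjoint_family_on_def)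
  also have "\<dots> \<le> 2 * prob ?E"
    using E by (intro mult_left_mono finite_measure_mono) auto
  finally have "(\<Sum>i\<le>N. prob (?A i)) \<le> 2 * prob ?E" .
  moreover have "prob (\<Union>i\<in>{..N}. ?A i) = (\<Sum>i\<le>N. prob (?A i))"
    using A first_in_disjoint by (intro finite_measure_finite_Union) auto
  moreover have "(\<Union>i\<in>{..N}. ?A i) = {\<omega> \<in> space M. \<exists>i\<le>N. a \<le> S i \<omega>}"
    using first_in_Union[of "{a..}" N] by simp
  ultimately show ?thesis by simp
qed

text \<open>Two signs, the factor 2 of \<open>max_ge_bound\<close> and the moment constant 3 make up
  the 12.\<close>

lemma max_abs_bound:
  assumes "a > 0"
  shows "prob {\<omega> \<in> space M. \<exists>i\<le>N. a \<le> \<bar>S i \<omega>\<bar>} \<le> 12 * total ^ 4 / a ^ 4"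
proof -
  interpret neg: gauss_walk M F "\<lambda>i \<omega>. - S i \<omega>" s N by (rule gauss_walk_uminus)
  have tail: "prob {\<omega> \<in> space M. a \<le> \<bar>S N \<omega>\<bar>} \<le> 3 * total ^ 4 / a ^ 4"
    using prob_S_N[of "{x. a \<le> \<bar>x\<bar>}"] gauss_tail[OF total_pos assms]
    by (simp add: vimage_def Int_def conj_commute)
  have "prob {\<omega> \<in> space M. \<exists>i\<le>N. a \<le> \<bar>S i \<omega>\<bar>} \<le>
      prob ({\<omega> \<in> space M. \<exists>i\<le>N. a \<le> S i \<omega>} \<union> {\<omega> \<in> space M. \<exists>i\<le>N. a \<le> - S i \<omega>})"
    by (intro finite_measure_mono) (auto simp: abs_if split: if_splits)
  also have "\<dots> \<le> prob {\<omega> \<in> space M. \<exists>i\<le>N. a \<le> S i \<omega>} + prob {\<omega> \<in> space M. \<exists>i\<le>N. a \<le> - S i \<omega>}"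
    by (intro measure_Un_le) auto
  also have "\<dots> \<le> 2 * prob {\<omega> \<in> space M. a \<le> S N \<omega>} + 2 * prob {\<omega> \<in> space M. a \<le> - S N \<omega>}"
    using max_ge_bound neg.max_ge_bound by (intro add_mono)
  also have "\<dots> \<le> 2 * (3 * total ^ 4 / a ^ 4) + 2 * (3 * total ^ 4 / a ^ 4)"
    using assms by (intro add_mono mult_left_mono order_trans[OF finite_measure_mono tail]) auto
  finally show ?thesis by simp
qed

lemma step_bound:
  assumes "e > 0"
  shows "prob {\<omega> \<in> space M. \<exists>i<N. e \<le> \<bar>S (Suc i) \<omega> - S i \<omega>\<bar>} \<le> real N * (3 * s ^ 4 / e ^ 4)"
proof -
  have one: "prob {\<omega> \<in> space M. e \<le> \<bar>S (Suc i) \<omega> - S i \<omega>\<bar>} \<le> 3 * s ^ 4 / e ^ 4" if "i < N" for i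
  proof -
    have [measurable]: "{x. e \<le> \<bar>x\<bar>} \<in> sets borel" by measurable
    have "prob ((\<lambda>\<omega>. S (Suc i) \<omega> - S i \<omega>) -` {x. e \<le> \<bar>x\<bar>} \<inter> space M) = measure (gauss s) {x. e \<le> \<bar>x\<bar>}"
      using that by (intro fresh_gauss_prob[OF S_step F_space]) auto
    moreover have "(\<lambda>\<omega>. S (Suc i) \<omega> - S i \<omega>) -` {x. e \<le> \<bar>x\<bar>} \<inter> space M =
        {\<omega> \<in> space M. e \<le> \<bar>S (Suc i) \<omega> - S i \<omega>\<bar>}" by auto
    ultimately show ?thesis using gauss_tail[OF s_pos assms] by simp
  qed
  have "prob (\<Union>i\<in>{..<N}. {\<omega> \<in> space M. e \<le> \<bar>S (Suc i) \<omega> - S i \<omega>\<bar>}) \<le>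
      (\<Sum>i<N. prob {\<omega> \<in> space M. e \<le> \<bar>S (Suc i) \<omega> - S i \<omega>\<bar>})"
    by (intro finite_measure_subadditive_finite) auto
  also have "\<dots> \<le> (\<Sum>i<N. 3 * s ^ 4 / e ^ 4)" using one by (intro sum_mono) auto
  finally have "prob (\<Union>i\<in>{..<N}. {\<omega> \<in> space M. e \<le> \<bar>S (Suc i) \<omega> - S i \<omega>\<bar>}) \<le> real N * (3 * s ^ 4 / e ^ 4)"
    by simp
  moreover have "(\<Union>i\<in>{..<N}. {\<omega> \<in> space M. e \<le> \<bar>S (Suc i) \<omega> - S i \<omega>\<bar>}) =
    {\<omega> \<in> space M. \<exists>i<N. e \<le> \<bar>S (Suc i) \<omega> - S i \<omega>\<bar>}" by auto
  ultimately show ?thesis by simp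
qed

text \<open>Reflection principle: the walk overshoots the level \<open>- a\<close> by less than \<open>e\<close> if no step is large.\<close>

lemma stay_bound:
  assumes "a > 0" "e > 0"
  shows "prob {\<omega> \<in> space M. \<forall>i\<le>N. - a < S i \<omega>} \<le>
    (a + e) / total + 2 * (real N * (3 * s ^ 4 / e ^ 4))"
proof -
  let ?A = "first_in {..-a}" and ?E = "{\<omega> \<in> space M. S N \<omega> < - (a + e)}"
  let ?J = "{\<omega> \<in> space M. \<exists>i<N. e \<le> \<bar>S (Suc i) \<omega> - S i \<omega>\<bar>}"
  let ?H = "\<lambda>i. ?A i \<inter> {\<omega> \<in> space M. S N \<omega> \<le> S i \<omega>}"
  have A: "?A i \<in> events" if "i \<le> N" for i using that by (intro first_in_events) auto
  have H: "?H i \<in> events" if "i < N" for i using A[of i] that by auto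
  have E: "?E \<in> events" and J: "?J \<in> events" by measurable
  have Un: "(\<Union>i\<in>{..N}. ?A i) = {\<omega> \<in> space M. \<exists>i\<le>N. S i \<omega> \<le> - a}"
    using first_in_Union[of "{..-a}" N] by simp
  \<comment> \<open>If no step reaches the size \<open>e\<close>, the walk is still above
    \<open>- (a + e)\<close> at its first passage to \<open>- a\<close>. Ending below
    \<open>- (a + e)\<close> then means ending below the value at that passage.\<close>
  have sub: "?E \<subseteq> (\<Union>i\<in>{..<N}. ?H i) \<union> ?J"
  proof
    fix \<omega> assume w: "\<omega> \<in> ?E"
    show "\<omega> \<in> (\<Union>i\<in>{..<N}. ?H i) \<union> ?J"
    proof (cases "\<omega> \<in> ?J")
      case False
      have "\<omega> \<in> (\<Union>i\<in>{..N}. ?A i)" unfolding Un using w assms by auto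
      then obtain i where i: "i \<le> N" "\<omega> \<in> ?A i" by auto
      have "i \<noteq> 0" using i(2) assms S_0[of \<omega>] by (intro notI) (simp add: first_in_def)
      then obtain j where j: "i = Suc j" by (cases i) auto
      have "- a < S j \<omega>" using i(2) j by (auto simp: first_in_def)
      moreover have "\<bar>S (Suc j) \<omega> - S j \<omega>\<bar> < e" using False w i(1) j by (simp add: not_le)
      ultimately have "- (a + e) < S i \<omega>" using j by auto
      then have "S N \<omega> < S i \<omega>" using w by auto
      moreover then have "i < N" using i(1) by (cases "i = N") auto
      ultimately show ?thesis using w i by auto
    qed simp
  qed
  have disj: "disjoint_family_on ?H {..<N}"
    using first_in_disjoint[of "{..-a}" "{..<N}"] by (auto simp: disjoint_family_on_def)
  have "prob ?E \<le> prob ((\<Union>i\<in>{..<N}. ?H i) \<union> ?J)"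
    using H J by (intro finite_measure_mono sub) auto
  also have "\<dots> \<le> prob (\<Union>i\<in>{..<N}. ?H i) + prob ?J"
    using H J by (intro measure_Un_le) auto
  also have "prob (\<Union>i\<in>{..<N}. ?H i) = (\<Sum>i<N. prob (?H i))"
    using H disj by (intro finite_measure_finite_Union) auto
  also have "\<dots> = (\<Sum>i<N. prob (?A i)) / 2"
    unfolding sum_divide_distrib by (intro sum.cong refl first_in_half(2)) auto
  also have "(\<Sum>i<N. prob (?A i)) \<le> (\<Sum>i\<le>N. prob (?A i))"
    by (intro sum_mono2) auto
  also have "(\<Sum>i\<le>N. prob (?A i)) = prob (\<Union>i\<in>{..N}. ?A i)"
    using A first_in_disjoint by (intro finite_measure_finite_Union[symmetric]) auto
  finally have 1: "2 * prob ?E - 2 * prob ?J \<le> prob {\<omega> \<in> space M. \<exists>i\<le>N. S i \<omega> \<le> - a}"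
    unfolding Un by simp
  have "space M - {\<omega> \<in> space M. \<exists>i\<le>N. S i \<omega> \<le> - a} = {\<omega> \<in> space M. \<forall>i\<le>N. - a < S i \<omega>}"
    by (auto simp: not_le)
  then have 2: "prob {\<omega> \<in> space M. \<forall>i\<le>N. - a < S i \<omega>} = 1 - prob {\<omega> \<in> space M. \<exists>i\<le>N. S i \<omega> \<le> - a}"
    using prob_compl[of "{\<omega> \<in> space M. \<exists>i\<le>N. S i \<omega> \<le> - a}"] by simp
  interpret g: prob_space "gauss total" by (rule prob_space_gauss[OF total_pos])
  let ?c = "a + e"
  have c: "?c > 0" using assms by simp
  have PE: "prob ?E = measure (gauss total) {..<-?c}"
    using prob_S_N[of "{..<-?c}"] by (simp add: vimage_def Int_def conj_commute)
  have "uminus -` {..<-?c} = {?c<..}" by auto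
  then have sym: "measure (gauss total) {?c<..} = measure (gauss total) {..<-?c}"
    using measure_gauss_uminus[OF total_pos, of "{..<-?c}"] by simp
  \<comment> \<open>Twice the mass of one tail is one minus the mass of \<open>{-?c..?c}\<close>.
    The latter is what remains for the walks that stay above \<open>- a\<close>, apart from large
    steps.\<close>
  have "measure (gauss total) (({..<-?c} \<union> {-?c..?c}) \<union> {?c<..}) =
      measure (gauss total) {..<-?c} + measure (gauss total) {-?c..?c} + measure (gauss total) {?c<..}"
    using c by (subst g.finite_measure_Union) (auto intro!: g.finite_measure_Union)
  moreover have "({..<-?c} \<union> {-?c..?c}) \<union> {?c<..} = UNIV" using c by auto
  ultimately have "1 = 2 * prob ?E + measure (gauss total) {-?c..?c}"
    using g.prob_space sym PE by simp
  moreover have "measure (gauss total) {-?c..?c} \<le> ?c / total"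
    using c by (intro gauss_small_ball total_pos) simp
  ultimately show ?thesis using 1 2 step_bound[OF assms(2)] by linarith
qed

end

subsection \<open>Discretised lines\<close>

definition grid :: "real \<Rightarrow> real \<Rightarrow> nat \<Rightarrow> nat \<Rightarrow> real"
  where "grid a b N i = a + (b - a) * real i / real N"

lemma grid_0 [simp]: "grid a b N 0 = a"
  by (simp add: grid_def)

lemma grid_N: "N > 0 \<Longrightarrow> grid a b N N = b"
  by (simp add: grid_def)

lemma grid_mono: "a \<le> b \<Longrightarrow> i \<le> j \<Longrightarrow> grid a b N i \<le> grid a b N j"
  unfolding grid_def by (intro add_left_mono divide_right_mono mult_left_mono) auto

lemma grid_Suc: "grid a b N (Suc i) - grid a b N i = (b - a) / real N"
  by (simp add: grid_def algebra_simps add_divide_distrib diff_divide_distrib)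

lemma grid_bounds: "a \<le> b \<Longrightarrow> N > 0 \<Longrightarrow> i \<le> N \<Longrightarrow> a \<le> grid a b N i \<and> grid a b N i \<le> b"
  using grid_mono[of a b 0 i N] grid_mono[of a b i N N] grid_N[of N a b] by simp

lemma grid_cell:
  assumes "a < b" "N > 0" "a \<le> y" "y \<le> b"
  obtains i where "i < N" "grid a b N i \<le> y" "y \<le> grid a b N (Suc i)"
proof -
  define P where "P = (\<lambda>i. y \<le> grid a b N (Suc i))"
  have PN: "P (N - 1)" using assms grid_N[of N a b] by (simp add: P_def)
  define i where "i = (LEAST i. P i)"
  have "P i" unfolding i_def using PN by (rule LeastI)
  moreover have "i \<le> N - 1" unfolding i_def using PN by (rule Least_le)
  moreover have "grid a b N i \<le> y"
  proof (cases i)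
    case 0
    then show ?thesis using assms by simp
  next
    case (Suc j)
    then have "\<not> P j" using not_less_Least[of j P] by (simp add: i_def)
    then show ?thesis using Suc by (simp add: P_def)
  qed
  ultimately show thesis using assms(2) by (intro that[of i]) (auto simp: P_def)
qed

lemma continuous_grid_modulus:
  fixes f :: "real \<Rightarrow> real"
  assumes f: "continuous_on {a..b} f" and "a < b" "e > 0"
  shows "\<forall>\<^sub>F N in sequentially. \<forall>i<N. \<forall>z. grid a b N i \<le> z \<longrightarrow> z \<le> grid a b N (Suc i) \<longrightarrow>
    \<bar>f z - f (grid a b N i)\<bar> \<le> e"
proof -
  have "uniformly_continuous_on {a..b} f"
    using f by (intro compact_uniformly_continuous) auto
  then obtain d where d: "d > 0" "\<And>x y. x \<in> {a..b} \<Longrightarrow> y \<in> {a..b} \<Longrightarrow> dist y x < d \<Longrightarrow> dist (f y) (f x) < e"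
    using \<open>e > 0\<close> unfolding uniformly_continuous_on_def by metis
  obtain N0 :: nat where N0: "(b - a) / d < real N0" using reals_Archimedean2 by blast
  show ?thesis
    unfolding eventually_sequentially
  proof (intro exI allI impI)
    fix N i z assume N: "Suc N0 \<le> N" and i: "i < N" and z: "grid a b N i \<le> z" "z \<le> grid a b N (Suc i)"
    have "(b - a) / d < real N" using N0 N by simp
    then have "(b - a) / real N < d" using d(1) N by (simp add: field_simps)
    then have "dist z (grid a b N i) < d" using z grid_Suc[of a b N i] by (auto simp: dist_real_def)
    moreover have "z \<in> {a..b}" "grid a b N i \<in> {a..b}"
      using z grid_bounds[of a b N i] grid_bounds[of a b N "Suc i"] i \<open>a < b\<close> by auto
    ultimately have "dist (f z) (f (grid a b N i)) < e" by (intro d(2))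
    then show "\<bar>f z - f (grid a b N i)\<bar> \<le> e" by (simp add: dist_real_def)
  qed
qed

context rab_family
begin

text \<open>The index is read off at the left end of each cell, so it is known before the increment
  that it selects; this is what makes the sum a Gaussian walk.\<close>

definition stitched :: "nat \<Rightarrow> real \<Rightarrow> real \<Rightarrow> nat \<Rightarrow> nat \<Rightarrow> real"
  where "stitched n a b N i =
    (\<Sum>j<i. X (idx n (grid a b N j)) (grid a b N (Suc j)) - X (idx n (grid a b N j)) (grid a b N j))"

text \<open>The motions are controlled for all \<open>k \<le> n\<close> because \<open>idx n\<close>
  takes only such values.\<close>

definition fine_mesh :: "nat \<Rightarrow> real \<Rightarrow> real \<Rightarrow> real \<Rightarrow> nat \<Rightarrow> bool"
  where "fine_mesh n a b e N \<longleftrightarrow> (\<forall>i<N. \<forall>z. grid a b N i \<le> z \<longrightarrow> z \<le> grid a b N (Suc i) \<longrightarrow>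
    \<bar>L n z - L n (grid a b N i)\<bar> \<le> e \<and> (\<forall>k\<le>n. \<bar>X k z - X k (grid a b N i)\<bar> \<le> e))"

lemma eventually_fine_mesh:
  assumes "alive n" "birth n \<le> a" "a < b" "e > 0"
  shows "\<forall>\<^sub>F N in sequentially. fine_mesh n a b e N"
proof -
  have "continuous_on {a..b} (L n)"
    using L_continuous[OF assms(1)] assms(2) by (rule_tac continuous_on_subset) auto
  from continuous_grid_modulus[OF this assms(3,4)]
  have 1: "\<forall>\<^sub>F N in sequentially. \<forall>i<N. \<forall>z. grid a b N i \<le> z \<longrightarrow> z \<le> grid a b N (Suc i) \<longrightarrow>
    \<bar>L n z - L n (grid a b N i)\<bar> \<le> e" .
  have 2: "\<forall>\<^sub>F N in sequentially. \<forall>k\<in>{..n}. \<forall>i<N. \<forall>z. grid a b N i \<le> z \<longrightarrow> z \<le> grid a b N (Suc i) \<longrightarrow>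
    \<bar>X k z - X k (grid a b N i)\<bar> \<le> e"
  proof (subst eventually_ball_finite_distrib, simp, rule ballI)
    fix k
    have "continuous_on {a..b} (X k)" using X_cont by (rule continuous_on_subset) auto
    from continuous_grid_modulus[OF this assms(3,4)]
    show "\<forall>\<^sub>F N in sequentially. \<forall>i<N. \<forall>z. grid a b N i \<le> z \<longrightarrow> z \<le> grid a b N (Suc i) \<longrightarrow>
      \<bar>X k z - X k (grid a b N i)\<bar> \<le> e" .
  qed
  from 1 2 show ?thesis unfolding fine_mesh_def by eventually_elim auto
qed

text \<open>A cell of the grid contributes an error only if the followed index drops during that cell,
  which happens at most \<open>n\<close> times.\<close>

lemma stitched_ge:
  assumes n: "alive n" "birth n \<le> a" and ab: "a < b" and f: "fine_mesh n a b e N" and e: "e \<ge> 0"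
    and i: "i \<le> N" and free: "\<And>j. j < i \<Longrightarrow> grid a b N (Suc j) \<le> c \<or> l (grid a b N (Suc j)) < L n (grid a b N (Suc j))"
  shows "stitched n a b N i - 2 * e * real n \<le> L n (grid a b N i) - L n a"
proof -
  let ?g = "grid a b N"
  \<comment> \<open>The induction carries the error as a multiple of the total drop of the index so
    far; a cell without a drop then adds nothing.\<close>
  have "stitched n a b N i - 2 * e * (real (idx n a) - real (idx n (?g i))) \<le> L n (?g i) - L n a"
    using i free
  proof (induction i)
    case (Suc i)
    have g: "birth n \<le> ?g i" "?g i \<le> ?g (Suc i)"
      using n(2) grid_mono[of a b 0 i N] grid_mono[of a b i "Suc i" N] ab by auto
    let ?d = "X (idx n (?g i)) (?g (Suc i)) - X (idx n (?g i)) (?g i)"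
    have IH: "stitched n a b N i - 2 * e * (real (idx n a) - real (idx n (?g i))) \<le> L n (?g i) - L n a"
      using Suc by simp
    have "?d - 2 * e * (real (idx n (?g i)) - real (idx n (?g (Suc i)))) \<le> L n (?g (Suc i)) - L n (?g i)"
    proof (cases "idx n (?g (Suc i)) = idx n (?g i)")
      case True
      then show ?thesis using cell_ge[OF n(1) g True] Suc.prems(2)[of i] by simp
    next
      case False
      then have "idx n (?g (Suc i)) < idx n (?g i)" using idx_antimono[OF n(1) g] by simp
      then have "2 * e * 1 \<le> 2 * e * (real (idx n (?g i)) - real (idx n (?g (Suc i))))"
        using e by (intro mult_left_mono) auto
      moreover have "\<bar>?d\<bar> \<le> e" "\<bar>L n (?g (Suc i)) - L n (?g i)\<bar> \<le> e"
        using f Suc.prems(1) g(2) idx_le[OF n(1) g(1)] by (auto simp: fine_mesh_def)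
      ultimately show ?thesis by linarith
    qed
    then show ?case using IH by (simp add: stitched_def algebra_simps)
  qed (simp add: stitched_def)
  moreover have "2 * e * (real (idx n a) - real (idx n (?g i))) \<le> 2 * e * real n"
    using e idx_le[OF n] by (intro mult_left_mono) auto
  ultimately show ?thesis by linarith
qed

text \<open>Strictly above the barrier there is neither reflection nor absorption, so the comparison
  becomes two-sided with the same error.\<close>

lemma stitched_eq:
  assumes n: "alive n" "birth n \<le> a" and ab: "a < b" and f: "fine_mesh n a b e N" and e: "e \<ge> 0"
    and i: "i \<le> N" and free: "\<And>z. a \<le> z \<Longrightarrow> z \<le> grid a b N i \<Longrightarrow> l z < L n z"
  shows "\<bar>L n (grid a b N i) - L n a - stitched n a b N i\<bar> \<le> 2 * e * real n"
proof -
  let ?g = "grid a b N"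
  have "\<bar>L n (?g i) - L n a - stitched n a b N i\<bar> \<le> 2 * e * (real (idx n a) - real (idx n (?g i)))"
    using i free
  proof (induction i)
    case (Suc i)
    have g: "birth n \<le> ?g i" "?g i \<le> ?g (Suc i)" "a \<le> ?g i"
      using n(2) grid_mono[of a b 0 i N] grid_mono[of a b i "Suc i" N] ab by auto
    let ?d = "X (idx n (?g i)) (?g (Suc i)) - X (idx n (?g i)) (?g i)"
    have IH: "\<bar>L n (?g i) - L n a - stitched n a b N i\<bar> \<le> 2 * e * (real (idx n a) - real (idx n (?g i)))"
      using Suc g by simp
    have "\<bar>L n (?g (Suc i)) - L n (?g i) - ?d\<bar> \<le> 2 * e * (real (idx n (?g i)) - real (idx n (?g (Suc i))))"
    proof (cases "idx n (?g (Suc i)) = idx n (?g i)")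
      case True
      then show ?thesis using cell_free[OF n(1) g(1,2) True] Suc.prems(2) g(3) by simp
    next
      case False
      then have "idx n (?g (Suc i)) < idx n (?g i)" using idx_antimono[OF n(1) g(1,2)] by simp
      then have "2 * e * 1 \<le> 2 * e * (real (idx n (?g i)) - real (idx n (?g (Suc i))))"
        using e by (intro mult_left_mono) auto
      moreover have "\<bar>?d\<bar> \<le> e" "\<bar>L n (?g (Suc i)) - L n (?g i)\<bar> \<le> e"
        using f Suc.prems(1) g(2) idx_le[OF n(1) g(1)] by (auto simp: fine_mesh_def)
      ultimately show ?thesis by linarith
    qed
    then show ?case using IH by (simp add: stitched_def algebra_simps)
  qed (simp add: stitched_def)
  moreover have "2 * e * (real (idx n a) - real (idx n (?g i))) \<le> 2 * e * real n"
    using e idx_le[OF n] by (intro mult_left_mono) auto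
  ultimately show ?thesis by linarith
qed

text \<open>Until the first time \<open>T\<close> at distance \<open>r\<close> from its start the
  line stays above the barrier. So the walk follows it and is itself large at the grid point just
  before \<open>T\<close>.\<close>

lemma exit_stitched:
  assumes n: "alive n" and ab: "birth n < b" and r: "r > 0"
    and low: "\<And>z. birth n \<le> z \<Longrightarrow> z \<le> b \<Longrightarrow> l z < snd (q n) - r"
    and y: "birth n \<le> y" "y \<le> b" "r \<le> \<bar>L n y - snd (q n)\<bar>"
  shows "\<forall>\<^sub>F N in sequentially. \<exists>i\<le>N. r / 2 \<le> \<bar>stitched n (birth n) b N i\<bar>"
proof -
  let ?a = "birth n" and ?h = "snd (q n)"
  \<comment> \<open>The walk errs by at most \<open>2 * e * n\<close>, and moving from
    \<open>T\<close> to the grid costs another \<open>e\<close>; together this is half of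
    \<open>r\<close>.\<close>
  define e where "e = r / (2 * (2 * real n + 1))"
  have e: "e > 0" "(2 * real n + 1) * e = r / 2" using r by (simp_all add: e_def field_simps)
  have La: "L n ?a = ?h" by (rule L_start[OF n])
  have cL: "continuous_on {?a..y} (\<lambda>z. \<bar>L n z - ?h\<bar>)"
    using L_continuous[OF n] by (intro continuous_intros) (auto elim: continuous_on_subset)
  have "\<exists>z\<ge>?a. z \<le> y \<and> \<bar>L n z - ?h\<bar> = r"
    using y r La by (intro IVT' cL) auto
  then obtain z0 where z0: "?a \<le> z0" "z0 \<le> y" "\<bar>L n z0 - ?h\<bar> = r" by blast
  define S where "S = {z. ?a \<le> z \<and> \<bar>L n z - ?h\<bar> = r}"
  have "closed S" unfolding S_def
    using L_continuous[OF n] by (intro closed_eq_on continuous_intros) auto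
  moreover have "z0 \<in> S" using z0 by (simp add: S_def)
  then have "S \<noteq> {}" by auto
  moreover have "?a \<le> u" if "u \<in> S" for u using that by (simp add: S_def)
  ultimately obtain T where "T \<in> S" and T_le: "\<And>u. u \<in> S \<Longrightarrow> T \<le> u"
    using first_time_attained[of S ?a] by metis
  then have T: "?a \<le> T" "\<bar>L n T - ?h\<bar> = r" by (simp_all add: S_def)
  have T_min: "T \<le> u" if "?a \<le> u" "\<bar>L n u - ?h\<bar> = r" for u
    using T_le[of u] that by (simp add: S_def)
  have "T \<le> b" using T_le[OF \<open>z0 \<in> S\<close>] z0 y by simp
  have inside: "\<bar>L n z - ?h\<bar> \<le> r" if z: "?a \<le> z" "z \<le> T" for z
  proof (rule ccontr)
    assume far: "\<not> ?thesis"
    moreover have "continuous_on {?a..z} (\<lambda>z. \<bar>L n z - ?h\<bar>)"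
      using L_continuous[OF n] by (intro continuous_intros) (auto elim: continuous_on_subset)
    ultimately have "\<exists>u\<ge>?a. u \<le> z \<and> \<bar>L n u - ?h\<bar> = r"
      using z r La by (intro IVT') auto
    then obtain u where "?a \<le> u" "u \<le> z" "\<bar>L n u - ?h\<bar> = r" by auto
    then have "z = T" using T_min[of u] z by auto
    then show False using T(2) far by simp
  qed
  have above: "l z < L n z" if "?a \<le> z" "z \<le> T" for z
    using inside[OF that] low[of z] that \<open>T \<le> b\<close> by auto
  show ?thesis
    using eventually_fine_mesh[OF n order_refl ab e(1)] eventually_gt_at_top[of 0]
  proof eventually_elim
    case (elim N)
    obtain i where i: "i < N" "grid ?a b N i \<le> T" "T \<le> grid ?a b N (Suc i)"
      using grid_cell[OF ab elim(2) T(1) \<open>T \<le> b\<close>] by metis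
    have "\<bar>L n (grid ?a b N i) - L n ?a - stitched n ?a b N i\<bar> \<le> 2 * e * real n"
      using i above e(1) by (intro stitched_eq[OF n order_refl ab elim(1)]) auto
    moreover have "\<bar>L n T - L n (grid ?a b N i)\<bar> \<le> e" using elim(1) i by (auto simp: fine_mesh_def)
    ultimately have "r - (2 * real n + 1) * e \<le> \<bar>stitched n ?a b N i\<bar>"
      using T(2) unfolding La by (simp add: algebra_simps)
    then show ?case using i(1) e(2) by (intro exI[of _ i]) auto
  qed
qed

text \<open>The upper line \<open>m\<close> stays strictly above \<open>n\<close>, hence above the
  barrier, and follows its motions; the lower line is only pushed upwards. As their distance stays
  positive, the difference of the walks exceeds \<open>- h\<close> up to an error below
  \<open>h\<close>.\<close>

lemma uncoalesced_stitched:
  assumes n: "alive n" "alive m" and a: "birth m = birth n" and ab: "birth n < b"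
    and h: "snd (q m) = snd (q n) + h" "h > 0"
    and sep: "L n b \<noteq> L m b" and free: "b \<le> c \<or> l b < L n b"
  shows "\<forall>z. birth n \<le> z \<longrightarrow> z \<le> b \<longrightarrow> L n z \<noteq> L m z"
    and "\<forall>\<^sub>F N in sequentially. \<forall>i\<le>N. - (2 * h) < stitched m (birth n) b N i - stitched n (birth n) b N i"
proof -
  let ?a = "birth n"
  have ne: "L n z \<noteq> L m z" if "?a \<le> z" "z \<le> b" for z
    using L_coalesce[of n m z b] n a that sep by auto
  then show "\<forall>z. ?a \<le> z \<longrightarrow> z \<le> b \<longrightarrow> L n z \<noteq> L m z" by simp
  have lt: "L n z < L m z" if "?a \<le> z" "z \<le> b" for z
  proof -
    have "L n z \<le> L m z"
      using n a that h L_start[of n] L_start[of m] by (intro L_mono[of n m ?a z]) auto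
    then show ?thesis using ne[OF that] by simp
  qed
  \<comment> \<open>With this choice the errors \<open>2 * e * n\<close> and
    \<open>2 * e * m\<close> of the two walks add up to less than \<open>h\<close>.\<close>
  define e where "e = h / (2 * (real n + real m + 1))"
  have e: "e > 0" using h by (simp add: e_def add_nonneg_pos)
  have e2: "2 * e * real n + 2 * e * real m < h"
  proof -
    define K where "K = real n + real m + 1"
    have "K > 0" by (simp add: K_def add_nonneg_pos)
    then have "2 * e * K = h" by (simp add: e_def K_def[symmetric])
    moreover have "2 * e * K = 2 * e * real n + 2 * e * real m + 2 * e" by (simp add: K_def algebra_simps)
    ultimately show ?thesis using e by simp
  qed
  have am: "birth m \<le> ?a" using a by simp
  show "\<forall>\<^sub>F N in sequentially. \<forall>i\<le>N. - (2 * h) < stitched m ?a b N i - stitched n ?a b N i"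
    using eventually_fine_mesh[OF n(1) order_refl ab e] eventually_fine_mesh[OF n(2) am ab e]
      eventually_gt_at_top[of 0]
  proof eventually_elim
    case (elim N)
    show ?case
    proof (intro allI impI)
      fix i assume i: "i \<le> N"
      have gi: "?a \<le> grid ?a b N j \<and> grid ?a b N j \<le> b" if "j \<le> N" for j
        using grid_bounds[of ?a b N j] ab elim(3) that by simp
      have "stitched n ?a b N i - 2 * e * real n \<le> L n (grid ?a b N i) - L n ?a"
      proof (rule stitched_ge[OF n(1) order_refl ab elim(1) _ i])
        fix j assume "j < i"
        then have g: "?a \<le> grid ?a b N (Suc j)" "grid ?a b N (Suc j) \<le> b" using gi[of "Suc j"] i by auto
        \<comment> \<open>A lower line on the barrier at a grid time after \<open>c\<close> would
          still be there at \<open>b\<close>, against \<open>free\<close>.\<close>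
        show "grid ?a b N (Suc j) \<le> c \<or> l (grid ?a b N (Suc j)) < L n (grid ?a b N (Suc j))"
          using L_absorbed[OF n(1) g(1) _ _ g(2)] L_ge[OF n(1) g(1)] free g by force
      qed (use e in simp)
      moreover have "\<bar>L m (grid ?a b N i) - L m ?a - stitched m ?a b N i\<bar> \<le> 2 * e * real m"
      proof (rule stitched_eq[OF n(2) am ab elim(2) _ i])
        fix z assume "?a \<le> z" "z \<le> grid ?a b N i"
        then show "l z < L m z" using lt[of z] L_ge[OF n(1), of z] gi[OF i] by auto
      qed (use e in simp)
      moreover have "L n (grid ?a b N i) < L m (grid ?a b N i)" using gi[OF i] by (intro lt) auto
      moreover have "L m ?a = L n ?a + h" using L_start[OF n(1)] L_start[OF n(2)] a h by simp
      ultimately show "- (2 * h) < stitched m ?a b N i - stitched n ?a b N i"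
        using e2 unfolding abs_le_iff by linarith
    qed
  qed
qed

end

context adapted_input
begin

lemma idx_measurable:
  assumes "start n \<le> t"
  shows "(\<lambda>\<omega>. if live n \<omega> then rab_family.idx (lam \<omega>) (chi \<omega>) q (\<lambda>n. X n \<omega>) n t else n)
    \<in> measurable G (count_space UNIV)"
proof -
  let ?Z = "\<lambda>k \<omega>. if live k \<omega> then Lw k \<omega> t else 0"
  have "{\<omega> \<in> space G. live k \<omega> \<and> live n \<omega> \<and> start k \<le> t \<and> ?Z k \<omega> = ?Z n \<omega>} \<in> sets G" for k
  proof (cases "start k \<le> t")
    case True
    have "{\<omega> \<in> space G. ?Z k \<omega> = ?Z n \<omega>} \<in> sets G"
      using L_measurable[OF True order_refl] L_measurable[OF assms order_refl] by measurable
    then have "{\<omega> \<in> space G. live k \<omega>} \<inter> {\<omega> \<in> space G. live n \<omega>} \<inter> {\<omega> \<in> space G. ?Z k \<omega> = ?Z n \<omega>} \<in> sets G"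
      by (intro sets.Int alive_sets)
    also have "{\<omega> \<in> space G. live k \<omega>} \<inter> {\<omega> \<in> space G. live n \<omega>} \<inter> {\<omega> \<in> space G. ?Z k \<omega> = ?Z n \<omega>} =
        {\<omega> \<in> space G. live k \<omega> \<and> live n \<omega> \<and> start k \<le> t \<and> ?Z k \<omega> = ?Z n \<omega>}"
      using True by auto
    finally show ?thesis .
  qed simp
  then have least: "(\<lambda>\<omega>. LEAST k. live k \<omega> \<and> live n \<omega> \<and> start k \<le> t \<and> ?Z k \<omega> = ?Z n \<omega>) \<in> measurable G (count_space UNIV)"
    by (intro measurable_Least) (simp add: pred_def)
  have "(\<lambda>\<omega>. if live n \<omega> then LEAST k. live k \<omega> \<and> live n \<omega> \<and> start k \<le> t \<and> ?Z k \<omega> = ?Z n \<omega> else n)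
      \<in> measurable G (count_space UNIV)"
    by (rule measurable_If[OF least _ alive_sets]) simp
  then show ?thesis
  proof (rule measurable_cong[THEN iffD1, rotated])
    fix \<omega> assume w: "\<omega> \<in> space G"
    show "(if live n \<omega> then LEAST k. live k \<omega> \<and> live n \<omega> \<and> start k \<le> t \<and> ?Z k \<omega> = ?Z n \<omega> else n) =
        (if live n \<omega> then rab_family.idx (lam \<omega>) (chi \<omega>) q (\<lambda>n. X n \<omega>) n t else n)"
    proof (cases "live n \<omega>")
      case True
      then have "(\<lambda>k. live k \<omega> \<and> live n \<omega> \<and> start k \<le> t \<and> ?Z k \<omega> = ?Z n \<omega>) =
          (\<lambda>k. live k \<omega> \<and> start k \<le> t \<and> Lw k \<omega> t = Lw n \<omega> t)" by (intro ext) auto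
      then show ?thesis unfolding rab_family.idx_def[OF fam[OF w]] by (simp only:)
    qed simp
  qed
qed

end

subsection \<open>Probability estimates\<close>

lemma sqrt_power4: "0 \<le> w \<Longrightarrow> sqrt w ^ 4 = w\<^sup>2"
  using power_mult[of "sqrt w" 2 2] by simp

context prob_space
begin

text \<open>A bound on the outer probability: the sets of paths below need not be measurable.\<close>

definition covered :: "'a set \<Rightarrow> real \<Rightarrow> bool"
  where "covered E p \<longleftrightarrow> (\<exists>A\<in>events. E \<subseteq> A \<and> prob A \<le> p)"

lemma coveredI: "A \<in> events \<Longrightarrow> E \<subseteq> A \<Longrightarrow> prob A \<le> p \<Longrightarrow> covered E p"
  unfolding covered_def by blast

lemma covered_mono: "covered E p \<Longrightarrow> E' \<subseteq> E \<Longrightarrow> p \<le> p' \<Longrightarrow> covered E' p'"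
  unfolding covered_def by (meson order_trans)

lemma covered_Union:
  assumes "finite I" "\<And>i. i \<in> I \<Longrightarrow> covered (E i) (p i)"
  shows "covered (\<Union>i\<in>I. E i) (\<Sum>i\<in>I. p i)"
proof -
  from assms(2) have "\<forall>i\<in>I. \<exists>A. A \<in> events \<and> E i \<subseteq> A \<and> prob A \<le> p i" by (auto simp: covered_def)
  then obtain A where A: "\<And>i. i \<in> I \<Longrightarrow> A i \<in> events \<and> E i \<subseteq> A i \<and> prob (A i) \<le> p i" by metis
  show ?thesis
  proof (rule coveredI)
    show "(\<Union>i\<in>I. A i) \<in> events" using assms(1) A by auto
    show "(\<Union>i\<in>I. E i) \<subseteq> (\<Union>i\<in>I. A i)" using A by blast
    have "prob (\<Union>i\<in>I. A i) \<le> (\<Sum>i\<in>I. prob (A i))"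
      using A assms(1) by (intro finite_measure_subadditive_finite) auto
    also have "\<dots> \<le> (\<Sum>i\<in>I. p i)" using A by (intro sum_mono) auto
    finally show "prob (\<Union>i\<in>I. A i) \<le> (\<Sum>i\<in>I. p i)" .
  qed
qed

lemma covered_Un:
  assumes "covered E p" "covered E' p'"
  shows "covered (E \<union> E') (p + p')"
proof -
  obtain A B where "A \<in> events" "E \<subseteq> A" "prob A \<le> p" "B \<in> events" "E' \<subseteq> B" "prob B \<le> p'"
    using assms unfolding covered_def by blast
  then show ?thesis
    using measure_Un_le[of A M B] by (intro coveredI[of "A \<union> B"]) auto
qed

text \<open>Fatou's lemma for covers: \<open>E\<close> lies in the lower limit of the covering sets,
  an increasing union of the tail intersections \<open>C m\<close>, each of probability at most
  \<open>c\<close>.\<close>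

lemma covered_liminf:
  assumes A: "\<And>N. covered (A N) (p N)" and E: "\<And>\<omega>. \<omega> \<in> E \<Longrightarrow> \<forall>\<^sub>F N in sequentially. \<omega> \<in> A N"
    and p: "\<forall>\<^sub>F N in sequentially. p N \<le> c"
  shows "covered E c"
proof -
  from A have "\<forall>N. \<exists>B. B \<in> events \<and> A N \<subseteq> B \<and> prob B \<le> p N" by (auto simp: covered_def)
  then obtain B where B: "\<And>N. B N \<in> events" "\<And>N. A N \<subseteq> B N" "\<And>N. prob (B N) \<le> p N" by metis
  define C where "C = (\<lambda>m. \<Inter>N\<in>{m..}. B N)"
  have C: "C m \<in> events" for m unfolding C_def using B(1) by (intro sets.countable_INT') auto
  have incC: "incseq C" unfolding C_def incseq_def by (intro allI impI INF_superset_mono) auto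
  obtain m0 where m0: "\<And>N. m0 \<le> N \<Longrightarrow> p N \<le> c" using p by (auto simp: eventually_sequentially)
  have Cc: "prob (C m) \<le> c" for m
  proof -
    have "C m \<subseteq> B (max m m0)" by (auto simp: C_def)
    then have "prob (C m) \<le> prob (B (max m m0))" using B(1) by (intro finite_measure_mono)
    then show ?thesis using B(3)[of "max m m0"] m0[of "max m m0"] by simp
  qed
  show ?thesis
  proof (rule coveredI)
    show "(\<Union>m. C m) \<in> events" using C by auto
    show "E \<subseteq> (\<Union>m. C m)"
    proof
      fix \<omega> assume "\<omega> \<in> E"
      then obtain m where "\<And>N. m \<le> N \<Longrightarrow> \<omega> \<in> A N" using E by (auto simp: eventually_sequentially)
      then show "\<omega> \<in> (\<Union>m. C m)" using B(2) by (auto simp: C_def intro!: exI[of _ m])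
    qed
    have "(\<lambda>m. prob (C m)) \<longlonglongrightarrow> prob (\<Union>m. C m)"
      using C incC by (intro finite_Lim_measure_incseq) auto
    then show "prob (\<Union>m. C m) \<le> c" using Cc by (intro LIMSEQ_le_const2) auto
  qed
qed

lemma covered_null:
  assumes "\<And>e. e > 0 \<Longrightarrow> covered E e"
  shows "covered E 0"
proof -
  have "\<exists>B. B \<in> events \<and> E \<subseteq> B \<and> prob B \<le> inverse (real (Suc N))" for N
    using assms[of "inverse (real (Suc N))"] by (auto simp: covered_def simp del: of_nat_Suc)
  then obtain B where B: "\<And>N. B N \<in> events" "\<And>N. E \<subseteq> B N" "\<And>N. prob (B N) \<le> inverse (real (Suc N))"
    by metis
  show ?thesis
  proof (rule coveredI)
    show "(\<Inter>N. B N) \<in> events" using B(1) by (intro sets.countable_INT') auto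
    show "E \<subseteq> (\<Inter>N. B N)" using B(2) by auto
    have "prob (\<Inter>N. B N) \<le> inverse (real (Suc N))" for N
      using B finite_measure_mono[of "\<Inter>N. B N" "B N"] by (meson INT_lower UNIV_I order_trans)
    then show "prob (\<Inter>N. B N) \<le> 0"
      using LIMSEQ_inverse_real_of_nat by (intro LIMSEQ_le_const) auto
  qed
qed

lemma covered_AE:
  assumes "covered {\<omega> \<in> space M. \<not> P \<omega>} 0"
  shows "AE \<omega> in M. P \<omega>"
proof -
  obtain A where A: "A \<in> events" "{\<omega> \<in> space M. \<not> P \<omega>} \<subseteq> A" "prob A \<le> 0"
    using assms by (auto simp: covered_def)
  then have "emeasure M A = 0" by (simp add: emeasure_eq_measure measure_le_0_iff)
  then show ?thesis using A by (intro AE_I)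
qed

text \<open>On each of the events \<open>J \<omega> = i\<close>, which belong to \<open>F\<close>,
  the selected variable is \<open>D i\<close>. All \<open>D i\<close> have the same law, so the
  pieces add up.\<close>

lemma fresh_gauss_select:
  assumes I: "finite I" and J: "\<And>i. i \<in> I \<Longrightarrow> {\<omega> \<in> space M. J \<omega> = i} \<in> sets F" "\<And>\<omega>. \<omega> \<in> space M \<Longrightarrow> J \<omega> \<in> I"
    and F: "sets F \<subseteq> events" and D: "\<And>i. i \<in> I \<Longrightarrow> fresh_gauss F (D i) s"
  shows "fresh_gauss F (\<lambda>\<omega>. D (J \<omega>) \<omega>) s"
  unfolding fresh_gauss_def
proof (intro conjI ballI)
  let ?E = "\<lambda>i. {\<omega> \<in> space M. J \<omega> = i}"
  have split: "(\<lambda>\<omega>. D (J \<omega>) \<omega>) -` B \<inter> space M = (\<Union>i\<in>I. ?E i \<inter> (D i -` B \<inter> space M))" for B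
    using J(2) by auto
  have meas: "D i -` B \<inter> space M \<in> events" if "i \<in> I" "B \<in> sets borel" for i B
    using D[OF that(1)] that(2) by (auto simp: fresh_gauss_def intro: measurable_sets)
  have E: "?E i \<in> events" if "i \<in> I" for i using J(1)[OF that] F by auto
  show "(\<lambda>\<omega>. D (J \<omega>) \<omega>) \<in> borel_measurable M"
  proof (rule measurableI)
    fix B :: "real set" assume "B \<in> sets borel"
    then show "(\<lambda>\<omega>. D (J \<omega>) \<omega>) -` B \<inter> space M \<in> events"
      unfolding split by (intro sets.finite_UN I sets.Int[OF E meas])
  qed simp
  fix A and B :: "real set" assume A: "A \<in> sets F" and B: "B \<in> sets borel"
  have AM: "A \<in> events" using A F by auto
  have "A \<inter> ((\<lambda>\<omega>. D (J \<omega>) \<omega>) -` B \<inter> space M) = (\<Union>i\<in>I. (A \<inter> ?E i) \<inter> (D i -` B \<inter> space M))"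
    unfolding split by auto
  also have "prob \<dots> = (\<Sum>i\<in>I. prob ((A \<inter> ?E i) \<inter> (D i -` B \<inter> space M)))"
  proof (rule finite_measure_finite_Union[OF I])
    show "(\<lambda>i. (A \<inter> ?E i) \<inter> (D i -` B \<inter> space M)) ` I \<subseteq> events"
      using sets.Int[OF sets.Int[OF AM E] meas[OF _ B]] by blast
  qed (auto simp: disjoint_family_on_def)
  also have "\<dots> = (\<Sum>i\<in>I. prob (A \<inter> ?E i)) * measure (gauss s) B"
    unfolding sum_distrib_right using A B J(1) D by (intro sum.cong refl fresh_gaussD) auto
  also have "(\<Sum>i\<in>I. prob (A \<inter> ?E i)) = prob (\<Union>i\<in>I. A \<inter> ?E i)"
    using I AM E by (intro finite_measure_finite_Union[symmetric]) (auto simp: disjoint_family_on_def)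
  also have "(\<Union>i\<in>I. A \<inter> ?E i) = A" using J(2) sets.sets_into_space[OF AM] by auto
  finally show "prob (A \<inter> ((\<lambda>\<omega>. D (J \<omega>) \<omega>) -` B \<inter> space M)) = prob A * measure (gauss s) B" .
qed

end

text \<open>\<open>F t\<close> carries the information of the barrier and of the driving motions up to time \<open>t\<close>.\<close>

locale web = prob_space M for M :: "'a measure" +
  fixes v :: real and lam :: "'a \<Rightarrow> real \<Rightarrow> real" and chi :: "'a \<Rightarrow> real"
    and q :: "nat \<Rightarrow> real \<times> real" and X :: "nat \<Rightarrow> 'a \<Rightarrow> real \<Rightarrow> real" and F :: "real \<Rightarrow> 'a measure"
  assumes v_pos: "v > 0"
    and lam_cont: "\<And>\<omega>. \<omega> \<in> space M \<Longrightarrow> continuous_on UNIV (lam \<omega>)"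
    and X_cont: "\<And>\<omega> n. \<omega> \<in> space M \<Longrightarrow> continuous_on UNIV (X n \<omega>)"
    and F_space: "\<And>t. space (F t) = space M"
    and F_events: "\<And>t. sets (F t) \<subseteq> events"
    and F_mono: "\<And>s t. s \<le> t \<Longrightarrow> sets (F s) \<subseteq> sets (F t)"
    and lam_meas: "\<And>t u. (\<lambda>\<omega>. lam \<omega> u) \<in> borel_measurable (F t)"
    and chi_meas: "\<And>t. chi \<in> borel_measurable (F t)"
    and X_meas: "\<And>n u t. u \<le> t \<Longrightarrow> (\<lambda>\<omega>. X n \<omega> u) \<in> borel_measurable (F t)"
    and fresh1: "\<And>n s t. fst (q n) \<le> s \<Longrightarrow> s < t \<Longrightarrow>
      fresh_gauss (F s) (\<lambda>\<omega>. X n \<omega> t - X n \<omega> s) (sqrt (v * (t - s)))"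
    and fresh2: "\<And>n m s t. n \<noteq> m \<Longrightarrow> fst (q n) \<le> s \<Longrightarrow> fst (q m) \<le> s \<Longrightarrow> s < t \<Longrightarrow>
      fresh_gauss (F s) (\<lambda>\<omega>. (X m \<omega> t - X m \<omega> s) - (X n \<omega> t - X n \<omega> s)) (sqrt (2 * v * (t - s)))"
begin

abbreviation "L n \<omega> \<equiv> rab_family.L (lam \<omega>) (chi \<omega>) q (\<lambda>n. X n \<omega>) n"
abbreviation "alive n \<omega> \<equiv> q n \<in> strict_epigraph (lam \<omega>)"
abbreviation "birth n \<equiv> fst (q n)"

lemma fam: "\<omega> \<in> space M \<Longrightarrow> rab_family (lam \<omega>) (\<lambda>n. X n \<omega>)"
  using lam_cont X_cont by (simp add: rab_family_def)

lemma adapted: "adapted_input (F t) lam chi X t"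
  by unfold_locales (use lam_cont X_cont lam_meas chi_meas X_meas F_space in auto)

lemma F_measurable_mono: "f \<in> measurable (F s) K \<Longrightarrow> s \<le> t \<Longrightarrow> f \<in> measurable (F t) K"
  using F_mono[of s t] F_space[of s] F_space[of t] by (auto simp: measurable_def)

text \<open>The default \<open>n\<close> for an undefined line ensures that the index is always at
  most \<open>n\<close> and belongs to a line born by time \<open>t\<close>.\<close>

definition index :: "nat \<Rightarrow> real \<Rightarrow> 'a \<Rightarrow> nat"
  where "index n t \<omega> = (if alive n \<omega> then rab_family.idx (lam \<omega>) (chi \<omega>) q (\<lambda>n. X n \<omega>) n t else n)"

lemma index_measurable:
  assumes "birth n \<le> t"
  shows "index n t \<in> measurable (F t) (count_space UNIV)"
proof -
  interpret adapted_input "F t" lam chi q X t by (rule adapted)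
  show ?thesis unfolding index_def[abs_def] by (rule idx_measurable[OF assms])
qed

lemma index_bounds:
  assumes "birth n \<le> t" "\<omega> \<in> space M"
  shows "index n t \<omega> \<le> n" "birth (index n t \<omega>) \<le> t"
  using rab_family.idx_props(2)[OF fam[OF assms(2)], where q=q and n=n and t=t and c="chi \<omega>"]
    rab_family.idx_le[OF fam[OF assms(2)], where q=q and n=n and t=t and c="chi \<omega>"] assms(1)
  by (auto simp: index_def)

text \<open>A line and the line of its index have the same height at time \<open>t\<close>, so equal
  indices force equal heights. Distinct motions are what \<open>fresh2\<close> requires.\<close>

lemma index_distinct:
  assumes "birth n \<le> t" "birth m \<le> t" "\<omega> \<in> space M" "alive n \<omega>" "alive m \<omega>" "L n \<omega> t \<noteq> L m \<omega> t"
  shows "index n t \<omega> \<noteq> index m t \<omega>"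
  using rab_family.idx_props(3)[OF fam[OF assms(3)], where q=q and n=n and t=t and c="chi \<omega>"]
    rab_family.idx_props(3)[OF fam[OF assms(3)], where q=q and n=m and t=t and c="chi \<omega>"] assms
  by (auto simp: index_def)

text \<open>The selected increment is fresh at the left end of its cell because the selecting index
  is known there and takes finitely many values.\<close>

lemma gauss_walk_select:
  assumes ab: "a < b" and N: "N > 0" and s: "\<sigma> > 0"
    and J: "\<And>j. j < N \<Longrightarrow> J j \<in> measurable (F (grid a b N j)) (count_space UNIV)"
    and I: "\<And>j. finite (I j)" "\<And>j \<omega>. j < N \<Longrightarrow> \<omega> \<in> space M \<Longrightarrow> J j \<omega> \<in> I j"
    and D: "\<And>j i. j < N \<Longrightarrow> i \<in> I j \<Longrightarrow> D j i \<in> borel_measurable (F (grid a b N (Suc j)))"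
    and fresh: "\<And>j i. j < N \<Longrightarrow> i \<in> I j \<Longrightarrow> fresh_gauss (F (grid a b N j)) (D j i) \<sigma>"
  shows "gauss_walk M (\<lambda>i. F (grid a b N i)) (\<lambda>i \<omega>. \<Sum>j<i. D j (J j \<omega>) \<omega>) \<sigma> N"
proof unfold_locales
  let ?g = "grid a b N"
  have mono: "?g i \<le> ?g j" if "i \<le> j" for i j using grid_mono[OF less_imp_le[OF ab] that] .
  show "sets (F (?g i)) \<subseteq> sets (F (?g j))" if "i \<le> j" "j \<le> N" for i j
    using F_mono[OF mono[OF that(1)]] .
  have step: "(\<lambda>\<omega>. D j (J j \<omega>) \<omega>) \<in> borel_measurable (F (?g (Suc j)))" if j: "j < N" for j
  proof (rule measurableI)
    fix B :: "real set" assume B: "B \<in> sets borel"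
    have "(\<lambda>\<omega>. D j (J j \<omega>) \<omega>) -` B \<inter> space (F (?g (Suc j))) =
      (\<Union>i\<in>I j. (J j -` {i} \<inter> space (F (?g (Suc j)))) \<inter> (D j i -` B \<inter> space (F (?g (Suc j)))))"
      using I(2)[OF j] by (auto simp: F_space)
    also have "\<dots> \<in> sets (F (?g (Suc j)))"
    proof (intro sets.finite_UN I(1))
      fix i assume "i \<in> I j"
      have "J j \<in> measurable (F (?g (Suc j))) (count_space UNIV)"
        by (rule F_measurable_mono[OF J[OF j] mono]) simp
      then have "J j -` {i} \<inter> space (F (?g (Suc j))) \<in> sets (F (?g (Suc j)))"
        by (rule measurable_sets) simp
      then show "(J j -` {i} \<inter> space (F (?g (Suc j)))) \<inter> (D j i -` B \<inter> space (F (?g (Suc j)))) \<in> sets (F (?g (Suc j)))"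
        using measurable_sets[OF D[OF j \<open>i \<in> I j\<close>] B] by (rule sets.Int)
    qed
    finally show "(\<lambda>\<omega>. D j (J j \<omega>) \<omega>) -` B \<inter> space (F (?g (Suc j))) \<in> sets (F (?g (Suc j)))" .
  qed simp
  show "(\<lambda>\<omega>. \<Sum>j<i. D j (J j \<omega>) \<omega>) \<in> borel_measurable (F (?g i))" if "i \<le> N" for i
    using that by (intro borel_measurable_sum F_measurable_mono[OF step mono]) auto
  show "fresh_gauss (F (?g i)) (\<lambda>\<omega>. (\<Sum>j<Suc i. D j (J j \<omega>) \<omega>) - (\<Sum>j<i. D j (J j \<omega>) \<omega>)) \<sigma>"
    if i: "i < N" for i
  proof -
    have "fresh_gauss (F (?g i)) (\<lambda>\<omega>. D i (J i \<omega>) \<omega>) \<sigma>"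
    proof (rule fresh_gauss_select[of "I i"])
      show "{\<omega> \<in> space M. J i \<omega> = k} \<in> sets (F (?g i))" for k
        using measurable_sets[OF J[OF i], of "{k}"] by (simp add: vimage_def Int_def conj_commute F_space)
    qed (use I fresh i F_events in auto)
    then show ?thesis by simp
  qed
qed (use N s F_space F_events in auto)

lemma total_sqrt:
  assumes "a < b" "N > 0" "c > 0"
  shows "sqrt (c * ((b - a) / real N)) * sqrt (real N) = sqrt (c * (b - a))"
  using assms by (simp add: real_sqrt_mult[symmetric])

text \<open>By \<open>exit_stitched\<close>, an exit at distance \<open>r\<close> makes the walk
  deviate by \<open>r / 2\<close> on every fine grid; the threshold \<open>r / 2\<close> turns the
  12 of \<open>max_abs_bound\<close> into \<open>192 = 12 * 2 ^ 4\<close>.\<close>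

lemma exit_covered:
  assumes ab: "birth n < b" and r: "r > 0"
  shows "covered {\<omega> \<in> space M. alive n \<omega> \<and> (\<forall>z. birth n \<le> z \<longrightarrow> z \<le> b \<longrightarrow> lam \<omega> z < snd (q n) - r) \<and>
      (\<exists>y. birth n \<le> y \<and> y \<le> b \<and> r \<le> \<bar>L n \<omega> y - snd (q n)\<bar>)}
    (192 * (v * (b - birth n))\<^sup>2 / r ^ 4)"
proof (rule covered_liminf)
  let ?a = "birth n"
  let ?S = "\<lambda>N i \<omega>. \<Sum>j<i. X (index n (grid ?a b N j) \<omega>) \<omega> (grid ?a b N (Suc j)) -
    X (index n (grid ?a b N j) \<omega>) \<omega> (grid ?a b N j)"
  let ?A = "\<lambda>N. {\<omega> \<in> space M. \<exists>i\<le>N. r / 2 \<le> \<bar>?S N i \<omega>\<bar>}"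
  let ?c = "192 * (v * (b - ?a))\<^sup>2 / r ^ 4"
  \<comment> \<open>A grid has at least one cell; the trivial bound 1 for \<open>N = 0\<close>
    disappears in the limit.\<close>
  show "covered (?A N) (if N = 0 then 1 else ?c)" for N
  proof (cases "N = 0")
    case False
    then have N: "N > 0" by simp
    let ?s = "sqrt (v * ((b - ?a) / real N))"
    have s: "?s > 0" using v_pos ab N by simp
    have g: "?a \<le> grid ?a b N j" for j using grid_mono[of ?a b 0 j N] ab by simp
    interpret gauss_walk M "\<lambda>i. F (grid ?a b N i)" "?S N" ?s N
    proof (rule gauss_walk_select[OF ab N s, where I="\<lambda>j. {k. k \<le> n \<and> birth k \<le> grid ?a b N j}"
          and D="\<lambda>j k \<omega>. X k \<omega> (grid ?a b N (Suc j)) - X k \<omega> (grid ?a b N j)"])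
      fix j
      show "index n (grid ?a b N j) \<in> measurable (F (grid ?a b N j)) (count_space UNIV)"
        by (rule index_measurable[OF g])
      show "index n (grid ?a b N j) \<omega> \<in> {k. k \<le> n \<and> birth k \<le> grid ?a b N j}" if "\<omega> \<in> space M" for \<omega>
        using index_bounds[OF g that] by simp
      fix k
      show "(\<lambda>\<omega>. X k \<omega> (grid ?a b N (Suc j)) - X k \<omega> (grid ?a b N j)) \<in> borel_measurable (F (grid ?a b N (Suc j)))"
        using ab by (intro borel_measurable_diff X_meas grid_mono) auto
      assume "k \<in> {k. k \<le> n \<and> birth k \<le> grid ?a b N j}"
      moreover have "grid ?a b N j < grid ?a b N (Suc j)"
        using grid_Suc[of ?a b N j] ab N by (smt (verit) divide_pos_pos of_nat_0_less_iff)
      ultimately show "fresh_gauss (F (grid ?a b N j)) (\<lambda>\<omega>. X k \<omega> (grid ?a b N (Suc j)) - X k \<omega> (grid ?a b N j)) ?s"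
        using fresh1[of k "grid ?a b N j" "grid ?a b N (Suc j)"] grid_Suc[of ?a b N j] by simp
    qed auto
    have "total = sqrt (v * (b - ?a))" unfolding total_def by (rule total_sqrt[OF ab N v_pos])
    then have "total ^ 4 = (v * (b - ?a))\<^sup>2"
      using v_pos ab by (simp add: power4_eq_xxxx power2_eq_square)
    then have "12 * total ^ 4 / (r / 2) ^ 4 = ?c" by (simp add: power_divide)
    then have "prob (?A N) \<le> ?c" using max_abs_bound[of "r / 2"] r by simp
    moreover have "?A N \<in> events" by measurable
    ultimately show ?thesis using False by (intro coveredI) auto
  qed (auto intro!: coveredI[of "space M"])
  show "\<forall>\<^sub>F N in sequentially. (if N = 0 then 1 else ?c) \<le> ?c"
    using eventually_gt_at_top[of 0] by eventually_elim auto
  fix \<omega>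
  assume "\<omega> \<in> {\<omega> \<in> space M. alive n \<omega> \<and> (\<forall>z. ?a \<le> z \<longrightarrow> z \<le> b \<longrightarrow> lam \<omega> z < snd (q n) - r) \<and>
      (\<exists>y. ?a \<le> y \<and> y \<le> b \<and> r \<le> \<bar>L n \<omega> y - snd (q n)\<bar>)}"
  then obtain y where w: "\<omega> \<in> space M" "alive n \<omega>" "\<And>z. ?a \<le> z \<Longrightarrow> z \<le> b \<Longrightarrow> lam \<omega> z < snd (q n) - r"
    and y: "?a \<le> y" "y \<le> b" "r \<le> \<bar>L n \<omega> y - snd (q n)\<bar>" by blast
  interpret f: rab_family "lam \<omega>" "chi \<omega>" q "\<lambda>n. X n \<omega>" by (rule fam[OF w(1)])
  have "f.stitched n ?a b N i = ?S N i \<omega>" for N i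
    using w(2) by (simp add: f.stitched_def index_def)
  then show "\<forall>\<^sub>F N in sequentially. \<omega> \<in> ?A N"
    using f.exit_stitched[OF w(2) ab r w(3) y] w(1) by simp
qed

text \<open>The last clause excludes an absorbed lower line: absorption, unlike reflection, may
  lower a line relative to its motion.\<close>

definition uncoalesced :: "nat \<Rightarrow> nat \<Rightarrow> real \<Rightarrow> 'a set"
  where "uncoalesced n m b = {\<omega> \<in> space M. alive n \<omega> \<and> alive m \<omega> \<and> L n \<omega> b \<noteq> L m \<omega> b \<and>
    (b \<le> chi \<omega> \<or> lam \<omega> b < L n \<omega> b)}"

text \<open>The difference of the walks stays above \<open>- 2 * h\<close>.
  \<open>stay_bound\<close> with tolerance \<open>e = h\<close> gives \<open>3 * h\<close> over the
  standard deviation, plus a term for large steps that vanishes as the grid is refined; the constant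
  4 leaves room for it.\<close>

lemma uncoalesced_covered:
  assumes a: "birth m = birth n" and ab: "birth n < b" and h: "snd (q m) = snd (q n) + h" "h > 0"
  shows "covered (uncoalesced n m b) (4 * h / sqrt (2 * v * (b - birth n)))"
proof (rule covered_liminf)
  let ?a = "birth n" and ?V = "2 * v"
  have nm: "n \<noteq> m" using h by auto
  \<comment> \<open>Where the two indices coincide, \<open>(n, m)\<close> is a default with distinct
    entries, so every step of \<open>S\<close> is a difference of two distinct motions. On the event
    in question they never coincide.\<close>
  define J where "J = (\<lambda>t \<omega>. if index n t \<omega> \<noteq> index m t \<omega> then (index n t \<omega>, index m t \<omega>) else (n, m))"
  define S where "S = (\<lambda>N i \<omega>. \<Sum>j<i. (X (snd (J (grid ?a b N j) \<omega>)) \<omega> (grid ?a b N (Suc j)) -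
     X (snd (J (grid ?a b N j) \<omega>)) \<omega> (grid ?a b N j)) - (X (fst (J (grid ?a b N j) \<omega>)) \<omega> (grid ?a b N (Suc j)) -
     X (fst (J (grid ?a b N j) \<omega>)) \<omega> (grid ?a b N j)))"
  let ?A = "\<lambda>N. {\<omega> \<in> space M. \<forall>i\<le>N. - (2 * h) < S N i \<omega>}"
  let ?p = "\<lambda>N. 3 * h / sqrt (?V * (b - ?a)) + 6 * (?V * (b - ?a))\<^sup>2 / h ^ 4 * (1 / real N)"
  show "covered (?A N) (if N = 0 then 1 else ?p N)" for N
  proof (cases "N = 0")
    case False
    then have N: "N > 0" by simp
    let ?s = "sqrt (?V * ((b - ?a) / real N))"
    have s: "?s > 0" using v_pos ab N by simp
    have g: "?a \<le> grid ?a b N j" for j using grid_mono[of ?a b 0 j N] ab by simp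
    let ?I = "\<lambda>j. {k. fst k \<le> n \<and> snd k \<le> m \<and> fst k \<noteq> snd k \<and>
      birth (fst k) \<le> grid ?a b N j \<and> birth (snd k) \<le> grid ?a b N j}"
    interpret gauss_walk M "\<lambda>i. F (grid ?a b N i)" "S N" ?s N
      unfolding S_def
    proof (rule gauss_walk_select[OF ab N s, where I="?I" and J="\<lambda>j. J (grid ?a b N j)"
          and D="\<lambda>j k \<omega>. (X (snd k) \<omega> (grid ?a b N (Suc j)) - X (snd k) \<omega> (grid ?a b N j)) -
            (X (fst k) \<omega> (grid ?a b N (Suc j)) - X (fst k) \<omega> (grid ?a b N j))"])
      fix j
      have im: "index n (grid ?a b N j) \<in> measurable (F (grid ?a b N j)) (count_space UNIV)"
        "index m (grid ?a b N j) \<in> measurable (F (grid ?a b N j)) (count_space UNIV)"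
        using index_measurable[of n] index_measurable[of m] g[of j] a by auto
      show "J (grid ?a b N j) \<in> measurable (F (grid ?a b N j)) (count_space UNIV)"
        unfolding J_def
      proof (rule measurable_compose_countable[OF _ im(1)])
        fix i
        show "(\<lambda>\<omega>. if i \<noteq> index m (grid ?a b N j) \<omega> then (i, index m (grid ?a b N j) \<omega>) else (n, m))
            \<in> measurable (F (grid ?a b N j)) (count_space UNIV)"
          by (rule measurable_compose[OF im(2), of "\<lambda>k. if i \<noteq> k then (i, k) else (n, m)"]) simp
      qed
      show "finite (?I j)" by (rule finite_subset[of _ "{..n} \<times> {..m}"]) auto
      show "J (grid ?a b N j) \<omega> \<in> ?I j" if "\<omega> \<in> space M" for \<omega>
        using index_bounds[of n "grid ?a b N j", OF g that] index_bounds[of m "grid ?a b N j", OF _ that] g[of j] a nm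
        by (auto simp: J_def)
      fix k
      show "(\<lambda>\<omega>. (X (snd k) \<omega> (grid ?a b N (Suc j)) - X (snd k) \<omega> (grid ?a b N j)) -
            (X (fst k) \<omega> (grid ?a b N (Suc j)) - X (fst k) \<omega> (grid ?a b N j))) \<in> borel_measurable (F (grid ?a b N (Suc j)))"
        using ab by (intro borel_measurable_diff X_meas grid_mono) auto
      assume "k \<in> ?I j"
      moreover have "grid ?a b N j < grid ?a b N (Suc j)"
        using grid_Suc[of ?a b N j] ab N by (smt (verit) divide_pos_pos of_nat_0_less_iff)
      ultimately show "fresh_gauss (F (grid ?a b N j)) (\<lambda>\<omega>. (X (snd k) \<omega> (grid ?a b N (Suc j)) - X (snd k) \<omega> (grid ?a b N j)) -
            (X (fst k) \<omega> (grid ?a b N (Suc j)) - X (fst k) \<omega> (grid ?a b N j))) ?s"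
        using fresh2[of "fst k" "snd k" "grid ?a b N j" "grid ?a b N (Suc j)"] grid_Suc[of ?a b N j] by simp
    qed
    have V: "?V > 0" using v_pos by simp
    have tot: "total = sqrt (?V * (b - ?a))" unfolding total_def by (rule total_sqrt[OF ab N V])
    have "?s ^ 4 = (?V * ((b - ?a) / real N))\<^sup>2"
      using v_pos ab N by (intro sqrt_power4) simp
    then have "2 * (real N * (3 * ?s ^ 4 / h ^ 4)) = 6 * (?V * (b - ?a))\<^sup>2 / h ^ 4 * (1 / real N)"
      using N by (simp add: power2_eq_square)
    then have "prob (?A N) \<le> ?p N" using stay_bound[of "2 * h" h] h tot by simp
    moreover have "?A N \<in> events" by measurable
    ultimately show ?thesis using False by (intro coveredI) auto
  qed (auto intro!: coveredI[of "space M"])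
  show "\<forall>\<^sub>F N in sequentially. (if N = 0 then 1 else ?p N) \<le> 4 * h / sqrt (?V * (b - ?a))"
  proof -
    have "(\<lambda>N. ?p N) \<longlonglongrightarrow> 3 * h / sqrt (?V * (b - ?a)) + 6 * (?V * (b - ?a))\<^sup>2 / h ^ 4 * 0"
      by (intro tendsto_intros lim_1_over_n)
    moreover have "0 < h / sqrt (?V * (b - ?a))" using h v_pos ab by simp
    then have "3 * h / sqrt (?V * (b - ?a)) + 6 * (?V * (b - ?a))\<^sup>2 / h ^ 4 * 0 < 4 * h / sqrt (?V * (b - ?a))" by simp
    ultimately have "\<forall>\<^sub>F N in sequentially. ?p N < 4 * h / sqrt (?V * (b - ?a))" by (rule order_tendstoD(2))
    then show ?thesis using eventually_gt_at_top[of 0] by eventually_elim simp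
  qed
  fix \<omega> assume "\<omega> \<in> uncoalesced n m b"
  then have w: "\<omega> \<in> space M" "alive n \<omega>" "alive m \<omega>" "L n \<omega> b \<noteq> L m \<omega> b" "b \<le> chi \<omega> \<or> lam \<omega> b < L n \<omega> b"
    by (auto simp: uncoalesced_def)
  interpret f: rab_family "lam \<omega>" "chi \<omega>" q "\<lambda>n. X n \<omega>" by (rule fam[OF w(1)])
  note un = f.uncoalesced_stitched[OF w(2,3) a ab h w(4,5)]
  have eq: "f.stitched m ?a b N i - f.stitched n ?a b N i = S N i \<omega>" if "N > 0" "i \<le> N" for N i
    unfolding f.stitched_def S_def sum_subtractf[symmetric]
  proof (intro sum.cong refl)
    fix j assume "j \<in> {..<i}"
    then have g: "?a \<le> grid ?a b N j" "grid ?a b N j \<le> b"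
      using grid_bounds[of ?a b N j] ab that by auto
    have "index n (grid ?a b N j) \<omega> \<noteq> index m (grid ?a b N j) \<omega>"
      using un(1) g a w by (intro index_distinct) auto
    then show "X (f.idx m (grid ?a b N j)) \<omega> (grid ?a b N (Suc j)) - X (f.idx m (grid ?a b N j)) \<omega> (grid ?a b N j) -
      (X (f.idx n (grid ?a b N j)) \<omega> (grid ?a b N (Suc j)) - X (f.idx n (grid ?a b N j)) \<omega> (grid ?a b N j)) =
      X (snd (J (grid ?a b N j) \<omega>)) \<omega> (grid ?a b N (Suc j)) - X (snd (J (grid ?a b N j) \<omega>)) \<omega> (grid ?a b N j) -
      (X (fst (J (grid ?a b N j) \<omega>)) \<omega> (grid ?a b N (Suc j)) - X (fst (J (grid ?a b N j) \<omega>)) \<omega> (grid ?a b N j))"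
      using w by (simp add: J_def index_def)
  qed
  show "\<forall>\<^sub>F N in sequentially. \<omega> \<in> ?A N"
    using un(2) eventually_gt_at_top[of 0] by eventually_elim (use eq w(1) in auto)
qed

end

subsection \<open>Almost sure properties of the lines\<close>

lemma dyadic_of_int_div: "real_of_int k / 2 ^ n \<in> dyadic_rationals"
  by (auto simp: dyadic_rationals_def)

lemma dyadic_of_int: "real_of_int k \<in> dyadic_rationals"
  using dyadic_of_int_div[of k 0] by simp

lemma dyadic_diff_power:
  assumes "h \<in> dyadic_rationals"
  shows "h - 1 / 2 ^ m \<in> dyadic_rationals"
proof -
  obtain k n where h: "h = real_of_int k / 2 ^ n" using assms by (auto simp: dyadic_rationals_def)
  have "h - 1 / 2 ^ m = real_of_int (k * 2 ^ m - 2 ^ n) / 2 ^ (n + m)"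
    by (simp add: h power_add field_simps)
  then show ?thesis by (metis dyadic_of_int_div)
qed

lemma dyadic_dense:
  assumes "a < b"
  obtains d where "d \<in> dyadic_rationals" "a < d" "d < b"
proof -
  obtain n where n: "1 / (b - a) < 2 ^ n"
    using real_arch_pow[of 2 "1 / (b - a)"] by auto
  have gap: "1 < (b - a) * 2 ^ n" using n assms by (simp add: field_simps)
  define k where "k = \<lfloor>a * 2 ^ n\<rfloor> + 1"
  have k: "a * 2 ^ n < real_of_int k" "real_of_int k \<le> a * 2 ^ n + 1"
    unfolding k_def by linarith+
  have "real_of_int k < b * 2 ^ n" using k gap by (simp add: algebra_simps)
  with k show thesis
    by (intro that[of "real_of_int k / 2 ^ n"] dyadic_of_int_div) (simp_all add: field_simps)
qed

section \<open>Null sets and counting of covered events\<close>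

context prob_space
begin

lemma covered_countable:
  assumes "\<And>i::nat. covered (E i) 0"
  shows "covered (\<Union>i. E i) 0"
proof -
  from assms have "\<forall>i. \<exists>A. A \<in> events \<and> E i \<subseteq> A \<and> prob A \<le> 0" by (auto simp: covered_def)
  then obtain A where A: "\<And>i. A i \<in> events" "\<And>i. E i \<subseteq> A i" "\<And>i. prob (A i) \<le> 0" by metis
  have "A i \<in> null_sets M" for i
    using A(1,3)[of i] by (simp add: null_sets_def emeasure_eq_measure measure_le_0_iff)
  then have "(\<Union>i. A i) \<in> null_sets M" by (rule null_sets_UN)
  then have "prob (\<Union>i. A i) \<le> 0" by (simp add: null_sets_def measure_def)
  then show ?thesis using A(1,2) by (intro coveredI[of "\<Union>i. A i"]) auto
qed

text \<open>Markov's inequality for the number of covering events that occur.\<close>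

lemma covered_count:
  assumes I: "finite I" and E: "\<And>i. i \<in> I \<Longrightarrow> covered (E i) p" and k: "k > 0"
  shows "covered {\<omega> \<in> space M. k \<le> real (card {i \<in> I. \<omega> \<in> E i})} (real (card I) * p / k)"
proof -
  from E have "\<forall>i\<in>I. \<exists>A. A \<in> events \<and> E i \<subseteq> A \<and> prob A \<le> p" by (auto simp: covered_def)
  then obtain A where A: "\<And>i. i \<in> I \<Longrightarrow> A i \<in> events" "\<And>i. i \<in> I \<Longrightarrow> E i \<subseteq> A i"
    "\<And>i. i \<in> I \<Longrightarrow> prob (A i) \<le> p" by metis
  let ?Y = "\<lambda>\<omega>. \<Sum>i\<in>I. indicator (A i) \<omega> :: real"
  have Yi: "integrable M ?Y" using A(1) by (intro Bochner_Integration.integrable_sum) (auto simp: emeasure_eq_measure)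
  show ?thesis
  proof (rule coveredI)
    show "{\<omega> \<in> space M. k \<le> ?Y \<omega>} \<in> events" using Yi by measurable
    show "{\<omega> \<in> space M. k \<le> real (card {i \<in> I. \<omega> \<in> E i})} \<subseteq> {\<omega> \<in> space M. k \<le> ?Y \<omega>}"
    proof safe
      fix \<omega> assume "k \<le> real (card {i \<in> I. \<omega> \<in> E i})"
      also have "\<dots> \<le> real (card {i \<in> I. \<omega> \<in> A i})"
        using A(2) I by (intro of_nat_mono card_mono) auto
      also have "\<dots> = ?Y \<omega>"
        using I by (simp add: indicator_def sum.If_cases Int_def)
      finally show "k \<le> ?Y \<omega>" .
    qed
    have "prob {\<omega> \<in> space M. k \<le> ?Y \<omega>} \<le> (\<integral>\<omega>. ?Y \<omega> \<partial>M) / k"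
      using k by (intro integral_Markov_inequality_measure[OF Yi, where A="{}"]) (auto intro!: sum_nonneg)
    also have "(\<integral>\<omega>. ?Y \<omega> \<partial>M) = (\<Sum>i\<in>I. prob (A i))"
      using A(1) by (subst Bochner_Integration.integral_sum) (auto simp: emeasure_eq_measure sets.Int_space_eq2)
    also have "(\<Sum>i\<in>I. prob (A i)) / k \<le> real (card I) * p / k"
      using A(3) k sum_bounded_above[of I "\<lambda>i. prob (A i)" p] by (intro divide_right_mono) auto
    finally show "prob {\<omega> \<in> space M. k \<le> ?Y \<omega>} \<le> real (card I) * p / k" .
  qed
qed

end

locale dense_web = web +
  assumes q_range: "range q = dyadic_rationals \<times> dyadic_rationals"
begin

definition pt :: "real \<Rightarrow> real \<Rightarrow> nat"
  where "pt s h = (SOME n. q n = (s, h))"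

lemma q_pt: "s \<in> dyadic_rationals \<Longrightarrow> h \<in> dyadic_rationals \<Longrightarrow> q (pt s h) = (s, h)"
  unfolding pt_def by (rule someI_ex) (use q_range in \<open>metis SigmaI rangeE\<close>)

lemma q_dyadic: "birth n \<in> dyadic_rationals" "snd (q n) \<in> dyadic_rationals"
  using q_range by (metis mem_Times_iff rangeI)+

lemma alive_iff: "alive n \<omega> \<longleftrightarrow> lam \<omega> (birth n) < snd (q n)"
  by (cases "q n") (simp add: strict_epigraph_def)

text \<open>The barrier is required to stay below \<open>snd (q n) - r\<close>, so that the line
  cannot touch it before the exit.\<close>

definition exits :: "nat \<Rightarrow> real \<Rightarrow> real \<Rightarrow> 'a set"
  where "exits n b r = {\<omega> \<in> space M. alive n \<omega> \<and>
    (\<forall>z. birth n \<le> z \<longrightarrow> z \<le> b \<longrightarrow> lam \<omega> z < snd (q n) - r) \<and>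
    (\<exists>y. birth n \<le> y \<and> y \<le> b \<and> r \<le> \<bar>L n \<omega> y - snd (q n)\<bar>)}"

lemma exitsI:
  assumes "\<omega> \<in> space M" "r > 0" "\<And>z. birth n \<le> z \<Longrightarrow> z \<le> b \<Longrightarrow> lam \<omega> z < snd (q n) - r"
    "birth n \<le> y" "y \<le> b" "r \<le> \<bar>L n \<omega> y - snd (q n)\<bar>"
  shows "\<omega> \<in> exits n b r"
proof -
  have "alive n \<omega>" using assms(2) assms(3)[of "birth n"] assms(4,5) by (auto simp: alive_iff)
  then show ?thesis using assms by (auto simp: exits_def)
qed

lemma exits_covered: "birth n < b \<Longrightarrow> r > 0 \<Longrightarrow> covered (exits n b r) (192 * (v * (b - birth n))\<^sup>2 / r ^ 4)"
  unfolding exits_def by (rule exit_covered)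

text \<open>The probability of leaving a neighbourhood during a time step of length \<open>2 ^ (- m)\<close> is of
  order \<open>2 ^ (- 2 * m)\<close>, which leaves room for a union over all steps.\<close>

lemma density_covered:
  fixes K :: nat
  assumes h: "h \<in> dyadic_rationals" and r: "r > 0"
  shows "covered {\<omega> \<in> space M. \<exists>x. - real K \<le> x \<and> x \<le> real K \<and> lam \<omega> x < h - r \<and>
    (\<forall>n. alive n \<omega> \<longrightarrow> birth n < x \<longrightarrow> r \<le> \<bar>L n \<omega> x - h\<bar>)} 0" (is "covered ?E 0")
proof (rule covered_null)
  fix e :: real assume e: "e > 0"
  \<comment> \<open>The extra \<open>- 1\<close> on the left serves \<open>x = - real K\<close>,
    which needs a grid time strictly before it.\<close>
  define J where "J = (\<lambda>m::nat. {- int K * 2 ^ m - 1 .. int K * 2 ^ m})"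
  define C where "C = 192 * v\<^sup>2 / r ^ 4"
  let ?n = "\<lambda>m j. pt (real_of_int j / 2 ^ m) h"
  have qn: "q (?n m j) = (real_of_int j / 2 ^ m, h)" for m j
    by (rule q_pt[OF dyadic_of_int_div h])
  let ?b = "\<lambda>m j. real_of_int j / 2 ^ m + 1 / 2 ^ m"
  show "covered ?E e"
  proof (rule covered_liminf)
    show "covered (\<Union>j\<in>J m. exits (?n m j) (?b m j) r) (\<Sum>j\<in>J m. C * (1 / 2 ^ m)\<^sup>2)" for m
    proof (rule covered_Union)
      show "finite (J m)" by (simp add: J_def)
      fix j
      show "covered (exits (?n m j) (?b m j) r) (C * (1 / 2 ^ m)\<^sup>2)"
        using exits_covered[of "?n m j" "?b m j" r] r qn
          by (simp add: C_def power_mult_distrib power_divide ac_simps)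
    qed
    have sum_le: "(\<Sum>j\<in>J m. C * (1 / 2 ^ m)\<^sup>2) \<le> (2 * real K + 2) * C * (1 / 2) ^ m" for m
    proof -
      have "real (card (J m)) = 2 * real K * 2 ^ m + 2" by (simp add: J_def of_nat_diff)
      also have "\<dots> \<le> (2 * real K + 2) * 2 ^ m" by (simp add: algebra_simps)
      finally have "real (card (J m)) * (C * (1 / 2 ^ m)\<^sup>2) \<le> (2 * real K + 2) * 2 ^ m * (C * (1 / 2 ^ m)\<^sup>2)"
        by (intro mult_right_mono) (simp_all add: C_def)
      also have "\<dots> = (2 * real K + 2) * C * (1 / 2) ^ m" by (simp add: power2_eq_square power_divide)
      finally show ?thesis by simp
    qed
    have "(\<lambda>m. (2 * real K + 2) * C * (1 / 2) ^ m) \<longlonglongrightarrow> (2 * real K + 2) * C * 0"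
      by (intro tendsto_intros LIMSEQ_power_zero) auto
    then have "\<forall>\<^sub>F m in sequentially. (2 * real K + 2) * C * (1 / 2) ^ m < e"
      using e by (intro order_tendstoD(2)) auto
    then show "\<forall>\<^sub>F m in sequentially. (\<Sum>j\<in>J m. C * (1 / 2 ^ m)\<^sup>2) \<le> e"
      by eventually_elim (use sum_le in \<open>meson less_imp_le order_trans\<close>)
    fix \<omega> assume "\<omega> \<in> ?E"
    then obtain x where w: "\<omega> \<in> space M" and x: "- real K \<le> x" "x \<le> real K" "lam \<omega> x < h - r"
      and far: "\<And>n. alive n \<omega> \<Longrightarrow> birth n < x \<Longrightarrow> r \<le> \<bar>L n \<omega> x - h\<bar>" by blast
    have "isCont (lam \<omega>) x" using lam_cont[OF w] by (simp add: continuous_on_eq_continuous_at)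
    then have "\<forall>\<^sub>F z in at x. lam \<omega> z < h - r" using x(3) by (simp add: isCont_def order_tendstoD(2))
    then obtain d where d: "d > 0" "\<And>z. \<bar>z - x\<bar> < d \<Longrightarrow> lam \<omega> z < h - r"
      using x(3) unfolding eventually_at dist_real_def by (metis UNIV_I)
    have "\<forall>\<^sub>F m in sequentially. (1 / 2 :: real) ^ m < d"
      using d(1) LIMSEQ_power_zero[of "1 / 2 :: real"] by (intro order_tendstoD(2)[of _ 0]) auto
    then show "\<forall>\<^sub>F m in sequentially. \<omega> \<in> (\<Union>j\<in>J m. exits (?n m j) (?b m j) r)"
    proof eventually_elim
      case (elim m)
      \<comment> \<open>Rounding up and subtracting 1 gives a grid time strictly before
        \<open>x\<close>, as \<open>far\<close> demands, at distance at most
        \<open>2 ^ (- m)\<close>.\<close>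
      define j where "j = \<lceil>x * 2 ^ m\<rceil> - 1"
      have j: "real_of_int j < x * 2 ^ m" "x * 2 ^ m \<le> real_of_int j + 1" unfolding j_def by linarith+
      have jx: "real_of_int j / 2 ^ m < x" "x \<le> ?b m j"
        using j by (simp_all add: field_simps)
      have "- real K * 2 ^ m \<le> x * 2 ^ m" "x * 2 ^ m \<le> real K * 2 ^ m"
        using mult_right_mono[OF x(1), of "2 ^ m"] mult_right_mono[OF x(2), of "2 ^ m"] by simp_all
      moreover have "real_of_int (- int K * 2 ^ m - 1) = - real K * 2 ^ m - 1"
        "real_of_int (int K * 2 ^ m) = real K * 2 ^ m" by simp_all
      ultimately have "real_of_int (- int K * 2 ^ m - 1) \<le> real_of_int j" "real_of_int j \<le> real_of_int (int K * 2 ^ m)"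
        using j by linarith+
      then have jJ: "j \<in> J m" unfolding J_def atLeastAtMost_iff of_int_le_iff by blast
      have low: "lam \<omega> z < h - r" if "real_of_int j / 2 ^ m \<le> z" "z \<le> ?b m j" for z
      proof (rule d(2))
        have "\<bar>z - x\<bar> \<le> 1 / 2 ^ m" using that jx by auto
        then show "\<bar>z - x\<bar> < d" using elim by (simp add: power_divide)
      qed
      have "\<omega> \<in> exits (?n m j) (?b m j) r"
      proof (rule exitsI[OF w r, of _ _ x])
        have "lam \<omega> (real_of_int j / 2 ^ m) < h - r" using jx by (intro low) auto
        then have "alive (?n m j) \<omega>" using r unfolding alive_iff by (simp add: qn)
        then show "r \<le> \<bar>L (?n m j) \<omega> x - snd (q (?n m j))\<bar>" using far[of "?n m j"] jx by (simp add: qn)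
      qed (use low jx in \<open>simp_all add: qn\<close>)
      then show ?case using jJ by blast
    qed
  qed
qed

text \<open>A line started at time \<open>- K\<close> at the height \<open>N + 1\<close>, with
  \<open>N\<close> large, can be below \<open>B\<close> later only after falling by half of this
  height. The exit radius \<open>(N + 1) / 2\<close> gives the order \<open>N ^ (- 4)\<close> and
  the factor 16.\<close>

lemma unbounded_covered:
  fixes K :: nat
  assumes K: "K > 0"
  shows "covered {\<omega> \<in> space M. \<exists>y. - real K \<le> y \<and> y \<le> real K \<and> (\<forall>z. - real K \<le> z \<longrightarrow> z \<le> real K \<longrightarrow> lam \<omega> z \<le> B) \<and>
    (\<forall>n. alive n \<omega> \<longrightarrow> birth n = - real K \<longrightarrow> L n \<omega> y \<le> B)} 0" (is "covered ?E 0")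
proof (rule covered_null)
  fix e :: real assume e: "e > 0"
  let ?n = "\<lambda>h. pt (- real K) (real h)"
  have qn: "q (?n h) = (- real K, real h)" for h :: nat
    using q_pt[OF dyadic_of_int dyadic_of_int, of "- int K" "int h"] by simp
  define C where "C = 192 * (v * (2 * real K))\<^sup>2 * 16"
  show "covered ?E e"
  proof (rule covered_liminf)
    show "covered (exits (?n (Suc N)) (real K) (real (Suc N) / 2)) (C / real (Suc N) ^ 4)" for N
      using exits_covered[of "?n (Suc N)" "real K" "real (Suc N) / 2"] K
      by (simp add: qn C_def power_divide del: of_nat_Suc)
    have "(\<lambda>N. C * inverse (real (Suc N)) ^ 4) \<longlonglongrightarrow> C * 0 ^ 4"
      by (intro tendsto_intros LIMSEQ_inverse_real_of_nat)
    then have "\<forall>\<^sub>F N in sequentially. C * inverse (real (Suc N)) ^ 4 < e"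
      using e by (intro order_tendstoD(2)) auto
    then show "\<forall>\<^sub>F N in sequentially. C / real (Suc N) ^ 4 \<le> e"
      by eventually_elim (simp add: divide_inverse power_inverse del: of_nat_Suc)
    fix \<omega> assume "\<omega> \<in> ?E"
    then obtain y where w: "\<omega> \<in> space M" and y: "- real K \<le> y" "y \<le> real K"
      and B: "\<And>z. - real K \<le> z \<Longrightarrow> z \<le> real K \<Longrightarrow> lam \<omega> z \<le> B"
      and low: "\<And>n. alive n \<omega> \<Longrightarrow> birth n = - real K \<Longrightarrow> L n \<omega> y \<le> B" by blast
    obtain N0 :: nat where "2 * B < real N0" using reals_Archimedean2 by blast
    then have "\<forall>\<^sub>F N in sequentially. 2 * B < real (Suc N)"
      by (intro eventually_sequentiallyI[of N0]) simp
    then show "\<forall>\<^sub>F N in sequentially. \<omega> \<in> exits (?n (Suc N)) (real K) (real (Suc N) / 2)"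
    proof eventually_elim
      case (elim N)
      show ?case
      proof (rule exitsI[OF w, of _ _ _ y])
        show "lam \<omega> z < snd (q (?n (Suc N))) - real (Suc N) / 2"
          if "birth (?n (Suc N)) \<le> z" "z \<le> real K" for z
          using B[of z] that elim by (simp add: qn del: of_nat_Suc)
        have "alive (?n (Suc N)) \<omega>"
          using B[of "- real K"] elim unfolding alive_iff by (simp add: qn del: of_nat_Suc)
        then have "L (?n (Suc N)) \<omega> y \<le> B" by (rule low) (simp add: qn del: of_nat_Suc)
        then show "real (Suc N) / 2 \<le> \<bar>L (?n (Suc N)) \<omega> y - snd (q (?n (Suc N)))\<bar>"
          using elim by (simp add: qn del: of_nat_Suc)
      qed (use y in \<open>simp_all add: qn del: of_nat_Suc\<close>)
    qed
  qed
qed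

text \<open>Consider the line started \<open>2 ^ (- m)\<close> below. If it has not joined
  \<open>n\<close> after time \<open>d\<close>, it is either on the barrier, which takes an exit of
  radius \<open>r\<close>, or uncoalesced, which has a probability tending to 0 as \<open>m\<close>
  grows. The summand \<open>d\<close> is a slack for this limit, chosen to vanish with
  \<open>d\<close>.\<close>

lemma separate_below_covered:
  assumes d: "d > 0" and r: "r > 0"
  shows "covered {\<omega> \<in> space M. (\<forall>z. birth n \<le> z \<longrightarrow> z \<le> birth n + d \<longrightarrow> lam \<omega> z < snd (q n) - 2 * r) \<and>
    (\<forall>m. alive (pt (birth n) (snd (q n) - 1 / 2 ^ m)) \<omega> \<longrightarrow>
      L (pt (birth n) (snd (q n) - 1 / 2 ^ m)) \<omega> (birth n + d) \<noteq> L n \<omega> (birth n + d))}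
    (192 * (v * d)\<^sup>2 / r ^ 4 + d)" (is "covered ?E _")
proof (rule covered_liminf)
  let ?s = "birth n" and ?h = "snd (q n)"
  let ?n = "\<lambda>m. pt ?s (?h - 1 / 2 ^ m)"
  have qn: "q (?n m) = (?s, ?h - 1 / 2 ^ m)" for m
    by (intro q_pt q_dyadic dyadic_diff_power)
  let ?p = "\<lambda>m. 192 * (v * d)\<^sup>2 / r ^ 4 + 4 * (1 / 2 ^ m) / sqrt (2 * v * d)"
  show "covered (exits (?n m) (?s + d) r \<union> uncoalesced (?n m) n (?s + d)) (?p m)" for m
    using exits_covered[of "?n m" "?s + d" r] uncoalesced_covered[of n "?n m" "?s + d" "1 / 2 ^ m"] d r
    by (intro covered_Un) (simp_all add: qn)
  have "(\<lambda>m. 192 * (v * d)\<^sup>2 / r ^ 4 + 4 * (1 / 2) ^ m / sqrt (2 * v * d)) \<longlonglongrightarrow>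
      192 * (v * d)\<^sup>2 / r ^ 4 + 4 * 0 / sqrt (2 * v * d)"
    using v_pos d by (intro tendsto_intros LIMSEQ_power_zero) auto
  then have "\<forall>\<^sub>F m in sequentially. 192 * (v * d)\<^sup>2 / r ^ 4 + 4 * (1 / 2) ^ m / sqrt (2 * v * d) <
      192 * (v * d)\<^sup>2 / r ^ 4 + d"
    using d by (intro order_tendstoD(2)) auto
  then show "\<forall>\<^sub>F m in sequentially. ?p m \<le> 192 * (v * d)\<^sup>2 / r ^ 4 + d"
    by eventually_elim (simp add: power_divide)
  fix \<omega> assume "\<omega> \<in> ?E"
  then have w: "\<omega> \<in> space M" and low: "\<And>z. ?s \<le> z \<Longrightarrow> z \<le> ?s + d \<Longrightarrow> lam \<omega> z < ?h - 2 * r"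
    and ne: "\<And>m. alive (?n m) \<omega> \<Longrightarrow> L (?n m) \<omega> (?s + d) \<noteq> L n \<omega> (?s + d)" by blast+
  have "\<forall>\<^sub>F m in sequentially. (1 / 2 :: real) ^ m < r"
    using r LIMSEQ_power_zero[of "1 / 2 :: real"] by (intro order_tendstoD(2)[of _ 0]) auto
  then show "\<forall>\<^sub>F m in sequentially. \<omega> \<in> exits (?n m) (?s + d) r \<union> uncoalesced (?n m) n (?s + d)"
  proof eventually_elim
    case (elim m)
    have small: "1 / 2 ^ m < r" using elim by (simp add: power_divide)
    have al: "alive (?n m) \<omega>" "alive n \<omega>" using low[of ?s] d small r
      unfolding alive_iff by (simp_all add: qn)
    show ?case
    proof (cases "lam \<omega> (?s + d) < L (?n m) \<omega> (?s + d)")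
      case True
      then show ?thesis using al ne[OF al(1)] w by (auto simp: uncoalesced_def)
    next
      case False
      \<comment> \<open>The line from below is on the barrier at the end, and the barrier lies
        \<open>2 * r\<close> below \<open>?h\<close>; since its start is less than \<open>r\<close>
        below \<open>?h\<close>, it has moved by at least \<open>r\<close>.\<close>
      have "\<omega> \<in> exits (?n m) (?s + d) r"
      proof (rule exitsI[OF w r, of _ _ "?s + d"])
        show "lam \<omega> z < snd (q (?n m)) - r" if "birth (?n m) \<le> z" "z \<le> ?s + d" for z
          using low[of z] that small by (simp add: qn)
        show "r \<le> \<bar>L (?n m) \<omega> (?s + d) - snd (q (?n m))\<bar>"
          using False low[of "?s + d"] d small by (simp add: qn)
      qed (use d in \<open>simp_all add: qn\<close>)
      then show ?thesis by blast
    qed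
  qed
qed

text \<open>Meeting by the time \<open>birth n + d\<close> implies having met by any later
  \<open>b\<close>, so \<open>separate_below_covered\<close> is used with \<open>d\<close> tending
  to 0. The gap to the barrier is first fixed as \<open>2 / (k + 1)\<close>, and a countable union
  over \<open>k\<close> removes this restriction.\<close>

lemma coalesce_below_covered:
  "covered {\<omega> \<in> space M. alive n \<omega> \<and> (\<exists>b>birth n. \<forall>m. alive (pt (birth n) (snd (q n) - 1 / 2 ^ m)) \<omega> \<longrightarrow>
      L (pt (birth n) (snd (q n) - 1 / 2 ^ m)) \<omega> b \<noteq> L n \<omega> b)} 0" (is "covered ?E 0")
proof -
  let ?s = "birth n" and ?h = "snd (q n)"
  let ?n = "\<lambda>m. pt ?s (?h - 1 / 2 ^ m)"
  have qn: "q (?n m) = (?s, ?h - 1 / 2 ^ m)" for m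
    by (intro q_pt q_dyadic dyadic_diff_power)
  let ?B = "\<lambda>k. {\<omega> \<in> space M. alive n \<omega> \<and> lam \<omega> ?s < ?h - 2 * inverse (real (Suc k)) \<and>
    (\<exists>b>?s. \<forall>m. alive (?n m) \<omega> \<longrightarrow> L (?n m) \<omega> b \<noteq> L n \<omega> b)}"
  have "covered (?B k) 0" for k
  proof (rule covered_null)
    fix e :: real assume e: "e > 0"
    define r where "r = inverse (real (Suc k))"
    have r: "r > 0" by (simp add: r_def)
    let ?d = "\<lambda>N. inverse (real (Suc N))"
    show "covered (?B k) e"
    proof (rule covered_liminf)
      show "covered {\<omega> \<in> space M. (\<forall>z. ?s \<le> z \<longrightarrow> z \<le> ?s + ?d N \<longrightarrow> lam \<omega> z < ?h - 2 * r) \<and>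
        (\<forall>m. alive (?n m) \<omega> \<longrightarrow> L (?n m) \<omega> (?s + ?d N) \<noteq> L n \<omega> (?s + ?d N))}
        (192 * (v * ?d N)\<^sup>2 / r ^ 4 + ?d N)" for N
        by (rule separate_below_covered[OF _ r]) simp
      have "(\<lambda>N. 192 * (v * ?d N)\<^sup>2 / r ^ 4 + ?d N) \<longlonglongrightarrow> 192 * (v * 0)\<^sup>2 / r ^ 4 + 0"
        using r by (intro tendsto_intros LIMSEQ_inverse_real_of_nat) auto
      then have "\<forall>\<^sub>F N in sequentially. 192 * (v * ?d N)\<^sup>2 / r ^ 4 + ?d N < e"
        using e by (intro order_tendstoD(2)) auto
      then show "\<forall>\<^sub>F N in sequentially. 192 * (v * ?d N)\<^sup>2 / r ^ 4 + ?d N \<le> e"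
        by eventually_elim simp
      fix \<omega> assume "\<omega> \<in> ?B k"
      then obtain b where w: "\<omega> \<in> space M" "alive n \<omega>" "lam \<omega> ?s < ?h - 2 * r" and b: "b > ?s"
        and ne: "\<And>m. alive (?n m) \<omega> \<Longrightarrow> L (?n m) \<omega> b \<noteq> L n \<omega> b" by (auto simp: r_def)
      have "isCont (lam \<omega>) ?s" using lam_cont[OF w(1)] by (simp add: continuous_on_eq_continuous_at)
      then have "\<forall>\<^sub>F z in at ?s. lam \<omega> z < ?h - 2 * r" using w(3) by (simp add: isCont_def order_tendstoD(2))
      then obtain d where d: "d > 0" "\<And>z. \<bar>z - ?s\<bar> < d \<Longrightarrow> lam \<omega> z < ?h - 2 * r"
        using w(3) unfolding eventually_at dist_real_def by (metis UNIV_I)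
      have "\<forall>\<^sub>F N in sequentially. ?d N < min d (b - ?s)"
        using d(1) b by (intro order_tendstoD(2)[OF LIMSEQ_inverse_real_of_nat]) auto
      then show "\<forall>\<^sub>F N in sequentially. \<omega> \<in> {\<omega> \<in> space M. (\<forall>z. ?s \<le> z \<longrightarrow> z \<le> ?s + ?d N \<longrightarrow> lam \<omega> z < ?h - 2 * r) \<and>
        (\<forall>m. alive (?n m) \<omega> \<longrightarrow> L (?n m) \<omega> (?s + ?d N) \<noteq> L n \<omega> (?s + ?d N))}"
      proof eventually_elim
        case (elim N)
        have "L (?n m) \<omega> (?s + ?d N) \<noteq> L n \<omega> (?s + ?d N)" if al: "alive (?n m) \<omega>" for m
        proof
          assume eq: "L (?n m) \<omega> (?s + ?d N) = L n \<omega> (?s + ?d N)"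
          have pos: "0 < ?d N" by simp
          have "L (?n m) \<omega> b = L n \<omega> b"
            by (rule rab_family.L_coalesce[OF fam[OF w(1)] al w(2) _ _ eq])
              (use elim pos in \<open>auto simp: qn less_imp_le simp del: of_nat_Suc\<close>)
          then show False using ne[OF al] by simp
        qed
        moreover have "lam \<omega> z < ?h - 2 * r" if "?s \<le> z" "z \<le> ?s + ?d N" for z
          using d(2)[of z] that elim by auto
        ultimately show ?case using w(1) by blast
      qed
    qed
  qed
  then have "covered (\<Union>k. ?B k) 0" by (rule covered_countable)
  then show ?thesis
  proof (rule covered_mono)
    show "?E \<subseteq> (\<Union>k. ?B k)"
    proof
      fix \<omega> assume w: "\<omega> \<in> ?E"
      then have "0 < (?h - lam \<omega> ?s) / 2" by (auto simp: alive_iff)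
      then obtain k where k: "inverse (real (Suc k)) < (?h - lam \<omega> ?s) / 2" using reals_Archimedean by blast
      have "lam \<omega> ?s < ?h - 2 * i" if "i < (?h - lam \<omega> ?s) / 2" for i using that by simp
      from this[OF k] have "lam \<omega> ?s < ?h - 2 * inverse (real (Suc k))" .
      then show "\<omega> \<in> (\<Union>k. ?B k)" using w by blast
    qed
  qed simp
qed

end

section \<open>Finiteness of the values taken at a later time\<close>

context dense_web
begin

abbreviation grid_line :: "real \<Rightarrow> nat \<Rightarrow> int \<Rightarrow> nat"
  where "grid_line s m j \<equiv> pt s (real_of_int j / 2 ^ m)"

definition grid_values :: "real \<Rightarrow> real \<Rightarrow> nat \<Rightarrow> nat \<Rightarrow> 'a \<Rightarrow> real set"
  where "grid_values s t K m \<omega> = (\<lambda>j. L (grid_line s m j) \<omega> t) `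
    {j \<in> {- int K * 2 ^ m .. int K * 2 ^ m}. alive (grid_line s m j) \<omega>}"

definition dyadic_values :: "real \<Rightarrow> real \<Rightarrow> nat \<Rightarrow> 'a \<Rightarrow> real set"
  where "dyadic_values s t K \<omega> = {L (pt s h) \<omega> t | h. h \<in> dyadic_rationals \<and> h \<le> real K \<and> alive (pt s h) \<omega>}"

lemma line_mono:
  assumes "\<omega> \<in> space M" "alive n \<omega>" "alive m \<omega>" "birth n \<le> s" "birth m \<le> s" "L n \<omega> s \<le> L m \<omega> s" "s \<le> t"
  shows "L n \<omega> t \<le> L m \<omega> t"
  using rab_family.L_mono[OF fam[OF assms(1)]] assms(2-) by blast

lemma line_start: "\<omega> \<in> space M \<Longrightarrow> alive n \<omega> \<Longrightarrow> L n \<omega> (birth n) = snd (q n)"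
  using rab_family.L_start[OF fam] by blast

lemma line_ge: "\<omega> \<in> space M \<Longrightarrow> alive n \<omega> \<Longrightarrow> birth n \<le> t \<Longrightarrow> lam \<omega> t \<le> L n \<omega> t"
  using rab_family.L_ge[OF fam] by blast

lemma q_grid_line: "s \<in> dyadic_rationals \<Longrightarrow> q (grid_line s m j) = (s, real_of_int j / 2 ^ m)"
  by (rule q_pt[OF _ dyadic_of_int_div])

lemma finite_grid_values: "finite (grid_values s t K m \<omega>)"
  unfolding grid_values_def
  by (rule finite_imageI, rule finite_subset[of _ "{- int K * 2 ^ m .. int K * 2 ^ m}"]) auto

text \<open>The lines are ordered, so each value belongs to a block of consecutive starting points.
  Unless it is the largest value or the value of the barrier, the last point \<open>j\<close> of its
  block forms an uncoalesced pair with \<open>j + 1\<close>. The two exceptions give the summand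
  2.\<close>

lemma card_grid_values:
  assumes w: "\<omega> \<in> space M" and s: "s \<in> dyadic_rationals" and st: "s < t"
  shows "card (grid_values s t K m \<omega>) \<le>
    card {j \<in> {- int K * 2 ^ m .. int K * 2 ^ m}. \<omega> \<in> uncoalesced (grid_line s m j) (grid_line s m (j + 1)) t} + 2"
proof -
  let ?J = "{- int K * 2 ^ m .. int K * 2 ^ m}"
  let ?n = "grid_line s m"
  let ?U = "{j \<in> ?J. \<omega> \<in> uncoalesced (?n j) (?n (j + 1)) t}"
  let ?f = "\<lambda>j. L (?n j) \<omega> t"
  let ?V = "grid_values s t K m \<omega>"
  have qn: "q (?n j) = (s, real_of_int j / 2 ^ m)" for j by (rule q_grid_line[OF s])
  have al_mono: "alive (?n j') \<omega>" if "alive (?n j) \<omega>" "j \<le> j'" for j j'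
  proof -
    have "real_of_int j / 2 ^ m \<le> real_of_int j' / 2 ^ m" using that by (intro divide_right_mono) auto
    then show ?thesis using that(1) unfolding alive_iff by (simp add: qn)
  qed
  have f_mono: "?f j \<le> ?f j'" if "alive (?n j) \<omega>" "j \<le> j'" for j j'
  proof (rule line_mono[OF w that(1) al_mono[OF that], of s])
    have "real_of_int j / 2 ^ m \<le> real_of_int j' / 2 ^ m" using that by (intro divide_right_mono) auto
    then show "L (?n j) \<omega> s \<le> L (?n j') \<omega> s"
      using line_start[OF w that(1)] line_start[OF w al_mono[OF that]] by (simp add: qn)
  qed (use st in \<open>simp_all add: qn\<close>)
  have finV: "finite ?V" by (rule finite_grid_values)
  have "?V \<subseteq> insert (Max ?V) (insert (lam \<omega> t) (?f ` ?U))"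
  proof
    fix x assume x: "x \<in> ?V"
    show "x \<in> insert (Max ?V) (insert (lam \<omega> t) (?f ` ?U))"
    proof (cases "x = Max ?V \<or> x = lam \<omega> t")
      case False
      have "Max ?V \<in> ?V" using finV x by (intro Max_in) auto
      then obtain k where k: "k \<in> ?J" "alive (?n k) \<omega>" "?f k = Max ?V" by (auto simp: grid_values_def)
      have "x < ?f k" using Max_ge[OF finV x] False k(3) by simp
      define A where "A = {j \<in> ?J. alive (?n j) \<omega> \<and> ?f j = x}"
      have A: "finite A" by (rule finite_subset[of _ ?J]) (auto simp: A_def)
      have A_ne: "A \<noteq> {}" using x by (auto simp: A_def grid_values_def)
      define j where "j = Max A"
      have jA: "j \<in> A" unfolding j_def using A A_ne by (rule Max_in)
      then have j: "j \<in> ?J" "alive (?n j) \<omega>" "?f j = x" by (simp_all add: A_def)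
      have "j < k"
      proof (rule ccontr)
        assume "\<not> j < k"
        then have "?f k \<le> ?f j" using f_mono[OF k(2)] by simp
        then show False using j(3) \<open>x < ?f k\<close> by simp
      qed
      then have j1: "j + 1 \<in> ?J" using j(1) k(1) by simp
      have al1: "alive (?n (j + 1)) \<omega>" by (rule al_mono[OF j(2)]) simp
      have "?f (j + 1) \<noteq> x"
      proof
        assume "?f (j + 1) = x"
        then have "j + 1 \<in> A" using j1 al1 by (simp add: A_def)
        then have "j + 1 \<le> j" unfolding j_def using A by (intro Max_ge)
        then show False by simp
      qed
      moreover have "lam \<omega> t < x" using line_ge[OF w j(2), of t] j(3) False st by (simp add: qn)
      ultimately have "\<omega> \<in> uncoalesced (?n j) (?n (j + 1)) t"
        using j al1 w by (auto simp: uncoalesced_def)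
      then show ?thesis using j by auto
    qed auto
  qed
  moreover define T where "T = ?f ` ?U"
  ultimately have V: "?V \<subseteq> insert (Max ?V) (insert (lam \<omega> t) T)" by simp
  have finU: "finite ?U" by (rule finite_subset[of _ ?J]) auto
  then have finT: "finite T" unfolding T_def by (rule finite_imageI)
  have "card ?V \<le> card (insert (Max ?V) (insert (lam \<omega> t) T))"
    using finT by (intro card_mono[OF _ V]) simp
  also have "\<dots> \<le> card T + 2" using finT by (simp add: card_insert_if)
  also have "card T \<le> card ?U" unfolding T_def by (rule card_image_le[OF finU])
  finally show ?thesis by simp
qed

lemma grid_values_mono:
  assumes "s \<in> dyadic_rationals" "m \<le> m'"
  shows "grid_values s t K m \<omega> \<subseteq> grid_values s t K m' \<omega>"
proof -
  obtain d where m': "m' = m + d" using assms(2) le_Suc_ex by blast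
  have "L (grid_line s m j) \<omega> t \<in> grid_values s t K m' \<omega>"
    if j: "j \<in> {- int K * 2 ^ m .. int K * 2 ^ m}" "alive (grid_line s m j) \<omega>" for j
  proof -
    have eq: "real_of_int (j * 2 ^ d) / 2 ^ m' = real_of_int j / 2 ^ m"
      by (simp add: m' power_add)
    have "- int K * 2 ^ m * 2 ^ d \<le> j * 2 ^ d"
      by (rule mult_right_mono) (use j in simp_all)
    moreover have "j * 2 ^ d \<le> int K * 2 ^ m * 2 ^ d"
      by (rule mult_right_mono) (use j in simp_all)
    ultimately have "j * 2 ^ d \<in> {- int K * 2 ^ m' .. int K * 2 ^ m'}" by (simp add: m' power_add mult.assoc)
    then show ?thesis unfolding grid_values_def using j(2) eq by (intro image_eqI[of _ _ "j * 2 ^ d"]) auto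
  qed
  then show ?thesis unfolding grid_values_def[of s t K m] by auto
qed

lemma dyadic_values_grid:
  assumes s: "s \<in> dyadic_rationals" and low: "- real K < lam \<omega> s" and x: "x \<in> dyadic_values s t K \<omega>"
  shows "\<exists>m. x \<in> grid_values s t K m \<omega>"
proof -
  obtain h where h: "h \<in> dyadic_rationals" "h \<le> real K" "alive (pt s h) \<omega>" "x = L (pt s h) \<omega> t"
    using x by (auto simp: dyadic_values_def)
  obtain j m where j: "h = real_of_int j / 2 ^ m" using h(1) by (auto simp: dyadic_rationals_def)
  have "lam \<omega> s < h" using h(3) unfolding alive_iff by (simp add: q_pt[OF s h(1)])
  then have "- real K \<le> real_of_int j / 2 ^ m" "real_of_int j / 2 ^ m \<le> real K" using low h(2) j by auto
  then have "- real K * 2 ^ m \<le> real_of_int j" "real_of_int j \<le> real K * 2 ^ m"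
    by (simp_all add: field_simps)
  moreover have "real_of_int (- int K * 2 ^ m) = - real K * 2 ^ m" "real_of_int (int K * 2 ^ m) = real K * 2 ^ m"
    by simp_all
  ultimately have "real_of_int (- int K * 2 ^ m) \<le> real_of_int j" "real_of_int j \<le> real_of_int (int K * 2 ^ m)"
    by linarith+
  then have "j \<in> {- int K * 2 ^ m .. int K * 2 ^ m}" unfolding atLeastAtMost_iff of_int_le_iff by blast
  then show ?thesis using h j by (auto simp: grid_values_def)
qed

text \<open>Neighbouring grid lines at distance \<open>2 ^ (- m)\<close> stay apart with probability of order
  \<open>2 ^ (- m)\<close>, so that the expected number of distinct values is bounded uniformly in \<open>m\<close>.\<close>

lemma dyadic_values_covered:
  assumes s: "s \<in> dyadic_rationals" and st: "s < t"
  shows "covered {\<omega> \<in> space M. - real K < lam \<omega> s \<and> infinite (dyadic_values s t K \<omega>)} 0" (is "covered ?E 0")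
proof (rule covered_null)
  fix e :: real assume e: "e > 0"
  define C where "C = 4 / sqrt (2 * v * (t - s))"
  have C: "C \<ge> 0" using v_pos st by (simp add: C_def)
  \<comment> \<open>On every grid the covering probabilities of the uncoalesced pairs add up to at
    most \<open>(2 * K + 1) * C\<close>, so \<open>k\<close> such pairs occur with probability at
    most \<open>e\<close>.\<close>
  obtain k :: nat where k: "(2 * real K + 1) * C / e < real k" using reals_Archimedean2 by blast
  then have k0: "real k > 0" using C e by (smt (verit) divide_nonneg_pos mult_nonneg_nonneg of_nat_0_le_iff)
  let ?J = "\<lambda>m. {- int K * 2 ^ m .. int K * 2 ^ m}"
  let ?n = "\<lambda>m. grid_line s m"
  let ?U = "\<lambda>m \<omega>. {j \<in> ?J m. \<omega> \<in> uncoalesced (?n m j) (?n m (j + 1)) t}"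
  show "covered ?E e"
  proof (rule covered_liminf)
    show "covered {\<omega> \<in> space M. real k \<le> real (card (?U m \<omega>))} (real (card (?J m)) * (C * (1 / 2 ^ m)) / real k)" for m
    proof (rule covered_count[OF _ _ k0])
      fix j
      have "birth (?n m (j + 1)) = birth (?n m j)" "birth (?n m j) < t"
        "snd (q (?n m (j + 1))) = snd (q (?n m j)) + 1 / 2 ^ m" "(0::real) < 1 / 2 ^ m"
        unfolding q_grid_line[OF s] using st by (simp_all add: add_divide_distrib)
      from uncoalesced_covered[OF this]
      have "covered (uncoalesced (?n m j) (?n m (j + 1)) t) (4 * (1 / 2 ^ m) / sqrt (2 * v * (t - s)))"
        unfolding q_grid_line[OF s] fst_conv .
      then show "covered (uncoalesced (?n m j) (?n m (j + 1)) t) (C * (1 / 2 ^ m))" by (simp add: C_def mult.commute)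
    qed simp
    show "\<forall>\<^sub>F m in sequentially. real (card (?J m)) * (C * (1 / 2 ^ m)) / real k \<le> e"
    proof (rule always_eventually, rule allI)
      fix m
      have "real (card (?J m)) = 2 * real K * 2 ^ m + 1" by (simp add: of_nat_diff)
      also have "\<dots> \<le> (2 * real K + 1) * 2 ^ m" by (simp add: algebra_simps)
      finally have "real (card (?J m)) * (C * (1 / 2 ^ m)) \<le> (2 * real K + 1) * 2 ^ m * (C * (1 / 2 ^ m))"
        using C by (intro mult_right_mono) simp_all
      also have "\<dots> = (2 * real K + 1) * C" by simp
      also have "\<dots> \<le> e * real k" using k e by (simp add: field_simps)
      finally show "real (card (?J m)) * (C * (1 / 2 ^ m)) / real k \<le> e"
        using k0 by (simp only: pos_divide_le_eq)
    qed
    fix \<omega> assume "\<omega> \<in> ?E"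
    then have w: "\<omega> \<in> space M" "- real K < lam \<omega> s" "infinite (dyadic_values s t K \<omega>)" by auto
    \<comment> \<open>Infinitely many values yield \<open>k + 2\<close> of them. These all occur on
      every fine enough grid, since the grid values increase with \<open>m\<close>, and force at
      least \<open>k\<close> uncoalesced pairs.\<close>
    obtain T where T: "finite T" "card T = k + 2" "T \<subseteq> dyadic_values s t K \<omega>"
      using infinite_arbitrarily_large[OF w(3)] by blast
    have "\<forall>x\<in>T. \<exists>m. x \<in> grid_values s t K m \<omega>" using dyadic_values_grid[OF s w(2)] T(3) by blast
    then obtain \<mu> where \<mu>: "\<And>x. x \<in> T \<Longrightarrow> x \<in> grid_values s t K (\<mu> x) \<omega>" by metis
    show "\<forall>\<^sub>F m in sequentially. \<omega> \<in> {\<omega> \<in> space M. real k \<le> real (card (?U m \<omega>))}"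
    proof (rule eventually_sequentiallyI[of "\<Sum>x\<in>T. \<mu> x"])
      fix m assume m: "(\<Sum>x\<in>T. \<mu> x) \<le> m"
      have "T \<subseteq> grid_values s t K m \<omega>"
      proof
        fix x assume x: "x \<in> T"
        have "\<mu> x \<le> (\<Sum>x\<in>T. \<mu> x)" using T(1) x by (intro member_le_sum) auto
        then show "x \<in> grid_values s t K m \<omega>" using \<mu>[OF x] grid_values_mono[OF s, of "\<mu> x" m] m by auto
      qed
      then have "card T \<le> card (grid_values s t K m \<omega>)" by (intro card_mono finite_grid_values)
      then have "k \<le> card (?U m \<omega>)" using card_grid_values[OF w(1) s st, of K m] T(2) by linarith
      then show "\<omega> \<in> {\<omega> \<in> space M. real k \<le> real (card (?U m \<omega>))}" using w(1) by simp
    qed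
  qed
qed

text \<open>Lines born earlier have arbitrary heights at time \<open>s\<close>; they are compared
  with the dyadic lines started above them at \<open>s\<close>. The map to \<open>Min (S x)\<close>
  is injective off \<open>dyadic_values\<close>: if \<open>x < y\<close> have the same image, a
  dyadic height between the two lines at time \<open>s\<close> gives
  \<open>Min (S x) \<le> y\<close>, while \<open>y \<le> Min (S y)\<close>, so \<open>y\<close> is a
  dyadic value.\<close>

lemma finite_line_values:
  assumes w: "\<omega> \<in> space M" and s: "s \<in> dyadic_rationals" and st: "s < t" and fin: "finite (dyadic_values s t K \<omega>)"
  shows "finite {L n \<omega> t | n. alive n \<omega> \<and> birth n \<le> s \<and> L n \<omega> s < real K}"
proof -
  define W where "W = {L n \<omega> t | n. alive n \<omega> \<and> birth n \<le> s \<and> L n \<omega> s < real K}"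
  let ?V = "dyadic_values s t K \<omega>"
  have "\<forall>x\<in>W. \<exists>n. alive n \<omega> \<and> birth n \<le> s \<and> L n \<omega> s < real K \<and> L n \<omega> t = x" by (auto simp: W_def)
  from bchoice[OF this] obtain N
    where "\<forall>x\<in>W. alive (N x) \<omega> \<and> birth (N x) \<le> s \<and> L (N x) \<omega> s < real K \<and> L (N x) \<omega> t = x"
    by blast
  then have N: "alive (N x) \<omega> \<and> birth (N x) \<le> s \<and> L (N x) \<omega> s < real K \<and> L (N x) \<omega> t = x" if "x \<in> W" for x
    using that by blast
  define S where "S = (\<lambda>x. {L (pt s h) \<omega> t | h. h \<in> dyadic_rationals \<and> L (N x) \<omega> s < h \<and> h \<le> real K})"
  have al: "alive (pt s h) \<omega>" if "x \<in> W" "h \<in> dyadic_rationals" "L (N x) \<omega> s < h" for x h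
    using line_ge[OF w, of "N x" s] N[OF that(1)] that(3) unfolding alive_iff by (simp add: q_pt[OF s that(2)])
  have at_s: "L (pt s h) \<omega> s = h" if "h \<in> dyadic_rationals" "alive (pt s h) \<omega>" for h
    using line_start[OF w that(2)] by (simp add: q_pt[OF s that(1)])
  have SV: "S x \<subseteq> ?V" if "x \<in> W" for x
    using al[OF that] by (auto simp: S_def dyadic_values_def)
  have Sfin: "finite (S x)" if "x \<in> W" for x using finite_subset[OF SV[OF that] fin] .
  have Sne: "S x \<noteq> {}" if x: "x \<in> W" for x
  proof -
    obtain h where "h \<in> dyadic_rationals" "L (N x) \<omega> s < h" "h < real K"
      using dyadic_dense[of "L (N x) \<omega> s" "real K"] N[OF x] by auto
    then show ?thesis by (auto simp: S_def intro!: exI[of _ h])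
  qed
  have Min_V: "Min (S x) \<in> ?V" if "x \<in> W" for x
    using Min_in[OF Sfin[OF that] Sne[OF that]] SV[OF that] by blast
  have le_Min: "x \<le> Min (S x)" if x: "x \<in> W" for x
  proof -
    have "x \<le> y" if y: "y \<in> S x" for y
    proof -
      obtain h where h: "h \<in> dyadic_rationals" "L (N x) \<omega> s < h" "y = L (pt s h) \<omega> t"
        using y by (auto simp: S_def)
      have qh: "q (pt s h) = (s, h)" by (rule q_pt[OF s h(1)])
      have "L (N x) \<omega> t \<le> L (pt s h) \<omega> t"
      proof (rule line_mono[OF w])
        show "L (N x) \<omega> s \<le> L (pt s h) \<omega> s" using at_s[OF h(1) al[OF x h(1,2)]] h(2) by simp
      qed (use N[OF x] al[OF x h(1,2)] st qh in simp_all)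
      then show ?thesis using N[OF x] h by simp
    qed
    then show ?thesis using Sfin[OF x] Sne[OF x] by simp
  qed
  have key: "y \<in> ?V" if x: "x \<in> W" and y: "y \<in> W" and "x < y" "Min (S x) = Min (S y)" for x y
  proof -
    have "L (N x) \<omega> s < L (N y) \<omega> s"
    proof (rule ccontr)
      assume "\<not> L (N x) \<omega> s < L (N y) \<omega> s"
      then have "L (N y) \<omega> t \<le> L (N x) \<omega> t"
        using N[OF x] N[OF y] st by (intro line_mono[OF w, of "N y" "N x" s t]) simp_all
      then show False using N[OF x] N[OF y] \<open>x < y\<close> by simp
    qed
    then obtain h where h: "h \<in> dyadic_rationals" "L (N x) \<omega> s < h" "h < L (N y) \<omega> s"
      using dyadic_dense by blast
    have qh: "q (pt s h) = (s, h)" by (rule q_pt[OF s h(1)])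
    have "L (pt s h) \<omega> t \<le> L (N y) \<omega> t"
    proof (rule line_mono[OF w])
      show "L (pt s h) \<omega> s \<le> L (N y) \<omega> s" using at_s[OF h(1) al[OF x h(1,2)]] h(3) by simp
    qed (use N[OF y] al[OF x h(1,2)] st qh in simp_all)
    moreover have "L (pt s h) \<omega> t \<in> S x" using h N[OF y] by (auto simp: S_def)
    then have "Min (S x) \<le> L (pt s h) \<omega> t" using Sfin[OF x] by simp
    ultimately have "Min (S y) \<le> y" using that(4) N[OF y] by simp
    then have "y = Min (S y)" using le_Min[OF y] by simp
    then show ?thesis using Min_V[OF y] by simp
  qed
  have "inj_on (\<lambda>x. Min (S x)) (W - ?V)"
  proof (rule linorder_inj_onI)
    fix x y assume "x < y" "x \<in> W - ?V" "y \<in> W - ?V"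
    then show "Min (S x) \<noteq> Min (S y)" using key[of x y] by blast
  qed auto
  moreover have "finite ((\<lambda>x. Min (S x)) ` (W - ?V))"
    by (rule finite_subset[OF _ fin]) (use Min_V in blast)
  ultimately have "finite (W - ?V)" by (rule finite_imageD[rotated])
  then have "finite ((W - ?V) \<union> ?V)" using fin by simp
  then have "finite W" by (rule finite_subset[rotated]) blast
  then show ?thesis by (simp only: W_def)
qed

text \<open>The finiteness clause is limited to dyadic times so as to remain a countable statement;
  \<open>finite_lines_below\<close> extends it to real times.\<close>

definition good :: "'a \<Rightarrow> bool"
  where "good \<omega> \<longleftrightarrow>
    (\<forall>x a b. lam \<omega> x \<le> a \<longrightarrow> a < b \<longrightarrow> (\<exists>n. alive n \<omega> \<and> birth n < x \<and> L n \<omega> x \<in> {a<..<b})) \<and>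
    (\<forall>x y c. x < y \<longrightarrow> (\<exists>n. alive n \<omega> \<and> birth n < x \<and> c < L n \<omega> y)) \<and>
    (\<forall>s t c. s \<in> dyadic_rationals \<longrightarrow> t \<in> dyadic_rationals \<longrightarrow> s < t \<longrightarrow>
      finite {L n \<omega> t | n. alive n \<omega> \<and> birth n \<le> s \<and> L n \<omega> s < c}) \<and>
    (\<forall>n b. alive n \<omega> \<longrightarrow> birth n < b \<longrightarrow>
      (\<exists>m. alive m \<omega> \<and> birth m = birth n \<and> snd (q m) < snd (q n) \<and> L m \<omega> b = L n \<omega> b))"

lemma AE_good: "AE \<omega> in M. good \<omega>"
proof -
  have 1: "AE \<omega> in M. \<forall>n k K. \<not> (\<exists>x. - real K \<le> x \<and> x \<le> real K \<and> lam \<omega> x < snd (q n) - inverse (real (Suc k)) \<and>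
    (\<forall>i. alive i \<omega> \<longrightarrow> birth i < x \<longrightarrow> inverse (real (Suc k)) \<le> \<bar>L i \<omega> x - snd (q n)\<bar>))"
    unfolding AE_all_countable
    by (intro allI covered_AE, unfold not_not, rule density_covered[OF q_dyadic(2)]) simp
  have 2: "AE \<omega> in M. \<forall>K. \<not> (\<exists>y. - real (Suc K) \<le> y \<and> y \<le> real (Suc K) \<and>
    (\<forall>z. - real (Suc K) \<le> z \<longrightarrow> z \<le> real (Suc K) \<longrightarrow> lam \<omega> z \<le> real B) \<and>
    (\<forall>n. alive n \<omega> \<longrightarrow> birth n = - real (Suc K) \<longrightarrow> L n \<omega> y \<le> real B))" for B :: nat
    unfolding AE_all_countable
    by (intro allI covered_AE, unfold not_not, rule unbounded_covered) simp
  then have 2: "AE \<omega> in M. \<forall>B K. \<not> (\<exists>y. - real (Suc K) \<le> y \<and> y \<le> real (Suc K) \<and>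
    (\<forall>z. - real (Suc K) \<le> z \<longrightarrow> z \<le> real (Suc K) \<longrightarrow> lam \<omega> z \<le> real B) \<and>
    (\<forall>n. alive n \<omega> \<longrightarrow> birth n = - real (Suc K) \<longrightarrow> L n \<omega> y \<le> real B))"
    by (subst AE_all_countable) blast
  have 3: "AE \<omega> in M. \<forall>i j K. \<not> (birth i < birth j \<and> - real K < lam \<omega> (birth i) \<and>
    infinite (dyadic_values (birth i) (birth j) K \<omega>))"
    unfolding AE_all_countable
  proof (intro allI)
    fix i j K
    show "AE \<omega> in M. \<not> (birth i < birth j \<and> - real K < lam \<omega> (birth i) \<and>
        infinite (dyadic_values (birth i) (birth j) K \<omega>))"
    proof (cases "birth i < birth j")
      case True
      then show ?thesis
        using dyadic_values_covered[OF q_dyadic(1) True, of K] by (intro covered_AE) simp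
    qed simp
  qed
  have 4: "AE \<omega> in M. \<forall>n. \<not> (alive n \<omega> \<and> (\<exists>b>birth n. \<forall>m. alive (pt (birth n) (snd (q n) - 1 / 2 ^ m)) \<omega> \<longrightarrow>
      L (pt (birth n) (snd (q n) - 1 / 2 ^ m)) \<omega> b \<noteq> L n \<omega> b))"
    unfolding AE_all_countable
    by (intro allI covered_AE, unfold not_not, rule coalesce_below_covered)
  show ?thesis
    using 1 2 3 4 AE_space
  proof eventually_elim
    case (elim \<omega>)
    note w = elim(5)
    have dens: "\<exists>n. alive n \<omega> \<and> birth n < x \<and> L n \<omega> x \<in> {a<..<b}" if "lam \<omega> x \<le> a" "a < b" for x a b
    proof -
      have "0 < (b - a) / 4" using that by simp
      then obtain k where k: "inverse (real (Suc k)) < (b - a) / 4" using reals_Archimedean by blast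
      define r where "r = inverse (real (Suc k))"
      have r: "r > 0" "r < (b - a) / 4" using k by (simp_all add: r_def)
      \<comment> \<open>The margin \<open>r\<close> on both sides keeps the barrier below
        \<open>h - r\<close> and the ball of radius \<open>r\<close> around \<open>h\<close> inside
        \<open>{a<..<b}\<close>.\<close>
      obtain h where h: "h \<in> dyadic_rationals" "a + r < h" "h < b - r"
        using dyadic_dense[of "a + r" "b - r"] r that by auto
      have qn: "snd (q (pt h h)) = h" by (simp add: q_pt[OF h(1) h(1)])
      obtain K :: nat where "\<bar>x\<bar> \<le> real K" using real_arch_simple by blast
      then have "- real K \<le> x" "x \<le> real K" "lam \<omega> x < snd (q (pt h h)) - inverse (real (Suc k))"
        using h that qn by (auto simp: r_def)
      then obtain i where "alive i \<omega>" "birth i < x" "\<not> r \<le> \<bar>L i \<omega> x - h\<bar>"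
        using elim(1) qn unfolding r_def by metis
      then show ?thesis using h by (intro exI[of _ i]) auto
    qed
    have unb: "\<exists>n. alive n \<omega> \<and> birth n < x \<and> c < L n \<omega> y" if "x < y" for x y c
    proof -
      obtain K :: nat where K: "max \<bar>x\<bar> \<bar>y\<bar> < real K" using reals_Archimedean2 by blast
      have "- real (Suc K) \<le> real (Suc K)" by simp
      \<comment> \<open>Continuity bounds the barrier on the interval on which
        \<open>unbounded_covered\<close> asks for a bound.\<close>
      from running_sup_attained[OF lam_cont[OF w] this] obtain z0
        where z0: "\<And>z. - real (Suc K) \<le> z \<Longrightarrow> z \<le> real (Suc K) \<Longrightarrow> lam \<omega> z \<le> lam \<omega> z0"
        by metis
      obtain B :: nat where B: "max c (lam \<omega> z0) < real B" using reals_Archimedean2 by blast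
      have "\<forall>z. - real (Suc K) \<le> z \<longrightarrow> z \<le> real (Suc K) \<longrightarrow> lam \<omega> z \<le> real B"
        using z0 B by (intro allI impI) (rule order_trans[OF z0], simp_all del: of_nat_Suc)
      moreover have "- real (Suc K) \<le> y" "y \<le> real (Suc K)" "- real (Suc K) < x" using K by auto
      ultimately obtain n where "alive n \<omega>" "birth n = - real (Suc K)" "\<not> L n \<omega> y \<le> real B"
        using elim(2) by metis
      then show ?thesis using B \<open>- real (Suc K) < x\<close> by (intro exI[of _ n]) auto
    qed
    have fin: "finite {L n \<omega> t | n. alive n \<omega> \<and> birth n \<le> s \<and> L n \<omega> s < c}"
      if st: "s \<in> dyadic_rationals" "t \<in> dyadic_rationals" "s < t" for s t c
    proof -
      obtain K :: nat where K: "max c (- lam \<omega> s) < real K" using reals_Archimedean2 by blast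
      \<comment> \<open>\<open>pt s s\<close> and \<open>pt t t\<close> merely provide indices with
        the birth times \<open>s\<close> and \<open>t\<close>, because the almost sure statement is
        quantified over indices.\<close>
      have "birth (pt s s) = s" "birth (pt t t) = t" using st by (simp_all add: q_pt)
      then have "finite (dyadic_values s t K \<omega>)" using elim(3) st K by (metis max_less_iff_conj minus_less_iff)
      from finite_line_values[OF w st(1,3) this] show ?thesis
        by (rule finite_subset[rotated]) (use K in auto)
    qed
    have coal: "\<exists>m. alive m \<omega> \<and> birth m = birth n \<and> snd (q m) < snd (q n) \<and> L m \<omega> b = L n \<omega> b"
      if nb: "alive n \<omega>" "birth n < b" for n b
    proof -
      obtain m where "alive (pt (birth n) (snd (q n) - 1 / 2 ^ m)) \<omega>"
        "L (pt (birth n) (snd (q n) - 1 / 2 ^ m)) \<omega> b = L n \<omega> b"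
        using elim(4) nb by blast
      moreover have "q (pt (birth n) (snd (q n) - 1 / 2 ^ m)) = (birth n, snd (q n) - 1 / 2 ^ m)"
        by (intro q_pt q_dyadic dyadic_diff_power)
      ultimately show ?thesis by (intro exI[of _ "pt (birth n) (snd (q n) - 1 / 2 ^ m)"]) simp
    qed
    show ?case unfolding good_def using dens unb fin coal by blast
  qed
qed

end

subsection \<open>From the properties of the lines to the theorem\<close>

text \<open>The deterministic half: the conclusion holds for any ordered coalescing family with
  these properties, however it was constructed.\<close>

locale good_lines =
  fixes l :: "real \<Rightarrow> real" and q :: "nat \<Rightarrow> real \<times> real" and L :: "nat \<Rightarrow> real \<Rightarrow> real"
    and \<Lambda> :: "real \<times> real \<Rightarrow> real \<Rightarrow> real"
  assumes cont: "q n \<in> strict_epigraph l \<Longrightarrow> continuous_on {fst (q n)..} (L n)"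
    and start: "q n \<in> strict_epigraph l \<Longrightarrow> L n (fst (q n)) = snd (q n)"
    and ge: "q n \<in> strict_epigraph l \<Longrightarrow> fst (q n) \<le> y \<Longrightarrow> l y \<le> L n y"
    and coalesce: "q n \<in> strict_epigraph l \<Longrightarrow> q m \<in> strict_epigraph l \<Longrightarrow> fst (q n) \<le> u \<Longrightarrow>
      fst (q m) \<le> u \<Longrightarrow> L n u = L m u \<Longrightarrow> u \<le> y \<Longrightarrow> L n y = L m y"
    and mono: "q n \<in> strict_epigraph l \<Longrightarrow> q m \<in> strict_epigraph l \<Longrightarrow> fst (q n) \<le> u \<Longrightarrow>
      fst (q m) \<le> u \<Longrightarrow> L n u \<le> L m u \<Longrightarrow> u \<le> y \<Longrightarrow> L n y \<le> L m y"
    and dense: "l x \<le> a \<Longrightarrow> a < b \<Longrightarrow>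
      \<exists>n. q n \<in> strict_epigraph l \<and> fst (q n) < x \<and> L n x \<in> {a<..<b}"
    and unbounded: "x < y \<Longrightarrow> \<exists>n. q n \<in> strict_epigraph l \<and> fst (q n) < x \<and> c < L n y"
    and finite_values: "s \<in> dyadic_rationals \<Longrightarrow> t \<in> dyadic_rationals \<Longrightarrow> s < t \<Longrightarrow>
      finite {L n t | n. q n \<in> strict_epigraph l \<and> fst (q n) \<le> s \<and> L n s < c}"
    and below: "q n \<in> strict_epigraph l \<Longrightarrow> fst (q n) < b \<Longrightarrow>
      \<exists>m. q m \<in> strict_epigraph l \<and> fst (q m) = fst (q n) \<and> snd (q m) < snd (q n) \<and> L m b = L n b"
    and \<Lambda>: "(x, h) \<in> strict_epigraph l \<Longrightarrow> x \<le> y \<Longrightarrow>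
      \<Lambda> (x, h) y = Sup {L n y | n. q n \<in> strict_epigraph l \<and> fst (q n) < x \<and> L n x < h}"
begin

abbreviation "alive n \<equiv> q n \<in> strict_epigraph l"
abbreviation "birth n \<equiv> fst (q n)"

definition lines_below :: "real \<Rightarrow> real \<Rightarrow> nat set"
  where "lines_below x h = {n. alive n \<and> birth n < x \<and> L n x < h}"

lemma \<Lambda>_lines_below: "l x < h \<Longrightarrow> x \<le> y \<Longrightarrow> \<Lambda> (x, h) y = Sup ((\<lambda>n. L n y) ` lines_below x h)"
  using \<Lambda>[of x h y] by (simp add: strict_epigraph_def lines_below_def setcompr_eq_image)

lemma lines_below_dense:
  assumes "l x < h" "c < h"
  obtains n where "n \<in> lines_below x h" "c < L n x"
  using dense[of x "max (l x) c" h] assms by (auto simp: lines_below_def)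

lemma \<Lambda>_eqI:
  assumes "l x < h" "x \<le> y" "n \<in> lines_below x h" "\<And>k. k \<in> lines_below x h \<Longrightarrow> L k y \<le> L n y"
  shows "\<Lambda> (x, h) y = L n y"
  unfolding \<Lambda>_lines_below[OF assms(1,2)] using assms(3,4) by (intro cSup_eq_maximum) auto

lemma \<Lambda>_start:
  assumes "l x < h"
  shows "\<Lambda> (x, h) x = h"
  unfolding \<Lambda>_lines_below[OF assms order_refl]
proof (rule cSup_eq_non_empty)
  show "(\<lambda>n. L n x) ` lines_below x h \<noteq> {}" using lines_below_dense[OF assms assms] by blast
  show "z \<le> h" if "z \<in> (\<lambda>n. L n x) ` lines_below x h" for z
    using that by (auto simp: lines_below_def)
  show "h \<le> c" if "\<And>z. z \<in> (\<lambda>n. L n x) ` lines_below x h \<Longrightarrow> z \<le> c" for c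
  proof (rule ccontr)
    assume "\<not> h \<le> c"
    then obtain n where "n \<in> lines_below x h" "c < L n x" using lines_below_dense[OF assms, of c] by auto
    then show False using that[of "L n x"] by auto
  qed
qed

text \<open>The supremum defining \<open>\<Lambda> (q n)\<close> runs over lines born strictly
  earlier. By \<open>below\<close>, a line \<open>m\<close> started under the same point has joined
  \<open>n\<close> by time \<open>y\<close>; it is born too late to count, but a line
  \<open>k\<close> passing between \<open>m\<close> and \<open>n\<close> is squeezed onto
  \<open>n\<close>.\<close>

lemma \<Lambda>_alive:
  assumes n: "alive n" and y: "birth n \<le> y"
  shows "\<Lambda> (q n) y = L n y"
proof (cases "birth n = y")
  case True
  have "l (birth n) < snd (q n)" using n by (cases "q n") (simp add: strict_epigraph_def)
  then show ?thesis using \<Lambda>_start[of "birth n" "snd (q n)"] start[OF n] True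
    by (cases "q n") simp
next
  case False
  have ln: "l (birth n) < snd (q n)" using n by (cases "q n") (simp add: strict_epigraph_def)
  obtain m where m: "alive m" "birth m = birth n" "snd (q m) < snd (q n)" "L m y = L n y"
    using below[OF n, of y] False y by auto
  obtain k where k: "k \<in> lines_below (birth n) (snd (q n))" "snd (q m) < L k (birth n)"
    using lines_below_dense[OF ln m(3)] by blast
  have kn: "alive k" "birth k < birth n" "L k (birth n) < snd (q n)" using k by (auto simp: lines_below_def)
  have up: "L i y \<le> L n y" if "i \<in> lines_below (birth n) (snd (q n))" for i
    using that start[OF n] y by (intro mono[OF _ n, of i "birth n" y]) (auto simp: lines_below_def)
  have "L m y \<le> L k y"
    using m kn k(2) start[OF m(1)] y by (intro mono[of m k "birth n" y]) auto
  then have "L k y = L n y" using up[OF k(1)] m(4) by simp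
  moreover have "\<Lambda> (birth n, snd (q n)) y = L k y"
    using up k(1) \<open>L k y = L n y\<close> by (intro \<Lambda>_eqI[OF ln y]) auto
  ultimately show ?thesis by simp
qed

text \<open>Two dyadic times fit between \<open>x\<close> and \<open>y\<close>. Lines below
  \<open>h\<close> at \<open>x\<close> remain below a common line \<open>m\<close>, so they take
  finitely many values at the second dyadic time, and by coalescence no more at
  \<open>y\<close>.\<close>

lemma finite_lines_below:
  assumes "x < y"
  shows "finite ((\<lambda>n. L n y) ` lines_below x h)"
proof -
  obtain s where s: "s \<in> dyadic_rationals" "x < s" "s < y" using dyadic_dense[OF assms] by blast
  obtain t where t: "t \<in> dyadic_rationals" "s < t" "t < y" using dyadic_dense[OF s(3)] by blast
  obtain m where m: "alive m" "birth m < x" "max h (l x) < L m x"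
    using dense[of x "max h (l x)" "max h (l x) + 1"] by auto
  define A where "A = {n. alive n \<and> birth n \<le> s \<and> L n s < L m s + 1}"
  have "finite {L n t | n. alive n \<and> birth n \<le> s \<and> L n s < L m s + 1}"
    by (rule finite_values[OF s(1) t(1,2)])
  then have fin: "finite ((\<lambda>n. L n t) ` A)" by (simp add: A_def setcompr_eq_image)
  have sub: "lines_below x h \<subseteq> A"
  proof
    fix n assume "n \<in> lines_below x h"
    then have n: "alive n" "birth n < x" "L n x < h" by (auto simp: lines_below_def)
    then have "L n s \<le> L m s" using m s by (intro mono[of n m x s]) auto
    then show "n \<in> A" using n s by (simp add: A_def)
  qed
  define r where "r = (\<lambda>z. SOME n. n \<in> A \<and> L n t = z)"
  have "(\<lambda>n. L n y) ` A \<subseteq> (\<lambda>z. L (r z) y) ` ((\<lambda>n. L n t) ` A)"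
  proof (intro image_subsetI)
    fix n assume n: "n \<in> A"
    have "r (L n t) \<in> A \<and> L (r (L n t)) t = L n t"
      unfolding r_def by (rule someI[of "\<lambda>i. i \<in> A \<and> L i t = L n t" n]) (simp add: n)
    then have "L n y = L (r (L n t)) y"
      using n s t by (intro coalesce[of _ _ t y]) (auto simp: A_def)
    then show "L n y \<in> (\<lambda>z. L (r z) y) ` ((\<lambda>n. L n t) ` A)" using n by blast
  qed
  then have "finite ((\<lambda>n. L n y) ` A)" by (rule finite_subset) (rule finite_imageI[OF fin])
  then show ?thesis using sub by (meson finite_subset image_mono)
qed

text \<open>The supremum at \<open>x + e\<close> is a maximum over a finite set. A line above a
  maximiser at time \<open>x\<close> attains it as well and stays maximal by the ordering, and it
  can be taken as close to \<open>h\<close> as desired.\<close>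

lemma \<Lambda>_eventually_line:
  assumes xh: "l x < h" and e: "e > 0"
  obtains n where "alive n" "birth n < x" "L n x \<in> {h - e<..<h}" "\<And>y. x + e \<le> y \<Longrightarrow> \<Lambda> (x, h) y = L n y"
proof -
  let ?y = "x + e"
  have fin: "finite ((\<lambda>n. L n ?y) ` lines_below x h)" using e by (intro finite_lines_below) simp
  have ne: "(\<lambda>n. L n ?y) ` lines_below x h \<noteq> {}" using lines_below_dense[OF xh xh] by blast
  obtain m where m: "m \<in> lines_below x h" "L m ?y = Max ((\<lambda>n. L n ?y) ` lines_below x h)"
    using Max_in[OF fin ne] by auto
  have m_max: "L k ?y \<le> L m ?y" if "k \<in> lines_below x h" for k
    using Max_ge[OF fin] that m(2) by simp
  have "max (h - e) (L m x) < h" using e m(1) by (simp add: lines_below_def)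
  then obtain n where n: "n \<in> lines_below x h" "max (h - e) (L m x) < L n x"
    using lines_below_dense[OF xh] by blast
  have an: "alive n" "birth n < x" "L n x < h" and am: "alive m" "birth m < x"
    using n m by (auto simp: lines_below_def)
  have mn: "L m ?y \<le> L n ?y" using an am n e by (intro mono[of m n x ?y]) auto
  show thesis
  proof (rule that[OF an(1,2)])
    show "L n x \<in> {h - e<..<h}" using n an by auto
    fix y assume y: "?y \<le> y"
    show "\<Lambda> (x, h) y = L n y"
    proof (rule \<Lambda>_eqI[OF xh _ n(1)])
      show "x \<le> y" using y e by simp
      fix k assume k: "k \<in> lines_below x h"
      then have "L k ?y \<le> L n ?y" using m_max[OF k] mn by simp
      then show "L k y \<le> L n y" using k an y e by (intro mono[of k n ?y y]) (auto simp: lines_below_def)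
    qed
  qed
qed

text \<open>A line from a time \<open>u < x\<close> has become one of the countably many lines by
  time \<open>x\<close>: \<open>\<Lambda>_eventually_line\<close> with \<open>x - u\<close> in place
  of \<open>e\<close>.\<close>

lemma line_valuesE:
  assumes "z \<in> line_values l \<Lambda> x y" "x \<le> y"
  obtains n where "alive n" "birth n < x" "z = L n y"
proof -
  obtain u h where u: "u < x" "l u < h" "z = \<Lambda> (u, h) y"
    using assms(1) by (auto simp: line_values_def strict_epigraph_def)
  obtain n where "alive n" "birth n < u" "\<And>y. u + (x - u) \<le> y \<Longrightarrow> \<Lambda> (u, h) y = L n y"
    using \<Lambda>_eventually_line[OF u(2), of "x - u"] u(1) by auto
  then show thesis using u assms(2) by (intro that[of n]) auto
qed

lemma line_valuesI:
  assumes "alive n" "birth n < x" "x \<le> y"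
  shows "L n y \<in> line_values l \<Lambda> x y"
proof -
  have "L n y = \<Lambda> (birth n, snd (q n)) y" using \<Lambda>_alive[of n y] assms by simp
  then show ?thesis
    unfolding line_values_def using assms by (intro CollectI exI[of _ "birth n"] exI[of _ "snd (q n)"]) simp
qed

lemma line_values_eq:
  assumes "x \<le> y"
  shows "line_values l \<Lambda> x y = {\<Lambda> (q n) y | n. birth n < x \<and> alive n}"
proof (intro set_eqI iffI)
  fix z assume "z \<in> line_values l \<Lambda> x y"
  then obtain n where "alive n" "birth n < x" "z = L n y" using line_valuesE assms by blast
  then show "z \<in> {\<Lambda> (q n) y | n. birth n < x \<and> alive n}"
    using \<Lambda>_alive[of n y] assms by (intro CollectI exI[of _ n]) auto
next
  fix z assume "z \<in> {\<Lambda> (q n) y | n. birth n < x \<and> alive n}"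
  then obtain n where "alive n" "birth n < x" "z = \<Lambda> (q n) y" by blast
  then show "z \<in> line_values l \<Lambda> x y"
    using \<Lambda>_alive[of n y] line_valuesI[of n x y] assms by auto
qed

lemma closure_line_values: "closure (line_values l \<Lambda> x x) = {l x..}"
proof (rule antisym)
  have "line_values l \<Lambda> x x \<subseteq> {l x..}"
  proof
    fix z assume "z \<in> line_values l \<Lambda> x x"
    then obtain n where "alive n" "birth n < x" "z = L n x" using line_valuesE by blast
    then show "z \<in> {l x..}" using ge[of n x] by simp
  qed
  then show "closure (line_values l \<Lambda> x x) \<subseteq> {l x..}" by (rule closure_minimal) simp
  show "{l x..} \<subseteq> closure (line_values l \<Lambda> x x)"
  proof
    fix z assume "z \<in> {l x..}"
    then have z: "l x \<le> z" by simp
    show "z \<in> closure (line_values l \<Lambda> x x)"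
      unfolding closure_approachable
    proof (intro allI impI)
      fix e :: real assume "e > 0"
      then obtain n where n: "alive n" "birth n < x" "L n x \<in> {z<..<z + e}" using dense[OF z, of "z + e"] by auto
      then show "\<exists>y\<in>line_values l \<Lambda> x x. dist y z < e"
        using line_valuesI[OF n(1,2) order_refl] by (intro bexI[of _ "L n x"]) (auto simp: dist_real_def)
    qed
  qed
qed

text \<open>Some line \<open>m\<close> exceeds the bound at \<open>y\<close>, so values within the
  bound come from lines that are below \<open>m\<close> at \<open>x\<close>.\<close>

lemma locally_finite_line_values:
  assumes xy: "x < y"
  shows "locally_finite_set (line_values l \<Lambda> x y)"
  unfolding locally_finite_set_def
proof (intro allI impI)
  fix B :: "real set" assume "bounded B"
  then obtain c where c: "\<And>z. z \<in> B \<Longrightarrow> \<bar>z\<bar> \<le> c" by (auto simp: bounded_iff)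
  obtain m where m: "alive m" "birth m < x" "c < L m y" using unbounded[OF xy] by blast
  have "line_values l \<Lambda> x y \<inter> B \<subseteq> (\<lambda>n. L n y) ` lines_below x (L m x)"
  proof
    fix z assume z: "z \<in> line_values l \<Lambda> x y \<inter> B"
    then have "z \<in> line_values l \<Lambda> x y" by simp
    from line_valuesE[OF this less_imp_le[OF xy]] obtain n
      where n: "alive n" "birth n < x" "z = L n y" by blast
    have "L n x < L m x"
    proof (rule ccontr)
      assume "\<not> L n x < L m x"
      then have "L m y \<le> L n y" using n m xy by (intro mono[of m n x y]) auto
      then show False using c[of z] z n m by auto
    qed
    then show "z \<in> (\<lambda>n. L n y) ` lines_below x (L m x)" using n by (auto simp: lines_below_def)
  qed
  then show "finite (line_values l \<Lambda> x y \<inter> B)" by (rule finite_subset) (rule finite_lines_below[OF xy])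
qed

lemma unbounded_line_values:
  assumes xy: "x < y"
  shows "\<not> bounded (line_values l \<Lambda> x y)"
proof
  assume "bounded (line_values l \<Lambda> x y)"
  then obtain c where c: "\<And>z. z \<in> line_values l \<Lambda> x y \<Longrightarrow> \<bar>z\<bar> \<le> c" by (auto simp: bounded_iff)
  obtain n where n: "alive n" "birth n < x" "c < L n y" using unbounded[OF xy] by blast
  then show False using c[OF line_valuesI[of n x y]] xy by auto
qed

text \<open>After its start the line locally coincides with a single continuous line. At the start
  it is squeezed between lines that pass just below and just above \<open>h\<close>.\<close>

lemma \<Lambda>_continuous:
  assumes xh: "l x < h"
  shows "continuous_on {x..} (\<Lambda> (x, h))"
proof (subst continuous_on_iff, intro ballI allI impI)
  fix y e :: real assume y: "y \<in> {x..}" and e: "e > 0"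
  show "\<exists>d>0. \<forall>z\<in>{x..}. dist z y < d \<longrightarrow> dist (\<Lambda> (x, h) z) (\<Lambda> (x, h) y) < e"
  proof (cases "x < y")
    case True
    define r where "r = (y - x) / 2"
    have r: "r > 0" "x + r < y" using True by (simp_all add: r_def field_simps)
    obtain n where n: "alive n" "birth n < x" "\<And>y. x + r \<le> y \<Longrightarrow> \<Lambda> (x, h) y = L n y"
      using \<Lambda>_eventually_line[OF xh r(1)] by blast
    have "y \<in> {birth n..}" using n True by simp
    then obtain d where d: "d > 0" "\<And>z. z \<in> {birth n..} \<Longrightarrow> dist z y < d \<Longrightarrow> dist (L n z) (L n y) < e"
      using cont[OF n(1)] e unfolding continuous_on_iff by blast
    show ?thesis
    proof (intro exI conjI ballI impI)
      show "min d r > 0" using d r by simp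
      fix z assume z: "z \<in> {x..}" "dist z y < min d r"
      then have "\<bar>z - y\<bar> < r" by (simp add: dist_real_def)
      moreover have "y = x + r + r" by (simp add: r_def)
      ultimately have "x + r \<le> z" by linarith
      then show "dist (\<Lambda> (x, h) z) (\<Lambda> (x, h) y) < e"
        using n z r d(2)[of z] by auto
    qed
  next
    case False
    then have yx: "y = x" using y by simp
    obtain n where n: "n \<in> lines_below x h" "h - e / 2 < L n x"
      using lines_below_dense[OF xh, of "h - e / 2"] e by auto
    obtain m where m: "alive m" "birth m < x" "L m x \<in> {h<..<h + e / 2}"
      using dense[of x h "h + e / 2"] xh e by auto
    have an: "alive n" "birth n < x" using n by (auto simp: lines_below_def)
    obtain d1 where d1: "d1 > 0" "\<And>z. z \<in> {birth n..} \<Longrightarrow> dist z x < d1 \<Longrightarrow> dist (L n z) (L n x) < e / 2"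
      using cont[OF an(1)] an e unfolding continuous_on_iff
      by (metis atLeast_iff half_gt_zero less_imp_le)
    obtain d2 where d2: "d2 > 0" "\<And>z. z \<in> {birth m..} \<Longrightarrow> dist z x < d2 \<Longrightarrow> dist (L m z) (L m x) < e / 2"
      using cont[OF m(1)] m e unfolding continuous_on_iff
      by (metis atLeast_iff half_gt_zero less_imp_le)
    show ?thesis
    proof (intro exI conjI ballI impI)
      show "min d1 d2 > 0" using d1 d2 by simp
      fix z assume z: "z \<in> {x..}" "dist z y < min d1 d2"
      have up: "L k z \<le> L m z" if "k \<in> lines_below x h" for k
        using that m z by (intro mono[of k m x z]) (auto simp: lines_below_def)
      have eq: "\<Lambda> (x, h) z = Sup ((\<lambda>k. L k z) ` lines_below x h)"
        using z by (intro \<Lambda>_lines_below[OF xh]) simp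
      have "\<Lambda> (x, h) z \<le> L m z" unfolding eq using n up by (intro cSup_least) auto
      moreover have "L n z \<le> \<Lambda> (x, h) z"
        unfolding eq using n up by (intro cSup_upper bdd_aboveI[of _ "L m z"]) auto
      moreover have "dist (L n z) (L n x) < e / 2" "dist (L m z) (L m x) < e / 2"
        using d1(2)[of z] d2(2)[of z] z an m yx by auto
      then have "\<bar>L n z - L n x\<bar> < e / 2" "\<bar>L m z - L m x\<bar> < e / 2" by (simp_all only: dist_real_def)
      moreover have "L m x < h + e / 2" using m(3) by simp
      ultimately have "\<bar>\<Lambda> (x, h) z - h\<bar> < e" using n(2) by linarith
      then show "dist (\<Lambda> (x, h) z) (\<Lambda> (x, h) y) < e" using \<Lambda>_start[OF xh] yx by (simp add: dist_real_def)
    qed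
  qed
qed

lemma conclusion:
  "(\<forall>x. closure (line_values l \<Lambda> x x) = {l x..}) \<and>
    (\<forall>x y. x < y \<longrightarrow>
      locally_finite_set (line_values l \<Lambda> x y) \<and>
      \<not> bounded (line_values l \<Lambda> x y)) \<and>
    (\<forall>x h \<epsilon>. (x, h) \<in> strict_epigraph l \<longrightarrow> \<epsilon> > 0 \<longrightarrow>
      (\<exists>n. q n \<in> strict_epigraph l \<and> fst (q n) < x \<and>
        \<Lambda> (q n) x \<in> {h - \<epsilon><..<h} \<and>
        (\<forall>y\<ge>x + \<epsilon>. \<Lambda> (x, h) y = \<Lambda> (q n) y))) \<and>
    (\<forall>x y. x < y \<longrightarrow>
      line_values l \<Lambda> x y =
        {\<Lambda> (q n) y | n. fst (q n) < x \<and> q n \<in> strict_epigraph l}) \<and>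
    (\<forall>x h. (x, h) \<in> strict_epigraph l \<longrightarrow> continuous_on {x..} (\<Lambda> (x, h)))"
proof (intro conjI allI impI)
  fix x h e :: real assume xh: "(x, h) \<in> strict_epigraph l" and e: "e > 0"
  then obtain n where n: "alive n" "birth n < x" "L n x \<in> {h - e<..<h}"
      "\<And>y. x + e \<le> y \<Longrightarrow> \<Lambda> (x, h) y = L n y"
    using \<Lambda>_eventually_line[of x h e] by (auto simp: strict_epigraph_def)
  show "\<exists>n. alive n \<and> birth n < x \<and> \<Lambda> (q n) x \<in> {h - e<..<h} \<and> (\<forall>y\<ge>x + e. \<Lambda> (x, h) y = \<Lambda> (q n) y)"
    using n e \<Lambda>_alive[OF n(1)] by (intro exI[of _ n]) auto
next
  fix x h assume "(x, h) \<in> strict_epigraph l"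
  then show "continuous_on {x..} (\<Lambda> (x, h))" by (intro \<Lambda>_continuous) (simp add: strict_epigraph_def)
next
  fix x y :: real assume "x < y"
  then show "line_values l \<Lambda> x y = {\<Lambda> (q n) y | n. birth n < x \<and> alive n}"
    by (intro line_values_eq) simp
qed (use closure_line_values locally_finite_line_values unbounded_line_values in blast)+

end

subsection \<open>The filtration of the driving motions\<close>

lemma first_time_eqI:
  assumes "T \<in> S" "\<And>u. u \<in> S \<Longrightarrow> T \<le> u"
  shows "first_time S = ereal T"
  unfolding first_time_def using assms by (intro antisym INF_lower INF_greatest) auto

context rab_family
begin

text \<open>Only defined paths, and only their values after birth, enter the construction. This
  allows the passage from the given motions to the modified ones.\<close>

lemma coalescing_line_cong:
  assumes R': "\<And>n y. alive n \<Longrightarrow> birth n \<le> y \<Longrightarrow> R' n y = R n y"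
  shows "alive n \<Longrightarrow> birth n \<le> y \<Longrightarrow> coalescing_line l q R' n y = L n y"
proof (induction n arbitrary: y rule: less_induct)
  case (less n)
  let ?L' = "first_lines l q R' n"
  have fl: "first_lines l q R' m k = coalescing_line l q R' k" if "k < m" for k m
    using that by (induction m) (auto simp: coalescing_line_def less_Suc_eq)
  have met: "met_lines l q n (R' n) ?L' u = meets n u" if "birth n \<le> u" for u
    using less.IH R'[OF less.prems(1) that] by (auto simp: met_lines_def meets_def fl)
  then have S: "{u. birth n \<le> u \<and> met_lines l q n (R' n) ?L' u \<noteq> {}} = {u. birth n \<le> u \<and> meets n u \<noteq> {}}"
    by auto
  have unfold: "coalescing_line l q R' n y = (let T = first_time {u. birth n \<le> u \<and> meets n u \<noteq> {}}
     in if ereal y \<le> T then R' n y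
        else ?L' (LEAST k. k \<in> met_lines l q n (R' n) ?L' (real_of_ereal T)) y)"
    by (simp add: coalescing_line_def coalesce_def S Let_def del: ereal_less_eq)
  from less.prems(1) show ?case
  proof (cases rule: L_cases)
    case free
    then have empty: "{u. birth n \<le> u \<and> meets n u \<noteq> {}} = {}" by auto
    have "first_time {u. birth n \<le> u \<and> meets n u \<noteq> {}} = \<infinity>"
      unfolding empty by (simp add: first_time_def top_ereal_def)
    then show ?thesis using R'[OF less.prems] free(2) unfolding unfold by simp
  next
    case (hit T k)
    have T: "first_time {u. birth n \<le> u \<and> meets n u \<noteq> {}} = ereal T"
    proof (rule first_time_eqI)
      show "T \<in> {u. birth n \<le> u \<and> meets n u \<noteq> {}}" using hit(1,2) by auto
      show "T \<le> u" if "u \<in> {u. birth n \<le> u \<and> meets n u \<noteq> {}}" for u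
        using hit(4)[of u] that by (cases "u < T") auto
    qed
    have least: "(LEAST k. k \<in> meets n T) = k" using hit(2,3) by (intro Least_equality)
    have k: "k < n" "alive k" "birth k \<le> T" using hit(2) by (auto simp: meets_def)
    show ?thesis
    proof (cases "y \<le> T")
      case True
      then show ?thesis unfolding unfold T using R'[OF less.prems] hit(5) by simp
    next
      case False
      then have "coalescing_line l q R' k y = L k y" using k by (intro less.IH) auto
      then show ?thesis unfolding unfold T using False hit(6)[of y] k by (simp add: met[OF hit(1)] least fl)
    qed
  qed
qed

end

locale driven_web = prob_space M for M :: "'a measure" +
  fixes v :: real and lam :: "'a \<Rightarrow> real \<Rightarrow> real" and chi :: "'a \<Rightarrow> real"
    and q :: "nat \<Rightarrow> real \<times> real" and a :: "nat \<Rightarrow> real" and W :: "nat \<Rightarrow> 'a \<Rightarrow> real \<Rightarrow> real"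
  assumes v_pos: "v > 0" and barrier: "barrier M lam chi"
    and q_range: "range q = dyadic_rationals \<times> dyadic_rationals"
    and a_le: "\<And>n. a n \<le> fst (q n)"
    and bm: "\<And>n. brownian_motion M v (a n) (W n)"
    and joint: "jointly_independent M lam chi a W"
begin

abbreviation "start n \<equiv> fst (q n)"

text \<open>One event of probability 1 is fixed because \<open>web\<close> asks for continuous paths
  at every point of the space.\<close>

definition regular :: "'a set"
  where "regular = (SOME A. A \<in> events \<and> prob A = 1 \<and> (\<forall>\<omega>\<in>A. \<forall>n. continuous_on {a n..} (W n \<omega>)))"

lemma regular: "regular \<in> events" "prob regular = 1"
  and regular_cont: "\<omega> \<in> regular \<Longrightarrow> continuous_on {a n..} (W n \<omega>)"
proof -
  have "AE \<omega> in M. \<forall>n. continuous_on {a n..} (W n \<omega>)"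
    unfolding AE_all_countable using bm by (simp add: brownian_motion_def)
  then obtain N where N: "{\<omega> \<in> space M. \<not> (\<forall>n. continuous_on {a n..} (W n \<omega>))} \<subseteq> N" "N \<in> null_sets M"
    by (auto simp: eventually_ae_filter)
  then have "space M - N \<in> events \<and> prob (space M - N) = 1 \<and> (\<forall>\<omega>\<in>space M - N. \<forall>n. continuous_on {a n..} (W n \<omega>))"
    using prob_compl[of N] by (auto simp: null_sets_def measure_def)
  then have "regular \<in> events \<and> prob regular = 1 \<and> (\<forall>\<omega>\<in>regular. \<forall>n. continuous_on {a n..} (W n \<omega>))"
    unfolding regular_def by (rule someI)
  then show "regular \<in> events" "prob regular = 1" "\<omega> \<in> regular \<Longrightarrow> continuous_on {a n..} (W n \<omega>)" by auto
qed

lemma AE_regular: "AE \<omega> in M. \<omega> \<in> regular"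
  by (rule AE_prob_1[OF regular(2)])

text \<open>Frozen before the birth time and normalised to vanish there. \<open>Y n\<close> depends
  on \<open>W n\<close> alone, whereas \<open>X n\<close> also involves all other motions through
  \<open>regular\<close>.\<close>

definition Y :: "nat \<Rightarrow> 'a \<Rightarrow> real \<Rightarrow> real"
  where "Y n \<omega> u = W n \<omega> (max u (start n)) - W n \<omega> (start n)"

definition X :: "nat \<Rightarrow> 'a \<Rightarrow> real \<Rightarrow> real"
  where "X n \<omega> u = (if \<omega> \<in> regular then Y n \<omega> u else 0)"

lemma X_cont: "continuous_on UNIV (X n \<omega>)"
proof (cases "\<omega> \<in> regular")
  case True
  have "continuous_on UNIV (\<lambda>u. W n \<omega> (max u (start n)))"
    by (rule continuous_on_compose2[OF regular_cont[OF True, of n]])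
      (use a_le[of n] in \<open>auto intro!: continuous_intros simp: le_max_iff_disj\<close>)
  then show ?thesis using True by (auto simp: X_def[abs_def] Y_def intro!: continuous_intros)
qed (simp add: X_def[abs_def])

definition Bar :: "'a measure"
  where "Bar = vimage_algebra (space M) (\<lambda>\<omega>. (lam \<omega>, chi \<omega>)) (PiM UNIV (\<lambda>_. borel) \<Otimes>\<^sub>M borel)"

definition Drv :: "nat \<Rightarrow> 'a measure"
  where "Drv n = vimage_algebra (space M) (\<lambda>\<omega>. restrict (W n \<omega>) {a n..}) (PiM {a n..} (\<lambda>_. borel))"

lemma indep: "indep_sets (\<lambda>i. case i of None \<Rightarrow> sets Bar | Some n \<Rightarrow> sets (Drv n)) UNIV"
  using joint unfolding jointly_independent_def Bar_def Drv_def .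

lemma space_Bar [simp]: "space Bar = space M" and space_Drv [simp]: "space (Drv n) = space M"
  by (simp_all add: Bar_def Drv_def)

lemma Bar_events: "sets Bar \<subseteq> events" and Drv_events: "sets (Drv n) \<subseteq> events"
  using indep by (auto simp: indep_sets_def split: option.splits dest: spec[of _ None] spec[of _ "Some n"])

lemma lam_Bar: "(\<lambda>\<omega>. lam \<omega> u) \<in> borel_measurable Bar" and chi_Bar: "chi \<in> borel_measurable Bar"
proof -
  have "(\<lambda>\<omega>. (lam \<omega>, chi \<omega>)) \<in> measurable Bar (PiM UNIV (\<lambda>_. borel) \<Otimes>\<^sub>M borel)"
    unfolding Bar_def by (rule measurable_vimage_algebra1) (auto simp: space_pair_measure space_PiM)
  then have 1: "lam \<in> measurable Bar (PiM UNIV (\<lambda>_. borel))" and 2: "chi \<in> borel_measurable Bar"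
    by (auto dest: measurable_fst'' measurable_snd'' simp: measurable_pair_iff comp_def)
  show "chi \<in> borel_measurable Bar" by (rule 2)
  show "(\<lambda>\<omega>. lam \<omega> u) \<in> borel_measurable Bar"
    using measurable_compose[OF 1 measurable_component_singleton[of u UNIV]] by simp
qed

lemma W_Drv:
  assumes "a n \<le> z"
  shows "(\<lambda>\<omega>. W n \<omega> z) \<in> borel_measurable (Drv n)"
proof -
  have "(\<lambda>\<omega>. restrict (W n \<omega>) {a n..}) \<in> measurable (Drv n) (PiM {a n..} (\<lambda>_. borel))"
    unfolding Drv_def by (rule measurable_vimage_algebra1) (auto simp: space_PiM)
  from measurable_compose[OF this measurable_component_singleton[of z "{a n..}"]]
  show ?thesis using assms by simp
qed

lemma Y_Drv: "(\<lambda>\<omega>. Y n \<omega> u) \<in> borel_measurable (Drv n)"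
  unfolding Y_def using a_le[of n] by (intro borel_measurable_diff W_Drv) auto

lemma Y_measurable [measurable]: "(\<lambda>\<omega>. Y n \<omega> u) \<in> borel_measurable M"
  using Y_Drv[of n u] Drv_events[of n] by (auto simp: measurable_def)

lemma X_measurable [measurable]: "(\<lambda>\<omega>. X n \<omega> u) \<in> borel_measurable M"
  unfolding X_def using regular(1) by measurable

lemma gauss_increment:
  assumes "start n \<le> s" "s < t" "B \<in> sets borel"
  shows "prob {\<omega> \<in> space M. Y n \<omega> t - Y n \<omega> s \<in> B} = measure (gauss (sqrt (v * (t - s)))) B"
proof -
  have "a n \<le> s" using assms(1) a_le[of n] by simp
  then have d: "distributed M lborel (\<lambda>\<omega>. W n \<omega> t - W n \<omega> s) (\<lambda>u. ennreal (normal_density 0 (sqrt (v * (t - s))) u))"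
    using bm[of n] assms(2) by (simp add: brownian_motion_def)
  have m: "(\<lambda>\<omega>. W n \<omega> t - W n \<omega> s) \<in> measurable M lborel" using d by (rule distributed_measurable)
  have "{\<omega> \<in> space M. Y n \<omega> t - Y n \<omega> s \<in> B} = (\<lambda>\<omega>. W n \<omega> t - W n \<omega> s) -` B \<inter> space M"
    using assms by (auto simp: Y_def max_def)
  also have "prob \<dots> = measure (distr M lborel (\<lambda>\<omega>. W n \<omega> t - W n \<omega> s)) B"
    using m assms(3) by (subst measure_distr) auto
  finally show ?thesis by (simp add: distributed_distr_eq_density[OF d] gauss_def)
qed

text \<open>The values at the times \<open>u \<le> s\<close> are partial sums of increments over a partition of \<open>[start n, s]\<close>.\<close>

lemma cylinder_increment:
  assumes n: "start n \<le> s" "s < t" and U: "finite U" "U \<subseteq> {..s}" and B: "\<And>u. B u \<in> sets borel" and C: "C \<in> sets borel"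
  shows "prob ({\<omega> \<in> space M. \<forall>u\<in>U. Y n \<omega> u \<in> B u} \<inter> {\<omega> \<in> space M. Y n \<omega> t - Y n \<omega> s \<in> C}) =
    prob {\<omega> \<in> space M. \<forall>u\<in>U. Y n \<omega> u \<in> B u} * prob {\<omega> \<in> space M. Y n \<omega> t - Y n \<omega> s \<in> C}"
proof -
  define xs where "xs = sorted_list_of_set U"
  define m where "m = length xs"
  \<comment> \<open>A partition with repetitions: times of \<open>U\<close> before the birth are
    moved to it, since \<open>Y\<close> is 0 there too. The increments 0 to \<open>m\<close> lead up
    to \<open>s\<close>, and the increment \<open>Suc m\<close> is the one from \<open>s\<close> to
    \<open>t\<close>.\<close>
  define \<tau> where "\<tau> = (\<lambda>i. if i = 0 then start n else if i \<le> m then max (start n) (xs ! (i - 1))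
    else if i = Suc m then s else t)"
  have xs: "set xs = U" "sorted xs" using U(1) by (simp_all add: xs_def)
  have xs_le: "xs ! i \<le> s" if "i < m" for i
    using that xs(1) U(2) nth_mem[of i xs] by (auto simp: m_def)
  have "mono \<tau>"
  proof (rule incseq_SucI)
    fix i
    consider "i = 0" "m = 0" | "i = 0" "m > 0" | "0 < i" "i < m" | "0 < i" "i = m" | "i = Suc m" | "i > Suc m" by linarith
    then show "\<tau> i \<le> \<tau> (Suc i)"
    proof cases
      case 3
      then have "xs ! (i - 1) \<le> xs ! i" using xs(2) by (intro sorted_nth_mono) (auto simp: m_def)
      then show ?thesis using 3 by (auto simp: \<tau>_def)
    next
      case 4
      then show ?thesis using xs_le[of "i - 1"] n by (auto simp: \<tau>_def)
    qed (use n in \<open>auto simp: \<tau>_def\<close>)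
  qed
  moreover have "a n \<le> \<tau> 0" using a_le[of n] by (simp add: \<tau>_def)
  ultimately have ind: "indep_vars (\<lambda>_. borel) (\<lambda>i \<omega>. W n \<omega> (\<tau> (Suc i)) - W n \<omega> (\<tau> i)) UNIV"
    using bm[of n] by (simp add: brownian_motion_def)
  let ?D = "\<lambda>i \<omega>. W n \<omega> (\<tau> (Suc i)) - W n \<omega> (\<tau> i)"
  have tel: "(\<Sum>j\<le>i. ?D j \<omega>) = Y n \<omega> (xs ! i)" if "i < m" for i \<omega>
  proof -
    have "(\<Sum>j\<le>i. ?D j \<omega>) = W n \<omega> (\<tau> (Suc i)) - W n \<omega> (\<tau> 0)"
      by (induction i) auto
    then show ?thesis using that by (simp add: \<tau>_def Y_def max.commute)
  qed
  let ?P = "PiM {..m} (\<lambda>_. borel :: real measure)" and ?Q = "PiM {Suc m} (\<lambda>_. borel :: real measure)"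
  let ?p = "\<lambda>\<omega>. restrict (\<lambda>i. ?D i \<omega>) {..m}" and ?r = "\<lambda>\<omega>. restrict (\<lambda>i. ?D i \<omega>) {Suc m}"
  have iv: "indep_var ?P ?p ?Q ?r"
    using indep_var_restrict[OF ind, of "{..m}" "{Suc m}"] by simp
  define S where "S = {f \<in> space ?P. \<forall>i\<in>{..<m}. (\<Sum>j\<le>i. f j) \<in> B (xs ! i)}"
  have S: "S \<in> sets ?P"
    unfolding S_def
  proof (rule sets.sets_Collect_finite_All)
    fix i assume "i \<in> {..<m}"
    then have "(\<lambda>f. \<Sum>j\<le>i. f j) \<in> borel_measurable ?P"
      by (intro borel_measurable_sum measurable_component_singleton) auto
    from measurable_sets[OF this B[of "xs ! i"]]
    show "{f \<in> space ?P. (\<Sum>j\<le>i. f j) \<in> B (xs ! i)} \<in> sets ?P"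
      by (simp add: vimage_def Int_def conj_commute)
  qed simp
  define T where "T = (\<lambda>f. f (Suc m)) -` C \<inter> space ?Q"
  have "(\<lambda>f. f (Suc m)) \<in> borel_measurable ?Q" by (rule measurable_component_singleton) simp
  then have T: "T \<in> sets ?Q" unfolding T_def using C by (rule measurable_sets)
  have "prob ((?p -` S \<inter> space M) \<inter> (?r -` T \<inter> space M)) = prob (?p -` S \<inter> space M) * prob (?r -` T \<inter> space M)"
    using indep_varD[OF iv S T] by (simp add: Int_def conj_ac vimage_def)
  moreover have "?p -` S \<inter> space M = {\<omega> \<in> space M. \<forall>u\<in>U. Y n \<omega> u \<in> B u}"
  proof -
    have key: "(\<forall>i\<in>{..<m}. (\<Sum>j\<le>i. ?p \<omega> j) \<in> B (xs ! i)) \<longleftrightarrow> (\<forall>u\<in>U. Y n \<omega> u \<in> B u)" for \<omega>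
    proof -
      have "(\<Sum>j\<le>i. ?p \<omega> j) = Y n \<omega> (xs ! i)" if "i \<in> {..<m}" for i
      proof -
        have "(\<Sum>j\<le>i. ?p \<omega> j) = (\<Sum>j\<le>i. ?D j \<omega>)" using that by (intro sum.cong) auto
        then show ?thesis using tel[of i \<omega>] that by simp
      qed
      then have "(\<forall>i\<in>{..<m}. (\<Sum>j\<le>i. ?p \<omega> j) \<in> B (xs ! i)) \<longleftrightarrow> (\<forall>i<m. Y n \<omega> (xs ! i) \<in> B (xs ! i))" by auto
      also have "\<dots> \<longleftrightarrow> (\<forall>u\<in>set xs. Y n \<omega> u \<in> B u)" by (simp add: m_def all_set_conv_all_nth)
      finally show ?thesis by (simp only: xs(1))
    qed
    have "?p \<omega> \<in> space ?P" for \<omega> by (simp add: space_PiM)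
    then have "?p \<omega> \<in> S \<longleftrightarrow> (\<forall>u\<in>U. Y n \<omega> u \<in> B u)" for \<omega>
      unfolding S_def using key by blast
    then show ?thesis by blast
  qed
  moreover have "?r -` T \<inter> space M = {\<omega> \<in> space M. Y n \<omega> t - Y n \<omega> s \<in> C}"
  proof -
    have "?r \<omega> \<in> space ?Q" for \<omega> by (simp add: space_PiM)
    moreover have "?r \<omega> (Suc m) = Y n \<omega> t - Y n \<omega> s" for \<omega>
      using n by (simp add: \<tau>_def Y_def max_absorb1)
    ultimately have "?r \<omega> \<in> T \<longleftrightarrow> Y n \<omega> t - Y n \<omega> s \<in> C" for \<omega>
      unfolding T_def by (metis (no_types, lifting) IntI IntD1 vimage_eq)
    then show ?thesis by blast
  qed
  ultimately show ?thesis by simp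
qed

section \<open>Independence of the future increments from the past\<close>

definition cyl :: "(nat \<Rightarrow> 'a \<Rightarrow> real \<Rightarrow> real) \<Rightarrow> 'a set \<Rightarrow> (nat \<times> real) set \<Rightarrow> (nat \<times> real \<Rightarrow> real set) \<Rightarrow> 'a set"
  where "cyl Z A P B = {\<omega> \<in> A. \<forall>p\<in>P. Z (fst p) \<omega> (snd p) \<in> B p}"

definition fut :: "(nat \<Rightarrow> 'a \<Rightarrow> real \<Rightarrow> real) \<Rightarrow> nat set \<Rightarrow> real \<Rightarrow> real \<Rightarrow> (nat \<Rightarrow> real set) \<Rightarrow> 'a set"
  where "fut Z K s t C = {\<omega> \<in> space M. \<forall>k\<in>K. Z k \<omega> t - Z k \<omega> s \<in> C k}"

text \<open>The constraints are grouped by motion: joint independence separates the groups from each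
  other and from the barrier, and \<open>cylinder_increment\<close> separates past and future within
  a group.\<close>

lemma cyl_fut_Y:
  assumes A: "A \<in> sets Bar" and P: "finite P" "\<And>p. p \<in> P \<Longrightarrow> snd p \<le> s" and B: "\<And>p. B p \<in> sets borel"
    and K: "finite K" "\<And>k. k \<in> K \<Longrightarrow> start k \<le> s" and st: "s < t" and C: "\<And>k. C k \<in> sets borel"
  shows "prob (cyl Y A P B \<inter> fut Y K s t C) = prob (cyl Y A P B) * (\<Prod>k\<in>K. measure (gauss (sqrt (v * (t - s)))) (C k))"
proof -
  let ?g = "\<lambda>k. measure (gauss (sqrt (v * (t - s)))) (C k)"
  define I where "I = fst ` P \<union> K"
  have I: "finite I" using P K by (simp add: I_def)
  define D where "D = (\<lambda>k. {\<omega> \<in> space M. \<forall>u\<in>{u. (k, u) \<in> P}. Y k \<omega> u \<in> B (k, u)})"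
  define E where "E = (\<lambda>k. if k \<in> K then {\<omega> \<in> space M. Y k \<omega> t - Y k \<omega> s \<in> C k} else space M)"
  have finU: "finite {u. (k, u) \<in> P}" for k
    by (rule finite_subset[of _ "snd ` P"]) (use P in force)+
  have Ymem: "{\<omega> \<in> space M. Y k \<omega> u \<in> B'} \<in> sets (Drv k)" if "B' \<in> sets borel" for k u B'
    using measurable_sets[OF Y_Drv that, of k u] by (simp add: vimage_def Int_def conj_commute)
  have D: "D k \<in> sets (Drv k)" for k
  proof -
    have "{\<omega> \<in> space (Drv k). \<forall>u\<in>{u. (k, u) \<in> P}. Y k \<omega> u \<in> B (k, u)} \<in> sets (Drv k)"
      using Ymem B by (intro sets.sets_Collect_finite_All finU) simp
    then show ?thesis by (simp add: D_def)
  qed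
  have E: "E k \<in> sets (Drv k)" for k
  proof -
    have "(\<lambda>\<omega>. Y k \<omega> t - Y k \<omega> s) \<in> borel_measurable (Drv k)" by (intro borel_measurable_diff Y_Drv)
    from measurable_sets[OF this C[of k]] have "{\<omega> \<in> space M. Y k \<omega> t - Y k \<omega> s \<in> C k} \<in> sets (Drv k)"
      by (simp add: vimage_def Int_def conj_commute)
    then show ?thesis using sets.top[of "Drv k"] by (simp add: E_def)
  qed
  have DE: "prob (D k \<inter> E k) = prob (D k) * (if k \<in> K then ?g k else 1)" for k
  proof (cases "k \<in> K")
    case True
    have "prob (D k \<inter> E k) = prob (D k) * prob (E k)"
      unfolding D_def E_def if_P[OF True]
      using P(2) K(2)[OF True] st B C finU by (intro cylinder_increment) force+
    moreover have "prob (E k) = ?g k"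
      unfolding E_def if_P[OF True] using K(2)[OF True] st C by (intro gauss_increment) auto
    ultimately show ?thesis using True by simp
  next
    case False
    moreover have "D k \<inter> space M = D k" by (auto simp: D_def)
    ultimately show ?thesis by (simp add: E_def)
  qed
  have AM: "A \<subseteq> space M" using sets.sets_into_space[OF A] by simp
  have prod: "prob (A \<inter> (\<Inter>k\<in>I. G k)) = prob A * (\<Prod>k\<in>I. prob (G k))" if "\<And>k. G k \<in> sets (Drv k)" for G
  proof -
    have "prob (\<Inter>i\<in>insert None (Some ` I). (case i of None \<Rightarrow> A | Some k \<Rightarrow> G k)) =
        (\<Prod>i\<in>insert None (Some ` I). prob (case i of None \<Rightarrow> A | Some k \<Rightarrow> G k))"
      using I A that by (intro indep_setsD[OF indep]) auto
    moreover have "(\<Prod>i\<in>insert None (Some ` I). prob (case i of None \<Rightarrow> A | Some k \<Rightarrow> G k)) = prob A * (\<Prod>k\<in>I. prob (G k))"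
      using I by (subst prod.insert) (auto simp: prod.reindex)
    moreover have "(\<Inter>i\<in>insert None (Some ` I). (case i of None \<Rightarrow> A | Some k \<Rightarrow> G k)) = A \<inter> (\<Inter>k\<in>I. G k)" by auto
    ultimately show ?thesis by simp
  qed
  have c1: "cyl Y A P B = A \<inter> (\<Inter>k\<in>I. D k)" using AM by (force simp: cyl_def D_def I_def)
  have c2: "cyl Y A P B \<inter> fut Y K s t C = A \<inter> (\<Inter>k\<in>I. D k \<inter> E k)"
    unfolding c1 using AM by (auto simp: fut_def E_def I_def split: if_splits)
  have "(\<Prod>k\<in>I. if k \<in> K then ?g k else 1) = (\<Prod>k\<in>K. ?g k)"
    using I by (intro prod.mono_neutral_cong_right) (auto simp: I_def)
  then show ?thesis
    unfolding c2 unfolding c1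
    by (subst prod, use D E in auto, subst prod, use D in auto) (simp add: DE prod.distrib)
qed

lemma cyl_events:
  assumes "A \<in> events" "finite P" "\<And>p. B p \<in> sets borel" "\<And>p. (\<lambda>\<omega>. Z (fst p) \<omega> (snd p)) \<in> borel_measurable M"
  shows "cyl Z A P B \<in> events"
proof -
  have "{\<omega> \<in> space M. \<forall>p\<in>P. Z (fst p) \<omega> (snd p) \<in> B p} \<in> events"
  proof (rule sets.sets_Collect_finite_All)
    show "{\<omega> \<in> space M. Z (fst p) \<omega> (snd p) \<in> B p} \<in> events" for p
      using measurable_sets[OF assms(4)[of p] assms(3)[of p]] by (simp add: vimage_def Int_def conj_commute)
  qed fact
  then have "A \<inter> {\<omega> \<in> space M. \<forall>p\<in>P. Z (fst p) \<omega> (snd p) \<in> B p} \<in> events" using assms(1) by (rule sets.Int[rotated])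
  also have "A \<inter> {\<omega> \<in> space M. \<forall>p\<in>P. Z (fst p) \<omega> (snd p) \<in> B p} = cyl Z A P B"
    using sets.sets_into_space[OF assms(1)] by (auto simp: cyl_def)
  finally show ?thesis .
qed

lemma fut_events:
  assumes "finite K" "\<And>k. C k \<in> sets borel" "\<And>k u. (\<lambda>\<omega>. Z k \<omega> u) \<in> borel_measurable M"
  shows "fut Z K s t C \<in> events"
  unfolding fut_def
proof (rule sets.sets_Collect_finite_All)
  fix k
  have "(\<lambda>\<omega>. Z k \<omega> t - Z k \<omega> s) \<in> borel_measurable M" using assms(3) by measurable
  from measurable_sets[OF this assms(2)[of k]]
  show "{\<omega> \<in> space M. Z k \<omega> t - Z k \<omega> s \<in> C k} \<in> events" by (simp add: vimage_def Int_def conj_commute)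
qed fact

text \<open>\<open>X\<close> and \<open>Y\<close> agree on \<open>regular\<close>, hence almost
  surely.\<close>

lemma cyl_fut_X:
  assumes A: "A \<in> sets Bar" and P: "finite P" "\<And>p. p \<in> P \<Longrightarrow> snd p \<le> s" and B: "\<And>p. B p \<in> sets borel"
    and K: "finite K" "\<And>k. k \<in> K \<Longrightarrow> start k \<le> s" and st: "s < t" and C: "\<And>k. C k \<in> sets borel"
  shows "prob (cyl X A P B \<inter> fut X K s t C) = prob (cyl X A P B) * (\<Prod>k\<in>K. measure (gauss (sqrt (v * (t - s)))) (C k))"
proof -
  have AM: "A \<in> events" using A Bar_events by auto
  have ev: "cyl X A P B \<in> events" "cyl Y A P B \<in> events" "fut X K s t C \<in> events" "fut Y K s t C \<in> events"
    using AM P B K C by (auto intro!: cyl_events fut_events)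
  have "prob (cyl X A P B) = prob (cyl Y A P B)"
    by (rule finite_measure_eq_AE[OF _ ev(1,2)])
      (use AE_regular in \<open>eventually_elim, auto simp: cyl_def X_def\<close>)
  moreover have "prob (cyl X A P B \<inter> fut X K s t C) = prob (cyl Y A P B \<inter> fut Y K s t C)"
    by (rule finite_measure_eq_AE[OF _ sets.Int[OF ev(1,3)] sets.Int[OF ev(2,4)]])
      (use AE_regular in \<open>eventually_elim, auto simp: cyl_def fut_def X_def\<close>)
  ultimately show ?thesis using cyl_fut_Y[OF assms] by simp
qed

definition past_cyls :: "real \<Rightarrow> 'a set set"
  where "past_cyls t = {cyl X A P B | A P B. A \<in> sets Bar \<and> finite P \<and> (\<forall>p\<in>P. snd p \<le> t) \<and> (\<forall>p. B p \<in> sets borel)}"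

lemma past_cylsI:
  assumes "A \<in> sets Bar" "finite P" "\<And>p. p \<in> P \<Longrightarrow> snd p \<le> t" "\<And>p. B p \<in> sets borel"
  shows "cyl X A P B \<in> past_cyls t"
  unfolding past_cyls_def using assms by blast

definition F :: "real \<Rightarrow> 'a measure"
  where "F t = sigma (space M) (past_cyls t)"

lemma past_cyls_events: "past_cyls t \<subseteq> events"
  using Bar_events by (auto simp: past_cyls_def intro!: cyl_events)

lemma past_cyls_Pow: "past_cyls t \<subseteq> Pow (space M)"
  using past_cyls_events sets.sets_into_space by blast

lemma F_space: "space (F t) = space M"
  unfolding F_def using past_cyls_Pow by (rule space_measure_of)

lemma F_sets: "sets (F t) = sigma_sets (space M) (past_cyls t)"
  unfolding F_def using past_cyls_Pow by (rule sets_measure_of)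

lemma F_events: "sets (F t) \<subseteq> events"
  unfolding F_sets by (rule sets.sigma_sets_subset[OF past_cyls_events])

lemma F_mono:
  assumes "s \<le> t"
  shows "sets (F s) \<subseteq> sets (F t)"
proof -
  have "past_cyls s \<subseteq> past_cyls t"
  proof
    fix E assume "E \<in> past_cyls s"
    then obtain A P B where "E = cyl X A P B" "A \<in> sets Bar" "finite P" "\<forall>p\<in>P. snd p \<le> s" "\<forall>p. B p \<in> sets borel"
      unfolding past_cyls_def by blast
    then show "E \<in> past_cyls t" using assms by (auto intro!: past_cylsI elim: order_trans)
  qed
  then show ?thesis unfolding F_sets by (rule sigma_sets_mono')
qed

lemma Bar_F: "sets Bar \<subseteq> sets (F t)"
proof
  fix A assume "A \<in> sets Bar"
  then have "cyl X A {} (\<lambda>_. UNIV) \<in> past_cyls t" by (rule past_cylsI) simp_all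
  then have "A \<in> past_cyls t" by (simp add: cyl_def)
  then show "A \<in> sets (F t)" unfolding F_sets by (rule sigma_sets.Basic)
qed

lemma X_F:
  assumes "u \<le> t"
  shows "(\<lambda>\<omega>. X n \<omega> u) \<in> borel_measurable (F t)"
proof (rule measurableI)
  fix B :: "real set" assume B: "B \<in> sets borel"
  have "(\<lambda>\<omega>. X n \<omega> u) -` B \<inter> space (F t) = cyl X (space M) {(n, u)} (\<lambda>_. B)"
    by (auto simp: cyl_def F_space)
  moreover have "cyl X (space M) {(n, u)} (\<lambda>_. B) \<in> past_cyls t"
    using assms B sets.top[of Bar] by (intro past_cylsI) simp_all
  ultimately show "(\<lambda>\<omega>. X n \<omega> u) -` B \<inter> space (F t) \<in> sets (F t)"
    unfolding F_sets by (auto intro: sigma_sets.Basic)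
qed simp

lemma past_cyls_Int_stable: "Int_stable (past_cyls t)"
  unfolding Int_stable_def
proof (intro ballI)
  fix E E' assume E: "E \<in> past_cyls t" and E': "E' \<in> past_cyls t"
  obtain A P B where e: "E = cyl X A P B" "A \<in> sets Bar" "finite P" "\<forall>p\<in>P. snd p \<le> t" "\<forall>p. B p \<in> sets borel"
    using E unfolding past_cyls_def by blast
  obtain A' P' B' where e': "E' = cyl X A' P' B'" "A' \<in> sets Bar" "finite P'" "\<forall>p\<in>P'. snd p \<le> t" "\<forall>p. B' p \<in> sets borel"
    using E' unfolding past_cyls_def by blast
  define C where "C = (\<lambda>p. (if p \<in> P then B p else UNIV) \<inter> (if p \<in> P' then B' p else UNIV))"
  have "E \<inter> E' = cyl X (A \<inter> A') (P \<union> P') C"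
    unfolding e(1) e'(1) by (auto simp: cyl_def C_def)
  moreover have "\<forall>p. C p \<in> sets borel" using e e' by (auto simp: C_def)
  moreover have "cyl X (A \<inter> A') (P \<union> P') C \<in> past_cyls t"
    using e e' calculation(2) by (intro past_cylsI) auto
  ultimately show "E \<inter> E' \<in> past_cyls t" by simp
qed

text \<open>The cylinders are a generator of \<open>F s\<close> that is stable under intersections,
  so independence of the future event extends from them to \<open>F s\<close>.\<close>

lemma F_fut:
  assumes A: "A \<in> sets (F s)" and K: "finite K" "\<And>k. k \<in> K \<Longrightarrow> start k \<le> s" and st: "s < t" and C: "\<And>k. C k \<in> sets borel"
  shows "prob (A \<inter> fut X K s t C) = prob A * (\<Prod>k\<in>K. measure (gauss (sqrt (v * (t - s)))) (C k))"
proof -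
  let ?E = "fut X K s t C"
  have E: "?E \<in> events" using K C by (intro fut_events) auto
  have eq: "prob (a \<inter> ?E) = prob a * (\<Prod>k\<in>K. measure (gauss (sqrt (v * (t - s)))) (C k))" if "a \<in> past_cyls s" for a
  proof -
    obtain A P B where a: "a = cyl X A P B" and "A \<in> sets Bar" "finite P" "\<forall>p\<in>P. snd p \<le> s" "\<forall>p. B p \<in> sets borel"
      using \<open>a \<in> past_cyls s\<close> unfolding past_cyls_def by blast
    then show ?thesis unfolding a using K st C by (intro cyl_fut_X) blast+
  qed
  have top: "space M \<in> past_cyls s"
    using past_cylsI[of "space M" "{}" s "\<lambda>_. UNIV"] sets.top[of Bar] by (simp add: cyl_def)
  have PE: "prob ?E = (\<Prod>k\<in>K. measure (gauss (sqrt (v * (t - s)))) (C k))"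
    using eq[OF top] sets.sets_into_space[OF E] prob_space by (simp add: Int_absorb1)
  have "indep_set (past_cyls s) {?E}"
    using eq PE past_cyls_events E by (intro indep_setI) auto
  then have "indep_set (sigma_sets (space M) (past_cyls s)) (sigma_sets (space M) {?E})"
    by (rule indep_set_sigma_sets[OF _ past_cyls_Int_stable]) (simp add: Int_stable_def)
  then show ?thesis
    using A PE unfolding indep_sets2_eq F_sets by (auto intro: sigma_sets.Basic)
qed

lemma fresh1:
  assumes "start n \<le> s" "s < t"
  shows "fresh_gauss (F s) (\<lambda>\<omega>. X n \<omega> t - X n \<omega> s) (sqrt (v * (t - s)))"
  unfolding fresh_gauss_def
proof (intro conjI ballI)
  fix A and B :: "real set" assume "A \<in> sets (F s)" "B \<in> sets borel"
  moreover have "(\<lambda>\<omega>. X n \<omega> t - X n \<omega> s) -` B \<inter> space M = fut X {n} s t (\<lambda>_. B)" by (auto simp: fut_def)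
  ultimately show "prob (A \<inter> ((\<lambda>\<omega>. X n \<omega> t - X n \<omega> s) -` B \<inter> space M)) =
      prob A * measure (gauss (sqrt (v * (t - s)))) B"
    using F_fut[of A s "{n}" t "\<lambda>_. B"] assms by simp
qed measurable

text \<open>Applying \<open>F_fut\<close> to the pair \<open>{m, n}\<close> shows that the two
  increments are jointly fresh and independent; so the variances add in their difference.\<close>

lemma fresh2:
  assumes "n \<noteq> m" "start n \<le> s" "start m \<le> s" "s < t"
  shows "fresh_gauss (F s) (\<lambda>\<omega>. (X m \<omega> t - X m \<omega> s) - (X n \<omega> t - X n \<omega> s)) (sqrt (2 * v * (t - s)))"
  unfolding fresh_gauss_def
proof (intro conjI ballI)
  fix A and D :: "real set" assume A: "A \<in> sets (F s)" and D: "D \<in> sets borel"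
  let ?\<sigma> = "sqrt (v * (t - s))"
  have \<sigma>: "?\<sigma> > 0" using v_pos assms by simp
  have sq: "sqrt (?\<sigma>\<^sup>2 + ?\<sigma>\<^sup>2) = sqrt (2 * v * (t - s))" using v_pos assms by simp
  have "prob (A \<inter> ((\<lambda>\<omega>. (X m \<omega> t - X m \<omega> s) - (X n \<omega> t - X n \<omega> s)) -` D \<inter> space M)) =
      prob A * measure (gauss (sqrt (?\<sigma>\<^sup>2 + ?\<sigma>\<^sup>2))) D"
  proof (rule gauss_combine(2)[OF _ _ _ \<sigma> \<sigma> _ D])
    show "A \<in> events" using A F_events by auto
    fix B C :: "real set" assume BC: "B \<in> sets borel" "C \<in> sets borel"
    have "prob (A \<inter> fut X {m, n} s t (\<lambda>k. if k = m then B else C)) =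
        prob A * (\<Prod>k\<in>{m, n}. measure (gauss ?\<sigma>) (if k = m then B else C))"
      using assms BC by (intro F_fut[OF A]) auto
    moreover have "A \<inter> ((\<lambda>\<omega>. X m \<omega> t - X m \<omega> s) -` B \<inter> space M) \<inter> ((\<lambda>\<omega>. X n \<omega> t - X n \<omega> s) -` C \<inter> space M) =
        A \<inter> fut X {m, n} s t (\<lambda>k. if k = m then B else C)"
      using assms(1) by (auto simp: fut_def)
    ultimately show "prob (A \<inter> ((\<lambda>\<omega>. X m \<omega> t - X m \<omega> s) -` B \<inter> space M) \<inter> ((\<lambda>\<omega>. X n \<omega> t - X n \<omega> s) -` C \<inter> space M)) =
        prob A * measure (gauss ?\<sigma>) B * measure (gauss ?\<sigma>) C"
      using assms(1) by (simp add: mult.assoc)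
  qed measurable
  then show "prob (A \<inter> ((\<lambda>\<omega>. (X m \<omega> t - X m \<omega> s) - (X n \<omega> t - X n \<omega> s)) -` D \<inter> space M)) =
      prob A * measure (gauss (sqrt (2 * v * (t - s)))) D"
    unfolding sq .
qed measurable

lemma Bar_measurable_F: "f \<in> measurable Bar K \<Longrightarrow> f \<in> measurable (F t) K"
  using Bar_F[of t] by (auto simp: measurable_def F_space)

sublocale dense_web M v lam chi q X F
proof unfold_locales
  show "continuous_on UNIV (lam \<omega>)" if "\<omega> \<in> space M" for \<omega>
    using barrier that by (simp add: barrier_def)
qed (use v_pos X_cont F_space F_events F_mono X_F fresh1 fresh2 q_range lam_Bar chi_Bar in
  \<open>auto intro: Bar_measurable_F\<close>)

text \<open>On \<open>regular\<close>, \<open>X n\<close> and \<open>W n\<close> differ after the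
  birth only by a constant, which \<open>rab_shift\<close> removes.\<close>

lemma lines_eq:
  assumes w: "\<omega> \<in> space M" "\<omega> \<in> regular" and n: "q n \<in> strict_epigraph (lam \<omega>)" and y: "birth n \<le> y"
  shows "coalescing_line (lam \<omega>) q (\<lambda>n. rab (lam \<omega>) (chi \<omega>) (W n \<omega>) (q n)) n y = L n \<omega> y"
proof -
  interpret f: rab_family "lam \<omega>" "chi \<omega>" q "\<lambda>n. X n \<omega>" by (rule fam[OF w(1)])
  show ?thesis
  proof (rule f.coalescing_line_cong[OF _ n y])
    fix n y assume n: "q n \<in> strict_epigraph (lam \<omega>)" and y: "birth n \<le> y"
    have "rab (lam \<omega>) (chi \<omega>) (W n \<omega>) (birth n, snd (q n)) y =
        rab (lam \<omega>) (chi \<omega>) (\<lambda>u. X n \<omega> u + W n \<omega> (birth n)) (birth n, snd (q n)) y"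
      using w(2) y by (intro rab_cong) (auto simp: X_def Y_def max_def)
    also have "\<dots> = rab (lam \<omega>) (chi \<omega>) (X n \<omega>) (birth n, snd (q n)) y"
      by (rule rab_shift[OF f.l_cont f.X_cont f.alive_less[OF n] y])
    finally show "rab (lam \<omega>) (chi \<omega>) (W n \<omega>) (q n) y = f.R n y" by (simp add: f.R_def)
  qed
qed

end

lemma (in driven_web) good_imp_good_lines:
  assumes w: "\<omega> \<in> space M" "\<omega> \<in> regular" and g: "good \<omega>"
    and \<Lambda>: "\<forall>(x, h)\<in>strict_epigraph (lam \<omega>). \<forall>y\<ge>x. \<Lambda> (x, h) y =
      Sup {coalescing_line (lam \<omega>) q (\<lambda>n. rab (lam \<omega>) (chi \<omega>) (W n \<omega>) (q n)) n y | n.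
        q n \<in> strict_epigraph (lam \<omega>) \<and> fst (q n) < x \<and>
        coalescing_line (lam \<omega>) q (\<lambda>n. rab (lam \<omega>) (chi \<omega>) (W n \<omega>) (q n)) n x < h}"
  shows "good_lines (lam \<omega>) q (\<lambda>n. L n \<omega>) \<Lambda>"
proof -
  interpret f: rab_family "lam \<omega>" "chi \<omega>" q "\<lambda>n. X n \<omega>" by (rule fam[OF w(1)])
  have \<Lambda>': "\<Lambda> (x, h) y = Sup {L n \<omega> y | n. alive n \<omega> \<and> birth n < x \<and> L n \<omega> x < h}"
    if xh: "(x, h) \<in> strict_epigraph (lam \<omega>)" and y: "x \<le> y" for x h y
  proof -
    let ?C = "coalescing_line (lam \<omega>) q (\<lambda>n. rab (lam \<omega>) (chi \<omega>) (W n \<omega>) (q n))"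
    have C: "?C n z = L n \<omega> z" if "alive n \<omega>" "birth n < x" "x \<le> z" for n z
      using lines_eq[OF w that(1), of z] that by simp
    have "{?C n y | n. alive n \<omega> \<and> birth n < x \<and> ?C n x < h} =
        {L n \<omega> y | n. alive n \<omega> \<and> birth n < x \<and> L n \<omega> x < h}"
    proof (intro set_eqI iffI)
      fix z assume "z \<in> {?C n y | n. alive n \<omega> \<and> birth n < x \<and> ?C n x < h}"
      then obtain n where "z = ?C n y" "alive n \<omega>" "birth n < x" "?C n x < h" by blast
      then show "z \<in> {L n \<omega> y | n. alive n \<omega> \<and> birth n < x \<and> L n \<omega> x < h}"
        using C[of n x] C[of n y] y by (intro CollectI exI[of _ n]) simp
    next
      fix z assume "z \<in> {L n \<omega> y | n. alive n \<omega> \<and> birth n < x \<and> L n \<omega> x < h}"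
      then obtain n where "z = L n \<omega> y" "alive n \<omega>" "birth n < x" "L n \<omega> x < h" by blast
      then show "z \<in> {?C n y | n. alive n \<omega> \<and> birth n < x \<and> ?C n x < h}"
        using C[of n x] C[of n y] y by (intro CollectI exI[of _ n]) simp
    qed
    moreover have "\<Lambda> (x, h) y = Sup {?C n y | n. alive n \<omega> \<and> birth n < x \<and> ?C n x < h}"
      using bspec[OF \<Lambda> xh] y by simp
    ultimately show ?thesis by simp
  qed
  note g = g[unfolded good_def]
  show ?thesis
  proof (rule good_lines.intro)
    show "\<exists>n. alive n \<omega> \<and> birth n < x \<and> L n \<omega> x \<in> {a<..<b}" if "lam \<omega> x \<le> a" "a < b" for x a b
      using g that by blast
    show "\<exists>n. alive n \<omega> \<and> birth n < x \<and> c < L n \<omega> y" if "x < y" for x y c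
      using g that by blast
    show "finite {L n \<omega> t | n. alive n \<omega> \<and> birth n \<le> s \<and> L n \<omega> s < c}"
      if "s \<in> dyadic_rationals" "t \<in> dyadic_rationals" "s < t" for s t c
      using g that by blast
    show "\<exists>m. alive m \<omega> \<and> birth m = birth n \<and> snd (q m) < snd (q n) \<and> L m \<omega> b = L n \<omega> b"
      if "alive n \<omega>" "birth n < b" for n b
      using g that by blast
  qed (fact f.L_continuous f.L_start f.L_ge f.L_coalesce f.L_mono \<Lambda>')+
qed

theorem theorem7:
  fixes M :: "'a measure"
    and v :: real
    and lam :: "'a \<Rightarrow> real \<Rightarrow> real"
    and chi :: "'a \<Rightarrow> real"
    and q :: "nat \<Rightarrow> real \<times> real"
    and \<Lambda> :: "'a \<Rightarrow> real \<times> real \<Rightarrow> real \<Rightarrow> real"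
  assumes "prob_space M"
    and "v > 0"
    and "barrier M lam chi"
    and "forward_line_system M v lam chi q \<Lambda>"
  shows "AE \<omega> in M.
    (\<forall>x. closure (line_values (lam \<omega>) (\<Lambda> \<omega>) x x) = {lam \<omega> x..}) \<and>
    (\<forall>x y. x < y \<longrightarrow>
      locally_finite_set (line_values (lam \<omega>) (\<Lambda> \<omega>) x y) \<and>
      \<not> bounded (line_values (lam \<omega>) (\<Lambda> \<omega>) x y)) \<and>
    (\<forall>x h \<epsilon>. (x, h) \<in> strict_epigraph (lam \<omega>) \<longrightarrow> \<epsilon> > 0 \<longrightarrow>
      (\<exists>n. q n \<in> strict_epigraph (lam \<omega>) \<and> fst (q n) < x \<and>
        \<Lambda> \<omega> (q n) x \<in> {h - \<epsilon><..<h} \<and>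
        (\<forall>y\<ge>x + \<epsilon>. \<Lambda> \<omega> (x, h) y = \<Lambda> \<omega> (q n) y))) \<and>
    (\<forall>x y. x < y \<longrightarrow>
      line_values (lam \<omega>) (\<Lambda> \<omega>) x y =
        {\<Lambda> \<omega> (q n) y | n. fst (q n) < x \<and> q n \<in> strict_epigraph (lam \<omega>)}) \<and>
    (\<forall>x h. (x, h) \<in> strict_epigraph (lam \<omega>) \<longrightarrow> continuous_on {x..} (\<Lambda> \<omega> (x, h)))"
proof -
  interpret prob_space M by fact
  obtain a W where bij: "bij_betw q UNIV (dyadic_rationals \<times> dyadic_rationals)"
    and aW: "\<And>n. a n \<le> fst (q n)" "\<And>n. brownian_motion M v (a n) (W n)"
    and joint: "jointly_independent M lam chi a W"
    and \<Lambda>: "\<And>\<omega>. \<omega> \<in> space M \<Longrightarrow> \<forall>(x, h)\<in>strict_epigraph (lam \<omega>). \<forall>y\<ge>x. \<Lambda> \<omega> (x, h) y =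
      Sup {coalescing_line (lam \<omega>) q (\<lambda>n. rab (lam \<omega>) (chi \<omega>) (W n \<omega>) (q n)) n y | n.
        q n \<in> strict_epigraph (lam \<omega>) \<and> fst (q n) < x \<and>
        coalescing_line (lam \<omega>) q (\<lambda>n. rab (lam \<omega>) (chi \<omega>) (W n \<omega>) (q n)) n x < h}"
    using assms(4) unfolding forward_line_system_def Let_def by blast
  interpret driven_web M v lam chi q a W
    using assms(2,3) bij aW joint by unfold_locales (auto simp: bij_betw_def)
  show ?thesis
    using AE_good AE_regular AE_space
    by eventually_elim (rule good_lines.conclusion[OF good_imp_good_lines[OF _ _ _ \<Lambda>]])
qed

end
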